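(* Assume regularly varying tails $\mu(y\in Y:\varphi(y)>n)=\ell(n)n^{-\beta}$ and hypotheses (H1) and (H2) of the context. If $\beta\in(\frac12,1]$, then $$\lim_{n\to\infty}m(n)n^{1-\beta}T_n=d_\beta P$$ in the operator norm on $\mathcal{B}$, i.e. $\sup_{v\in\mathcal{B},\,\|v\|=1}\bigl\|m(n)n^{1-\beta}T_nv-d_\beta\int_Yv\,d\mu\bigr\|\to0$ as $n\to\infty$.
   Context: Setting. $(X,\mu)$ is an infinite measure space, $f:X\to X$ a conservative measure preserving map, $Y\subset X$ measurable with $\mu(Y)\in(0,\infty)$, and $\mu$ is rescaled so that $\mu(Y)=1$. Let $\varphi:Y\to\mathbb{Z}^+$, $\varphi(y)=\inf\{n\ge1:f^ny\in Y\}$ (finite a.e.), and $F=f^\varphi:Y\to Y$ the first return map. It is assumed that $\mu(y\in Y:\varphi(y)>n)=\ell(n)n^{-\beta}$ where $\beta\in(0,1]$ and $\ell:(0,\infty)\to(0,\infty)$ is slowly varying (measurable with $\lim_{x\to\infty}\ell(\lambda x)/\ell(x)=1$ for all $\lambda>0$). Let $L:L^1(X)\to L^1(X)$ and $R:L^1(Y)\to L^1(Y)$ be the transfer operators of $f$ and $F$: $\int_XLv\,w\,d\mu=\int_Xv\,w\circ f\,d\mu$ and $\int_YRv\,w\,d\mu=\int_Yv\,w\circ F\,d\mu$ for bounded measurable $w$. For $v$ on $Y$ set $T_nv=1_YL^n(1_Yv)$ ($n\ge0$), $R_nv=R(1_{\{\varphi=n\}}v)$ ($n\ge1$), and $R(z)v=R(z^\varphi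 v)=\sum_{n\ge1}z^nR_nv$ for $z\in\bar{\mathbb{D}}=\{z\in\mathbb{C}:|z|\le1\}$. $\mathcal{B}\subset L^\infty(Y)$ is a (real) Banach space of functions containing the constants with norm satisfying $|v|_\infty\le\|v\|$ (complexified when $z$ is complex), such that: (H1) there is $C>0$ such that for all $n\ge1$, $R_n:\mathcal{B}\to\mathcal{B}$ is bounded with $\|R_n\|\le C\mu(\varphi=n)$. (H2) (i) the eigenvalue $1$ is simple and isolated in the spectrum of $R(1):\mathcal{B}\to\mathcal{B}$; (ii) for $z\in\bar{\mathbb{D}}\setminus\{1\}$ the spectrum of $R(z):\mathcal{B}\to\mathcal{B}$ does not contain $1$. $P$ is the spectral projection of $R(1)$ for the eigenvalue $1$: $Pv\equiv\int_Yv\,d\mu$. $d_\beta=\frac1\pi\sin\beta\pi$ for $\beta\in(0,1)$, $d_1=1$; $m(n)=\ell(n)$ for $\beta\in(0,1)$, and $m(n)=\sum_{j=1}^n\ell(j)j^{-1}$ for $\beta=1$.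
   Formalization: For β=1 it is additionally assumed that the return time φ is not integrable over Y; without this the claim fails, since if ∫φ is finite (possible when part of X never visits Y) then T_n→P/∫φ while m(n)→∫φ−1. *)

theory Defs
  imports "HOL-Analysis.Analysis" "HOL-Probability.Essential_Supremum"
begin

section \<open>Dynamics\<close>

definition wandering :: "'a measure \<Rightarrow> ('a \<Rightarrow> 'a) \<Rightarrow> 'a set \<Rightarrow> bool" where
  "wandering M f W \<longleftrightarrow> W \<in> sets M \<and> disjoint_family (\<lambda>n. (f ^^ n) -` W \<inter> space M)"

definition conservative :: "'a measure \<Rightarrow> ('a \<Rightarrow> 'a) \<Rightarrow> bool" where
  "conservative M f \<longleftrightarrow> (\<forall>W. wandering M f W \<longrightarrow> W \<in> null_sets M)"

definition measure_preserving_map :: "'a measure \<Rightarrow> ('a \<Rightarrow> 'a) \<Rightarrow> bool" where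
  "measure_preserving_map M f \<longleftrightarrow> f \<in> measurable M M \<and> distr M M f = M"

text \<open>Points of \<open>Y\<close> that never return to \<open>Y\<close> (a null set when \<open>f\<close> is conservative) get the
  dummy return time \<open>0\<close>, so that \<open>return_map f Y\<close> always maps \<open>Y\<close> into itself.\<close>

definition return_time :: "('a \<Rightarrow> 'a) \<Rightarrow> 'a set \<Rightarrow> 'a \<Rightarrow> nat" where
  "return_time f Y y =
     (if \<exists>n\<ge>1. (f ^^ n) y \<in> Y then Inf {n. n \<ge> 1 \<and> (f ^^ n) y \<in> Y} else 0)"

definition return_map :: "('a \<Rightarrow> 'a) \<Rightarrow> 'a set \<Rightarrow> 'a \<Rightarrow> 'a" where
  "return_map f Y y = (f ^^ return_time f Y y) y"

text \<open>Elements of \<open>L\<^sup>1\<close> are handled through representatives. The duality relation determines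
  \<open>A v\<close> up to null sets and makes \<open>A\<close> compatible with a.e. equality and a.e. linear.\<close>

definition transfer_operator ::
  "'a measure \<Rightarrow> ('a \<Rightarrow> 'a) \<Rightarrow> (('a \<Rightarrow> real) \<Rightarrow> ('a \<Rightarrow> real)) \<Rightarrow> bool" where
  "transfer_operator N g A \<longleftrightarrow>
     (\<forall>v. integrable N v \<longrightarrow> integrable N (A v) \<and>
       (\<forall>w \<in> borel_measurable N. (\<exists>K. \<forall>x\<in>space N. \<bar>w x\<bar> \<le> K) \<longrightarrow>
          (\<integral>x. A v x * w x \<partial>N) = (\<integral>x. v x * w (g x) \<partial>N)))"

definition slowly_varying :: "(real \<Rightarrow> real) \<Rightarrow> bool" where
  "slowly_varying l \<longleftrightarrow>
     l \<in> borel_measurable (restrict_space borel {0<..}) \<and> (\<forall>x>0. l x > 0) \<and>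
     (\<forall>c>0. ((\<lambda>x. l (c * x) / l x) \<longlongrightarrow> 1) at_top)"

definition d_const :: "real \<Rightarrow> real" where
  "d_const \<beta> = (if \<beta> = 1 then 1 else sin (\<beta> * pi) / pi)"

text \<open>If \<open>\<mu>(\<phi> > n) = l(n)/n\<close> for \<open>n \<ge> 1\<close>, then \<open>m_seq l 1\<close> tends to \<open>(\<integral>\<phi>) - 1\<close>, which is infinite
  only if the return time \<open>\<phi>\<close> is not integrable. Infinite total measure alone does not ensure
  this when some part of the space never visits the inducing set.\<close>

definition m_seq :: "(real \<Rightarrow> real) \<Rightarrow> real \<Rightarrow> nat \<Rightarrow> real" where
  "m_seq l \<beta> n = (if \<beta> = 1 then (\<Sum>j=1..n. l (real j) / real j) else l (real n))"

section \<open>Banach spaces of bounded functions\<close>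

text \<open>A Banach space inside \<open>L\<^sup>\<infinity>(N)\<close> that contains the constants is a type \<open>'b\<close> of class
  \<^class>\<open>banach\<close> with a map \<open>\<iota>\<close> choosing a representative of each element. \<open>\<iota>\<close> is linear
  and injective modulo null sets, so \<open>'b\<close> is identified with a space of a.e. classes.\<close>

definition banach_function_space :: "'a measure \<Rightarrow> ('b::banach \<Rightarrow> 'a \<Rightarrow> real) \<Rightarrow> bool" where
  "banach_function_space N \<iota> \<longleftrightarrow>
     (\<forall>v. \<iota> v \<in> borel_measurable N) \<and>
     (\<forall>u v. AE y in N. \<iota> (u + v) y = \<iota> u y + \<iota> v y) \<and>
     (\<forall>c v. AE y in N. \<iota> (c *\<^sub>R v) y = c * \<iota> v y) \<and>
     (\<forall>v. (AE y in N. \<iota> v y = 0) \<longrightarrow> v = 0) \<and>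
     (\<forall>v. esssup N (\<lambda>y. ereal \<bar>\<iota> v y\<bar>) \<le> ereal (norm v)) \<and>
     (\<forall>c. \<exists>e. AE y in N. \<iota> e y = c)"

text \<open>\<open>A\<close> maps the function space into itself, and \<open>T\<close> is the bounded operator it induces.\<close>

definition induces :: "'a measure \<Rightarrow> ('b::banach \<Rightarrow> 'a \<Rightarrow> real) \<Rightarrow>
    (('a \<Rightarrow> real) \<Rightarrow> ('a \<Rightarrow> real)) \<Rightarrow> ('b \<Rightarrow>\<^sub>L 'b) \<Rightarrow> bool" where
  "induces N \<iota> A T \<longleftrightarrow> (\<forall>v. AE y in N. \<iota> (blinfun_apply T v) y = A (\<iota> v) y)"

lemma induces_unique:
  assumes B: "banach_function_space N \<iota>" and S: "induces N \<iota> A S" and T: "induces N \<iota> A T"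
  shows "S = T"
proof (rule blinfun_eqI)
  fix v
  have add: "AE y in N. \<iota> (S v + (-1) *\<^sub>R T v) y = \<iota> (S v) y + \<iota> ((-1) *\<^sub>R T v) y"
    and scale: "AE y in N. \<iota> ((-1) *\<^sub>R T v) y = (-1) * \<iota> (T v) y"
    using B unfolding banach_function_space_def by blast+
  have "AE y in N. \<iota> (S v) y = A (\<iota> v) y" "AE y in N. \<iota> (T v) y = A (\<iota> v) y"
    using S T unfolding induces_def by blast+
  with add scale have "AE y in N. \<iota> (S v + (-1) *\<^sub>R T v) y = 0"
    by eventually_elim simp
  then have "S v + (-1) *\<^sub>R T v = 0"
    using B unfolding banach_function_space_def by blast
  then show "blinfun_apply S v = blinfun_apply T v" by simp
qed

section \<open>Complexification and spectrum\<close>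

text \<open>The complexification of \<open>'b\<close> is \<open>'b \<times> 'b\<close>, where \<open>(x, y)\<close> stands for \<open>x + i y\<close>. The
  product norm is equivalent to the usual complexification norms, and invertibility, spectra
  and contour integrals of operators depend only on the topology. The notions below are meant
  for operators that commute with all \<open>cscale c\<close>; their inverses then do as well.\<close>

lift_definition cscale :: "complex \<Rightarrow> ('b \<times> 'b) \<Rightarrow>\<^sub>L ('b::banach \<times> 'b)" is
  "\<lambda>c (x, y). (Re c *\<^sub>R x - Im c *\<^sub>R y, Im c *\<^sub>R x + Re c *\<^sub>R y)"
  unfolding split_beta by (intro bounded_linear_intros)

lift_definition complexify :: "('b::banach \<Rightarrow>\<^sub>L 'b) \<Rightarrow> ('b \<times> 'b) \<Rightarrow>\<^sub>L ('b \<times> 'b)" is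
  "\<lambda>T (x, y). (T x, T y)"
  unfolding split_beta
  by (intro bounded_linear_Pair bounded_linear_compose[OF _ bounded_linear_fst]
      bounded_linear_compose[OF _ bounded_linear_snd])

definition inverse_blinfun :: "('c::real_normed_vector \<Rightarrow>\<^sub>L 'c) \<Rightarrow> ('c \<Rightarrow>\<^sub>L 'c) \<Rightarrow> bool" where
  "inverse_blinfun T S \<longleftrightarrow> S o\<^sub>L T = id_blinfun \<and> T o\<^sub>L S = id_blinfun"

definition cspectrum :: "(('b::banach \<times> 'b) \<Rightarrow>\<^sub>L ('b \<times> 'b)) \<Rightarrow> complex set" where
  "cspectrum T = {c. \<nexists>S. inverse_blinfun (cscale c - T) S}"

definition resolvent :: "(('b::banach \<times> 'b) \<Rightarrow>\<^sub>L ('b \<times> 'b)) \<Rightarrow> complex \<Rightarrow> ('b \<times> 'b) \<Rightarrow>\<^sub>L ('b \<times> 'b)" where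
  "resolvent T c = (THE S. inverse_blinfun (cscale c - T) S)"

text \<open>The Riesz integral \<open>(1 / (2 \<pi> i)) \<integral> (\<zeta> - T)\<^sup>-\<^sup>1 d\<zeta>\<close> over the circle
  \<open>\<zeta> = c + r exp(i t)\<close>. At an isolated point \<open>c\<close> of the spectrum it does not depend on
  \<open>r\<close> once \<open>r\<close> is small, and its value is the spectral projection.\<close>

definition riesz_integral ::
  "(('b::banach \<times> 'b) \<Rightarrow>\<^sub>L ('b \<times> 'b)) \<Rightarrow> complex \<Rightarrow> real \<Rightarrow> ('b \<times> 'b) \<Rightarrow>\<^sub>L ('b \<times> 'b)" where
  "riesz_integral T c r = (1 / (2 * pi)) *\<^sub>R
     integral {0..2*pi} (\<lambda>t. cscale (of_real r * cis t) o\<^sub>L resolvent T (c + of_real r * cis t))"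

definition spectral_projection ::
  "(('b::banach \<times> 'b) \<Rightarrow>\<^sub>L ('b \<times> 'b)) \<Rightarrow> complex \<Rightarrow> ('b \<times> 'b) \<Rightarrow>\<^sub>L ('b \<times> 'b)" where
  "spectral_projection T c = (THE Q. \<forall>\<^sub>F r in at_right 0. riesz_integral T c r = Q)"

text \<open>Simplicity of an isolated eigenvalue is algebraic: its spectral projection has
  (complex) rank one.\<close>

definition simple_isolated_eigenvalue ::
  "(('b::banach \<times> 'b) \<Rightarrow>\<^sub>L ('b \<times> 'b)) \<Rightarrow> complex \<Rightarrow> bool" where
  "simple_isolated_eigenvalue T c \<longleftrightarrow>
     c isolated_in cspectrum T \<and>
     (\<exists>x. x \<noteq> 0 \<and> blinfun_apply T x = blinfun_apply (cscale c) x) \<and>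
     (\<exists>e. e \<noteq> 0 \<and> range (blinfun_apply (spectral_projection T c)) =
        range (\<lambda>a. blinfun_apply (cscale a) e))"

text \<open>\<open>R(z) = \<Sum>\<^sub>n\<^sub>\<ge>\<^sub>1 z\<^sup>n R\<^sub>n\<close>, convergent in operator norm; \<open>Rn 0\<close> is not used.\<close>

definition R_z :: "(nat \<Rightarrow> 'b::banach \<Rightarrow>\<^sub>L 'b) \<Rightarrow> complex \<Rightarrow> ('b \<times> 'b) \<Rightarrow>\<^sub>L ('b \<times> 'b)" where
  "R_z Rn z = (\<Sum>n. cscale (z ^ Suc n) o\<^sub>L complexify (Rn (Suc n)))"

end

theory Submission
  imports Defs "HOL-Probability.Probability_Measure"
begin

text \<open>
  Write \<open>p n = \<mu>(\<phi> > n)\<close>, \<open>M n = \<Sum>\<^sub>k\<^sub><\<^sub>n p k\<close> and \<open>\<alpha> = 1 - \<beta>\<close>. The operators \<open>T\<^sub>n\<close> and \<open>R\<^sub>n\<close>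
  satisfy the renewal equation \<open>T\<^sub>n = \<Sum>\<^sub>j T\<^sub>n\<^sub>-\<^sub>j R\<^sub>j\<close>, because a point of \<open>Y\<close> that is in \<open>Y\<close> again at
  time \<open>n\<close> has a first return at some time \<open>j \<le> n\<close>. So, for \<open>|z| < 1\<close>, the \<open>T\<^sub>n\<close> are the Taylor
  coefficients of \<open>T(z) = (1 - R(z))\<^sup>-\<^sup>1\<close>. The theorem is deduced from the statement
  \<open>M n T\<^sub>n \<rightarrow> P / (\<Gamma>(1 - \<alpha>) \<Gamma>(1 + \<alpha>))\<close>, which treats all \<open>\<beta> \<in> (1/2, 1]\<close> alike. It is translated at
  the end: for \<open>\<beta> < 1\<close> the monotone density theorem gives \<open>n p n / M n \<rightarrow> \<alpha>\<close>, and the reflection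
  formula of the Gamma function turns the constant into \<open>sin(\<pi>\<beta>)/\<pi>\<close>; for \<open>\<beta> = 1\<close> the given
  normalising sequence is \<open>M (n + 1) - 1\<close>.

  In the closed unit disc \<open>T(z)\<close> is singular only at \<open>z = 1\<close>. Since \<open>P R(z) P = (1 - \<delta>(z)) P\<close> with
  \<open>\<delta>(z) = (1 - z) \<Sum>\<^sub>k p k z\<^sup>k\<close>, and since \<open>\<parallel>R(1) - R(z)\<parallel>\<close> is near \<open>1\<close> at most a constant times \<open>|\<delta>(z)|\<close>,
  inverting \<open>1 - R(z)\<close> on the range of \<open>P\<close> and on its complement gives \<open>\<delta>(z) T(z) \<rightarrow> P\<close> as
  \<open>z \<rightarrow> 1\<close> (lemma \<open>resolvent_near_simple_eigenvalue\<close>). The complement is handled by the reduced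
  resolvent of \<open>R(1)\<close>, which exists by the spectral hypothesis (lemma \<open>reduced_resolvent\<close>). An
  Abelian theorem (lemma \<open>abelian\<close>) says that \<open>\<delta>(z)\<close> is close to \<open>\<Gamma>(1 + \<alpha>) n\<^sup>-\<^sup>\<alpha> M n (1 - z)\<^sup>1\<^sup>-\<^sup>\<alpha>\<close> when \<open>|1 - z|\<close>
  is of order \<open>1/n\<close>.

  Let \<open>G\<^sub>n(z) = M n T(z) - n\<^sup>\<alpha> (1 - z)\<^sup>\<alpha>\<^sup>-\<^sup>1 P / \<Gamma>(1 + \<alpha>)\<close>. The coefficients of \<open>(1 - z)\<^sup>\<alpha>\<^sup>-\<^sup>1\<close> are known
  explicitly, so it remains to show that the \<open>n\<close>-th coefficient of \<open>G\<^sub>n\<close> tends to \<open>0\<close>. That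
  coefficient is estimated by Cauchy's formula on the circle of radius \<open>exp(-1/n)\<close>, with a device
  from Fourier analysis: turning the circle by \<open>\<pi>/n\<close> changes the sign of \<open>z\<^sup>n\<close>, so that \<open>G\<^sub>n(z)\<close> may
  be replaced by half of the difference \<open>G\<^sub>n(z) - G\<^sub>n(z e\<^sup>i\<^sup>\<pi>\<^sup>/\<^sup>n)\<close> (lemma \<open>holomorphic_coefficient_bound\<close>). By the resolvent
  identity this difference contains two factors \<open>T\<close>. In the variable \<open>x = n arg z\<close> the integrand
  is then bounded by a multiple of \<open>(1 + |x|)\<^sup>2\<^sup>\<gamma>\<^sup>-\<^sup>2\<close> for any fixed \<open>\<gamma> > \<alpha>\<close>, by Potter's bound for \<open>M\<close>. Because
  \<open>\<alpha> < 1/2\<close> one can choose \<open>\<gamma> < 1/2\<close>, so that this bound is integrable: this is where \<open>\<beta> > 1/2\<close> enters.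
  The integrand tends to \<open>0\<close> pointwise by the behaviour of \<open>T\<close> near \<open>1\<close>, and dominated convergence
  finishes the proof (theorem \<open>renewal_asymptotics\<close>).
\<close>

section \<open>Operators on the complexification\<close>

interpretation blinfun_compose: bounded_bilinear "(o\<^sub>L)"
  by (rule bounded_bilinear_blinfun_compose)

lemmas blinfun_compose_simps =
  blinfun_compose.add_left blinfun_compose.add_right blinfun_compose.diff_left
  blinfun_compose.diff_right blinfun_compose.minus_left blinfun_compose.minus_right
  blinfun_compose.scaleR_left blinfun_compose.scaleR_right

lemma blinfun_compose_assoc: "(A o\<^sub>L B) o\<^sub>L C = A o\<^sub>L (B o\<^sub>L C)"
  by (rule blinfun_eqI) simp

lemma id_blinfun_compose [simp]: "id_blinfun o\<^sub>L A = A" "A o\<^sub>L id_blinfun = A"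
  by (auto intro: blinfun_eqI)

lemma cscale_apply: "cscale c v = (Re c *\<^sub>R fst v - Im c *\<^sub>R snd v, Im c *\<^sub>R fst v + Re c *\<^sub>R snd v)"
  by (simp add: cscale.rep_eq split_beta)

lemma complexify_apply: "complexify T v = (T (fst v), T (snd v))"
  by (simp add: complexify.rep_eq split_beta)

lemma cscale_add: "cscale (a + b) = cscale a + cscale b"
  by (rule blinfun_eqI) (simp add: cscale_apply blinfun.bilinear_simps algebra_simps)

lemma cscale_scaleR: "cscale (r *\<^sub>R a) = r *\<^sub>R cscale a"
  by (rule blinfun_eqI) (simp add: cscale_apply blinfun.bilinear_simps algebra_simps)

lemma cscale_mult: "cscale (a * b) = cscale a o\<^sub>L cscale b"
  by (rule blinfun_eqI) (simp add: cscale_apply algebra_simps)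

lemma cscale_1 [simp]: "cscale 1 = id_blinfun"
  by (rule blinfun_eqI) (simp add: cscale_apply)

lemma cscale_of_real: "cscale (of_real r) = r *\<^sub>R id_blinfun"
  by (rule blinfun_eqI) (simp add: cscale_apply blinfun.bilinear_simps scaleR_prod_def)

text \<open>The product norm on \<open>'b \<times> 'b\<close> is not a complex norm: rotations need not be isometries.
Hence the factor \<open>2\<close>, which all later estimates carry along.\<close>

lemma norm_cscale: "norm (cscale c) \<le> 2 * cmod c"
proof (rule norm_blinfun_bound)
  fix v :: "'a \<times> 'a"
  define a b x y where "a = \<bar>Re c\<bar>" "b = \<bar>Im c\<bar>" "x = norm (fst v)" "y = norm (snd v)"
  have "(norm (cscale c v))^2 = (norm (Re c *\<^sub>R fst v - Im c *\<^sub>R snd v))^2 + (norm (Im c *\<^sub>R fst v + Re c *\<^sub>R snd v))^2"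
    by (simp add: cscale_apply norm_Pair)
  also have "\<dots> \<le> (a * x + b * y)^2 + (b * x + a * y)^2"
    unfolding a_b_x_y_def
    by (intro add_mono power_mono order_trans[OF norm_triangle_ineq4] order_trans[OF norm_triangle_ineq]) auto
  also have "\<dots> \<le> 2 * (a * x + b * y)^2 + 2 * (a * y - b * x)^2 + (b * x + a * y)^2 * 2 + 2 * (a * x - b * y)^2"
    using zero_le_power2[of "a * x + b * y"] zero_le_power2[of "a * y - b * x"]
      zero_le_power2[of "b * x + a * y"] zero_le_power2[of "a * x - b * y"] by linarith
  also have "\<dots> = 4 * ((a\<^sup>2 + b\<^sup>2) * (x\<^sup>2 + y\<^sup>2))"
    by (simp add: algebra_simps power2_eq_square)
  also have "\<dots> = (2 * cmod c * norm v)\<^sup>2"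
    by (simp add: a_b_x_y_def cmod_power2 norm_prod_def power_mult_distrib)
  finally show "norm (cscale c v) \<le> 2 * cmod c * norm v"
    by (rule power2_le_imp_le) simp
qed simp

lemma bounded_linear_cscale: "bounded_linear cscale"
  by (rule bounded_linear_intro[where K = 2])
    (use norm_cscale in \<open>auto simp: cscale_add cscale_scaleR mult.commute[of _ 2]\<close>)

lemma cscale_0 [simp]: "cscale 0 = 0"
  using bounded_linear_cscale by (rule linear_simps)

lemma cscale_diff: "cscale (a - b) = cscale a - cscale b"
  using bounded_linear_cscale by (rule linear_simps)

lemma norm_cscale_compose: "norm (cscale c o\<^sub>L A) \<le> 2 * cmod c * norm A"
  by (rule order_trans[OF norm_blinfun_compose]) (simp add: norm_cscale mult_right_mono)

lemma norm_compose_cscale: "norm (A o\<^sub>L cscale c) \<le> 2 * cmod c * norm A"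
  by (rule order_trans[OF norm_blinfun_compose])
    (metis mult.commute norm_cscale mult_right_mono norm_ge_zero)

lemma complexify_add: "complexify (A + B) = complexify A + complexify B"
  by (rule blinfun_eqI) (simp add: complexify_apply blinfun.bilinear_simps)

lemma complexify_scaleR: "complexify (r *\<^sub>R A) = r *\<^sub>R complexify A"
  by (rule blinfun_eqI) (simp add: complexify_apply blinfun.bilinear_simps)

lemma complexify_compose: "complexify (A o\<^sub>L B) = complexify A o\<^sub>L complexify B"
  by (rule blinfun_eqI) (simp add: complexify_apply)

lemma complexify_id [simp]: "complexify id_blinfun = id_blinfun"
  by (rule blinfun_eqI) (simp add: complexify_apply)

lemma norm_complexify: "norm (complexify A) \<le> norm A"
proof (rule norm_blinfun_bound)
  fix v
  have "(norm (complexify A v))^2 = (norm (A (fst v)))^2 + (norm (A (snd v)))^2"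
    by (simp add: complexify_apply norm_Pair)
  also have "\<dots> \<le> (norm A * norm (fst v))^2 + (norm A * norm (snd v))^2"
    by (intro add_mono power_mono norm_blinfun) auto
  also have "\<dots> = (norm A * norm v)\<^sup>2"
    by (simp add: norm_prod_def power_mult_distrib algebra_simps)
  finally show "norm (complexify A v) \<le> norm A * norm v"
    by (rule power2_le_imp_le) simp
qed simp

lemma norm_le_complexify: "norm A \<le> norm (complexify A)"
proof (rule norm_blinfun_bound)
  fix v
  have "norm (A v) = norm (complexify A (v, 0))"
    by (simp add: complexify_apply blinfun.bilinear_simps norm_Pair)
  also have "\<dots> \<le> norm (complexify A) * norm (v, 0::'a)"
    by (rule norm_blinfun)
  finally show "norm (A v) \<le> norm (complexify A) * norm v"
    by (simp add: norm_Pair)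
qed simp

lemma bounded_linear_complexify: "bounded_linear complexify"
  by (rule bounded_linear_intro[where K = 1])
    (auto simp: complexify_add complexify_scaleR norm_complexify)

lemma complexify_diff: "complexify (A - B) = complexify A - complexify B"
  using bounded_linear_complexify by (rule linear_simps)

text \<open>Operators on \<open>'b \<times> 'b\<close> are only real linear by type. Moving scalars past an operator needs
the following condition.\<close>

definition complex_linear :: "(('b::banach \<times> 'b) \<Rightarrow>\<^sub>L ('b \<times> 'b)) \<Rightarrow> bool" where
  "complex_linear A \<longleftrightarrow> (\<forall>c. A o\<^sub>L cscale c = cscale c o\<^sub>L A)"

lemma complex_linear_cscale: "complex_linear (cscale c)"
  unfolding complex_linear_def by (simp add: cscale_mult[symmetric] mult.commute)

lemma complex_linear_id: "complex_linear id_blinfun"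
  by (simp add: complex_linear_def)

lemma complex_linear_complexify: "complex_linear (complexify A)"
  unfolding complex_linear_def
  by (auto intro!: blinfun_eqI simp: cscale_apply complexify_apply blinfun.bilinear_simps)

lemma complex_linear_compose: "complex_linear A \<Longrightarrow> complex_linear B \<Longrightarrow> complex_linear (A o\<^sub>L B)"
  unfolding complex_linear_def by (simp add: blinfun_compose_assoc) (simp add: blinfun_compose_assoc[symmetric])

lemma complex_linear_diff: "complex_linear A \<Longrightarrow> complex_linear B \<Longrightarrow> complex_linear (A - B)"
  unfolding complex_linear_def by (simp add: blinfun_compose_simps)

lemma complex_linear_suminf:
  assumes "\<And>n. complex_linear (A n)" "summable A"
  shows "complex_linear (\<Sum>n. A n)"
  unfolding complex_linear_def
proof
  fix c
  have "(\<Sum>n. A n) o\<^sub>L cscale c = (\<Sum>n. A n o\<^sub>L cscale c)"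
    by (rule bounded_linear.suminf[OF blinfun_compose.bounded_linear_left assms(2)])
  also have "\<dots> = (\<Sum>n. cscale c o\<^sub>L A n)"
    using assms(1) by (simp add: complex_linear_def)
  also have "\<dots> = cscale c o\<^sub>L (\<Sum>n. A n)"
    by (rule bounded_linear.suminf[OF blinfun_compose.bounded_linear_right assms(2), symmetric])
  finally show "(\<Sum>n. A n) o\<^sub>L cscale c = cscale c o\<^sub>L (\<Sum>n. A n)" .
qed

lemma complex_linear_inverse:
  assumes "inverse_blinfun A S" "complex_linear A"
  shows "complex_linear S"
  unfolding complex_linear_def
proof
  fix c
  have "S o\<^sub>L cscale c = S o\<^sub>L cscale c o\<^sub>L (A o\<^sub>L S)"
    using assms(1) by (simp add: inverse_blinfun_def)
  also have "\<dots> = S o\<^sub>L (cscale c o\<^sub>L A) o\<^sub>L S"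
    by (simp add: blinfun_compose_assoc)
  also have "\<dots> = S o\<^sub>L (A o\<^sub>L cscale c) o\<^sub>L S"
    using assms(2) by (simp add: complex_linear_def)
  also have "\<dots> = (S o\<^sub>L A) o\<^sub>L (cscale c o\<^sub>L S)"
    by (simp add: blinfun_compose_assoc)
  finally show "S o\<^sub>L cscale c = cscale c o\<^sub>L S"
    using assms(1) by (simp add: inverse_blinfun_def)
qed

lemma inverse_blinfun_unique:
  assumes "inverse_blinfun A S" "inverse_blinfun A S'"
  shows "S = S'"
proof -
  have "S = S o\<^sub>L (A o\<^sub>L S')"
    using assms by (simp add: inverse_blinfun_def)
  also have "\<dots> = (S o\<^sub>L A) o\<^sub>L S'"
    by (simp add: blinfun_compose_assoc)
  finally show ?thesis
    using assms by (simp add: inverse_blinfun_def)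
qed

lemma inverse_blinfun_diff:
  assumes "inverse_blinfun A S" "inverse_blinfun B S'"
  shows "S - S' = S o\<^sub>L (B - A) o\<^sub>L S'"
proof -
  have "S o\<^sub>L (B - A) o\<^sub>L S' = (S o\<^sub>L (B o\<^sub>L S')) - ((S o\<^sub>L A) o\<^sub>L S')"
    by (simp add: blinfun_compose_simps blinfun_compose_assoc)
  then show ?thesis
    using assms by (simp add: inverse_blinfun_def)
qed

text \<open>By the resolvent identity, \<open>S z - S0\<close> is bounded by \<open>norm (S z)\<close> times a quantity that tends to
\<open>0\<close>; this first bounds \<open>S z\<close> and then shows the convergence.\<close>

lemma tendsto_inverse_blinfun:
  assumes inv: "eventually (\<lambda>z. inverse_blinfun (A z) (S z)) F" and inv0: "inverse_blinfun A0 S0"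
    and lim: "(A \<longlongrightarrow> A0) F"
  shows "(S \<longlongrightarrow> S0) F"
proof (rule LIM_zero_cancel)
  define d where "d z = norm (A z - A0) * norm S0" for z
  have d: "(d \<longlongrightarrow> 0) F"
    unfolding d_def using tendsto_mult_right[OF tendsto_norm[OF LIM_zero[OF lim]], of "norm S0"] by simp
  then have "eventually (\<lambda>z. d z < 1/2) F"
    by (rule order_tendstoD) simp
  with inv have "eventually (\<lambda>z. norm (S z - S0) \<le> 2 * norm S0 * d z) F"
  proof eventually_elim
    case (elim z)
    have "S z - S0 = S z o\<^sub>L (A0 - A z) o\<^sub>L S0"
      by (rule inverse_blinfun_diff[OF elim(1) inv0])
    then have "norm (S z - S0) \<le> norm (S z) * norm (A0 - A z) * norm S0"
      by (simp add: order_trans[OF norm_blinfun_compose] mult_right_mono norm_blinfun_compose)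
    then have 1: "norm (S z - S0) \<le> norm (S z) * d z"
      by (simp add: d_def norm_minus_commute mult.assoc)
    also have "\<dots> \<le> norm (S z) * (1/2)"
      using elim(2) by (intro mult_left_mono) auto
    finally have "norm (S z) \<le> 2 * norm S0"
      using norm_triangle_ineq2[of "S z" S0] by simp
    with 1 show ?case
      by (rule order_trans[OF _ mult_right_mono]) (auto simp: d_def)
  qed
  moreover have "((\<lambda>z. 2 * norm S0 * d z) \<longlongrightarrow> 0) F"
    using tendsto_mult_right_zero[OF d] by simp
  ultimately show "((\<lambda>z. S z - S0) \<longlongrightarrow> 0) F"
    by (rule Lim_null_comparison)
qed

section \<open>Complex differentiable operator functions\<close>

text \<open>The complex derivative is required to be continuous, so that one may differentiate under the
integral sign without first proving Goursat's theorem for operator-valued functions.\<close>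

definition blinfun_holomorphic_on ::
    "(complex \<Rightarrow> ('b::banach \<times> 'b) \<Rightarrow>\<^sub>L ('b \<times> 'b)) \<Rightarrow> complex set \<Rightarrow> bool" where
  "blinfun_holomorphic_on G S \<longleftrightarrow> (\<exists>G'. continuous_on S G' \<and>
     (\<forall>z\<in>S. (G has_derivative (\<lambda>h. cscale h o\<^sub>L G' z)) (at z)))"

lemma blinfun_holomorphic_onI:
  assumes "continuous_on S G'" "\<And>z. z \<in> S \<Longrightarrow> (G has_derivative (\<lambda>h. cscale h o\<^sub>L G' z)) (at z)"
  shows "blinfun_holomorphic_on G S"
  using assms unfolding blinfun_holomorphic_on_def by blast

lemma blinfun_holomorphic_on_subset:
  "blinfun_holomorphic_on G S \<Longrightarrow> T \<subseteq> S \<Longrightarrow> blinfun_holomorphic_on G T"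
  unfolding blinfun_holomorphic_on_def by (meson continuous_on_subset subsetD)

lemma blinfun_holomorphic_on_imp_continuous_on:
  "blinfun_holomorphic_on G S \<Longrightarrow> continuous_on S G"
  unfolding blinfun_holomorphic_on_def
  by (meson continuous_at_imp_continuous_on has_derivative_continuous)

lemma bounded_bilinear_cscale_compose: "bounded_bilinear (\<lambda>c A. cscale c o\<^sub>L A)"
  by (rule bounded_bilinear.comp1[OF bounded_bilinear_blinfun_compose bounded_linear_cscale])

lemma continuous_on_cscale [continuous_intros]:
  "continuous_on S f \<Longrightarrow> continuous_on S (\<lambda>x. cscale (f x))"
  by (rule bounded_linear.continuous_on[OF bounded_linear_cscale])

lemma continuous_on_compose_blinfun [continuous_intros]:
  "continuous_on S f \<Longrightarrow> continuous_on S g \<Longrightarrow> continuous_on S (\<lambda>x. f x o\<^sub>L g x)"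
  by (rule bounded_bilinear.continuous_on[OF bounded_bilinear_blinfun_compose])

lemma blinfun_holomorphic_on_diff:
  assumes "blinfun_holomorphic_on F S" "blinfun_holomorphic_on G S"
  shows "blinfun_holomorphic_on (\<lambda>z. F z - G z) S"
proof -
  obtain F' G' where "continuous_on S F'" "continuous_on S G'"
    and F: "\<And>z. z \<in> S \<Longrightarrow> (F has_derivative (\<lambda>h. cscale h o\<^sub>L F' z)) (at z)"
    and G: "\<And>z. z \<in> S \<Longrightarrow> (G has_derivative (\<lambda>h. cscale h o\<^sub>L G' z)) (at z)"
    using assms unfolding blinfun_holomorphic_on_def by blast
  then show ?thesis
    by (intro blinfun_holomorphic_onI[where G' = "\<lambda>z. F' z - G' z"] continuous_intros)
      (auto intro!: derivative_eq_intros simp: blinfun_compose_simps)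
qed

lemma blinfun_holomorphic_on_cscale:
  assumes \<phi>: "\<And>z. z \<in> S \<Longrightarrow> (\<phi> has_field_derivative \<phi>' z) (at z)" "continuous_on S \<phi>'"
    and G: "blinfun_holomorphic_on G S"
  shows "blinfun_holomorphic_on (\<lambda>z. cscale (\<phi> z) o\<^sub>L G z) S"
proof -
  obtain G' where G': "continuous_on S G'"
      "\<And>z. z \<in> S \<Longrightarrow> (G has_derivative (\<lambda>h. cscale h o\<^sub>L G' z)) (at z)"
    using G unfolding blinfun_holomorphic_on_def by blast
  have cont: "continuous_on S \<phi>" "continuous_on S G"
    using \<phi>(1) G by (auto intro: DERIV_continuous_on blinfun_holomorphic_on_imp_continuous_on
        has_field_derivative_at_within)
  show ?thesis
  proof (rule blinfun_holomorphic_onI[where G' = "\<lambda>z. (cscale (\<phi>' z) o\<^sub>L G z) + (cscale (\<phi> z) o\<^sub>L G' z)"])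
    show "continuous_on S (\<lambda>z. (cscale (\<phi>' z) o\<^sub>L G z) + (cscale (\<phi> z) o\<^sub>L G' z))"
      using cont G'(1) \<phi>(2) by (intro continuous_intros)
  next
    fix z assume "z \<in> S"
    have "((\<lambda>z. cscale (\<phi> z) o\<^sub>L G z) has_derivative
        (\<lambda>h. (cscale (\<phi> z) o\<^sub>L (cscale h o\<^sub>L G' z)) + (cscale (\<phi>' z * h) o\<^sub>L G z))) (at z)"
      using \<phi>(1)[OF \<open>z \<in> S\<close>] unfolding has_field_derivative_def
      by (rule bounded_bilinear.FDERIV[OF bounded_bilinear_cscale_compose _ G'(2)[OF \<open>z \<in> S\<close>]])
    moreover have "(cscale (\<phi> z) o\<^sub>L (cscale h o\<^sub>L G' z)) + (cscale (\<phi>' z * h) o\<^sub>L G z)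
        = cscale h o\<^sub>L ((cscale (\<phi>' z) o\<^sub>L G z) + (cscale (\<phi> z) o\<^sub>L G' z))" for h
    proof -
      have "cscale (\<phi> z) o\<^sub>L (cscale h o\<^sub>L G' z) = cscale h o\<^sub>L (cscale (\<phi> z) o\<^sub>L G' z)"
        by (simp add: blinfun_compose_assoc[symmetric] cscale_mult[symmetric] mult.commute)
      moreover have "cscale (\<phi>' z * h) o\<^sub>L G z = cscale h o\<^sub>L (cscale (\<phi>' z) o\<^sub>L G z)"
        by (simp add: blinfun_compose_assoc[symmetric] cscale_mult[symmetric] mult.commute)
      ultimately show ?thesis
        by (simp add: blinfun_compose_simps)
    qed
    ultimately show "((\<lambda>z. cscale (\<phi> z) o\<^sub>L G z) has_derivative
        (\<lambda>h. cscale h o\<^sub>L ((cscale (\<phi>' z) o\<^sub>L G z) + (cscale (\<phi> z) o\<^sub>L G' z)))) (at z)"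
      by simp
  qed
qed

lemma blinfun_holomorphic_on_const: "blinfun_holomorphic_on (\<lambda>z. A) S"
  by (rule blinfun_holomorphic_onI[where G' = "\<lambda>_. 0"]) auto

lemma blinfun_holomorphic_on_affine:
  assumes G: "blinfun_holomorphic_on G S" and "\<And>z. z \<in> T \<Longrightarrow> c + w * z \<in> S"
  shows "blinfun_holomorphic_on (\<lambda>z. G (c + w * z)) T"
proof -
  obtain G' where G': "continuous_on S G'"
      "\<And>z. z \<in> S \<Longrightarrow> (G has_derivative (\<lambda>h. cscale h o\<^sub>L G' z)) (at z)"
    using G unfolding blinfun_holomorphic_on_def by blast
  show ?thesis
  proof (rule blinfun_holomorphic_onI[where G' = "\<lambda>z. cscale w o\<^sub>L G' (c + w * z)"])
    show "continuous_on T (\<lambda>z. cscale w o\<^sub>L G' (c + w * z))"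
      using assms(2) by (intro continuous_intros continuous_on_compose2[OF G'(1)]) auto
  next
    fix z assume "z \<in> T"
    have "((\<lambda>z. c + w * z) has_derivative (\<lambda>h. w * h)) (at z)"
      by (auto intro!: derivative_eq_intros)
    from has_derivative_compose[OF this G'(2)[OF assms(2)[OF \<open>z \<in> T\<close>]]]
    show "((\<lambda>z. G (c + w * z)) has_derivative (\<lambda>h. cscale h o\<^sub>L (cscale w o\<^sub>L G' (c + w * z)))) (at z)"
      by (simp add: blinfun_compose_assoc[symmetric] cscale_mult[symmetric] mult.commute)
  qed
qed

text \<open>The derivative of \<open>A\<^sup>-\<^sup>1\<close> is \<open>- A\<^sup>-\<^sup>1 A' A\<^sup>-\<^sup>1\<close>. Complex linearity of the inverse is needed to bring
the increment \<open>h\<close> to the front.\<close>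

lemma blinfun_holomorphic_on_inverse:
  assumes A: "blinfun_holomorphic_on A S" and S: "open S"
    and inv: "\<And>z. z \<in> S \<Longrightarrow> inverse_blinfun (A z) (T z)"
    and lin: "\<And>z. z \<in> S \<Longrightarrow> complex_linear (T z)"
  shows "blinfun_holomorphic_on T S"
proof -
  obtain A' where A': "continuous_on S A'"
      "\<And>z. z \<in> S \<Longrightarrow> (A has_derivative (\<lambda>h. cscale h o\<^sub>L A' z)) (at z)"
    using A unfolding blinfun_holomorphic_on_def by blast
  have cont: "isCont T z" if z: "z \<in> S" for z
    unfolding isCont_def
  proof (rule tendsto_inverse_blinfun[where A = A])
    show "\<forall>\<^sub>F x in at z. inverse_blinfun (A x) (T x)"
      using eventually_at_in_open'[OF S z] by eventually_elim (rule inv)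
    show "A \<midarrow>z\<rightarrow> A z"
      using has_derivative_continuous[OF A'(2)[OF z]] by (simp add: isCont_def)
  qed (rule inv[OF z])
  then have cont_on: "continuous_on S T"
    by (simp add: continuous_at_imp_continuous_on)
  show ?thesis
  proof (rule blinfun_holomorphic_onI[where G' = "\<lambda>z. - (T z o\<^sub>L A' z o\<^sub>L T z)"])
    show "continuous_on S (\<lambda>z. - (T z o\<^sub>L A' z o\<^sub>L T z))"
      using cont_on A'(1) by (intro continuous_intros)
  next
    fix z assume z: "z \<in> S"
    have dA: "(A has_derivative (\<lambda>h. cscale h o\<^sub>L A' z)) (at z)"
      by (rule A'(2)[OF z])
    \<comment> \<open>\<open>E\<close> is the first order Taylor remainder of \<open>A\<close> at \<open>z\<close>\<close>
    define E where "E y = A y - A z - (cscale (y - z) o\<^sub>L A' z)" for y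
    have E: "((\<lambda>y. norm (E y) / norm (y - z)) \<longlongrightarrow> 0) (at z)"
      using dA unfolding has_derivative_iff_norm E_def by simp
    have key: "norm (T y - T z - (cscale (y - z) o\<^sub>L (- (T z o\<^sub>L A' z o\<^sub>L T z)))) / norm (y - z) \<le>
        norm (T y) * norm (T z) * (norm (E y) / norm (y - z))
        + 2 * norm (T y - T z) * norm (A' z) * norm (T z)"
      if y: "y \<in> S" "y \<noteq> z" for y
    proof -
      have lin': "cscale (y - z) o\<^sub>L (T z o\<^sub>L X) = T z o\<^sub>L (cscale (y - z) o\<^sub>L X)" for X
        using lin[OF z] unfolding complex_linear_def
        by (simp add: blinfun_compose_assoc[symmetric])
      have "T y - T z = T y o\<^sub>L (A z - A y) o\<^sub>L T z"
        by (rule inverse_blinfun_diff[OF inv[OF y(1)] inv[OF z]])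
      also have "A z - A y = - E y - (cscale (y - z) o\<^sub>L A' z)"
        by (simp add: E_def)
      finally have e1: "T y - T z = - (T y o\<^sub>L E y o\<^sub>L T z) - (T y o\<^sub>L (cscale (y - z) o\<^sub>L (A' z o\<^sub>L T z)))"
        by (simp add: blinfun_compose_simps blinfun_compose_assoc)
      have e2: "cscale (y - z) o\<^sub>L (- (T z o\<^sub>L A' z o\<^sub>L T z)) = - (T z o\<^sub>L (cscale (y - z) o\<^sub>L (A' z o\<^sub>L T z)))"
        by (simp add: blinfun_compose_simps blinfun_compose_assoc lin')
      have "T y - T z - (cscale (y - z) o\<^sub>L (- (T z o\<^sub>L A' z o\<^sub>L T z)))
          = - (T y o\<^sub>L E y o\<^sub>L T z) - ((T y - T z) o\<^sub>L (cscale (y - z) o\<^sub>L (A' z o\<^sub>L T z)))"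
        unfolding e2 blinfun_compose.diff_left using e1 by (simp add: algebra_simps)
      also have "norm \<dots> \<le> norm (T y o\<^sub>L E y o\<^sub>L T z) + norm ((T y - T z) o\<^sub>L (cscale (y - z) o\<^sub>L (A' z o\<^sub>L T z)))"
        by (rule order_trans[OF norm_triangle_ineq4]) simp
      also have "\<dots> \<le> norm (T y) * norm (E y) * norm (T z) +
          norm (T y - T z) * (2 * norm (y - z) * (norm (A' z) * norm (T z)))"
      proof (intro add_mono)
        show "norm (T y o\<^sub>L E y o\<^sub>L T z) \<le> norm (T y) * norm (E y) * norm (T z)"
          by (intro order_trans[OF norm_blinfun_compose] mult_right_mono norm_blinfun_compose) auto
        have "norm (cscale (y - z) o\<^sub>L (A' z o\<^sub>L T z)) \<le> 2 * norm (y - z) * (norm (A' z) * norm (T z))"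
          by (intro order_trans[OF norm_cscale_compose] mult_left_mono norm_blinfun_compose) auto
        then have "norm (T y - T z) * norm (cscale (y - z) o\<^sub>L (A' z o\<^sub>L T z))
            \<le> norm (T y - T z) * (2 * norm (y - z) * (norm (A' z) * norm (T z)))"
          by (rule mult_left_mono) simp
        with norm_blinfun_compose show "norm ((T y - T z) o\<^sub>L (cscale (y - z) o\<^sub>L (A' z o\<^sub>L T z)))
            \<le> norm (T y - T z) * (2 * norm (y - z) * (norm (A' z) * norm (T z)))"
          by (rule order_trans)
      qed
      finally show ?thesis
        using y(2) by (simp add: field_simps)
    qed
    have "((\<lambda>y. norm (T y) * norm (T z) * (norm (E y) / norm (y - z))
        + 2 * norm (T y - T z) * norm (A' z) * norm (T z)) \<longlongrightarrow>
        norm (T z) * norm (T z) * 0 + 2 * norm (T z - T z) * norm (A' z) * norm (T z)) (at z)"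
      using cont[OF z] by (intro tendsto_intros E) (simp_all add: isCont_def)
    then have lim: "((\<lambda>y. norm (T y) * norm (T z) * (norm (E y) / norm (y - z))
        + 2 * norm (T y - T z) * norm (A' z) * norm (T z)) \<longlongrightarrow> 0) (at z)"
      by simp
    have "((\<lambda>y. norm (T y - T z - (cscale (y - z) o\<^sub>L (- (T z o\<^sub>L A' z o\<^sub>L T z)))) / norm (y - z)) \<longlongrightarrow> 0) (at z)"
    proof (rule Lim_null_comparison[OF _ lim])
      show "\<forall>\<^sub>F y in at z. norm (norm (T y - T z - (cscale (y - z) o\<^sub>L (- (T z o\<^sub>L A' z o\<^sub>L T z)))) / norm (y - z))
          \<le> norm (T y) * norm (T z) * (norm (E y) / norm (y - z))
            + 2 * norm (T y - T z) * norm (A' z) * norm (T z)"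
        using eventually_at_in_open[OF S z] by eventually_elim (use key in auto)
    qed
    then show "(T has_derivative (\<lambda>h. cscale h o\<^sub>L - (T z o\<^sub>L A' z o\<^sub>L T z))) (at z)"
      unfolding has_derivative_iff_norm
      using bounded_bilinear.bounded_linear_left[OF bounded_bilinear_cscale_compose] by simp
  qed
qed

text \<open>The derivative of the integral with
respect to the radius \<open>x\<close> is \<open>\<integral> e\<^sup>i\<^sup>t G'(x e\<^sup>i\<^sup>t) dt\<close>. Up to the factor \<open>i x\<close> the integrand is the derivative of
\<open>G(x e\<^sup>i\<^sup>t)\<close> in \<open>t\<close>, so it integrates to \<open>0\<close> over a full period.\<close>

lemma circle_integral_independent_of_radius:
  assumes G: "blinfun_holomorphic_on G {z. a < norm z \<and> norm z < b}" and "0 \<le> a"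
    and r: "a < r" "r < b" and s: "a < s" "s < b"
  shows "integral {c..c+2*pi} (\<lambda>t. G (of_real r * cis t)) = integral {c..c+2*pi} (\<lambda>t. G (of_real s * cis t))"
proof -
  define S where "S = {z::complex. a < norm z \<and> norm z < b}"
  obtain G' where G': "continuous_on S G'"
      "\<And>z. z \<in> S \<Longrightarrow> (G has_derivative (\<lambda>h. cscale h o\<^sub>L G' z)) (at z)"
    using G unfolding blinfun_holomorphic_on_def S_def by blast
  have contG: "continuous_on S G"
    using G unfolding S_def by (rule blinfun_holomorphic_on_imp_continuous_on)
  have in_S: "of_real x * cis t \<in> S" if "x \<in> {a<..<b}" for x t
    using that \<open>0 \<le> a\<close> by (auto simp: S_def norm_mult)
  have "((\<lambda>x. integral (cbox c (c+2*pi)) (\<lambda>t. G (of_real x * cis t))) has_vector_derivative 0) (at x within {a<..<b})"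
    if x: "x \<in> {a<..<b}" for x
  proof -
    let ?J = "integral (cbox c (c+2*pi)) (\<lambda>t. cscale (cis t) o\<^sub>L G' (of_real x * cis t))"
    have int: "(\<lambda>t. cscale (cis t) o\<^sub>L G' (of_real x * cis t)) integrable_on {c..c+2*pi}"
      using in_S[OF x] by (intro integrable_continuous_interval continuous_intros continuous_on_compose2[OF G'(1)]) auto
    have *: "((\<lambda>x. integral (cbox c (c+2*pi)) (\<lambda>t. G (of_real x * cis t))) has_vector_derivative ?J) (at x within {a<..<b})"
    proof (rule leibniz_rule_vector_derivative)
      fix y t assume y: "y \<in> {a<..<b}"
      have "((\<lambda>y. of_real y * cis t) has_vector_derivative cis t) (at y within {a<..<b})"
        by (auto intro!: derivative_eq_intros simp: has_vector_derivative_def scaleR_conv_of_real)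
      moreover have "(G has_derivative (\<lambda>h. cscale h o\<^sub>L G' (of_real y * cis t))) (at (of_real y * cis t) within (\<lambda>y. of_real y * cis t) ` {a<..<b})"
        using G'(2)[OF in_S[OF y]] by (rule has_derivative_at_withinI)
      ultimately show "((\<lambda>y. G (of_real y * cis t)) has_vector_derivative (cscale (cis t) o\<^sub>L G' (of_real y * cis t))) (at y within {a<..<b})"
        by (rule vector_derivative_diff_chain_within[unfolded o_def])
    next
      fix y assume "y \<in> {a<..<b}"
      then show "(\<lambda>t. G (of_real y * cis t)) integrable_on cbox c (c + 2 * pi)"
        using in_S by (intro integrable_continuous continuous_intros continuous_on_compose2[OF contG]) auto
    next
      show "continuous_on ({a<..<b} \<times> cbox c (c + 2 * pi)) (\<lambda>(x, t). cscale (cis t) o\<^sub>L G' (of_real x * cis t))"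
        using in_S unfolding split_beta
        by (intro continuous_intros continuous_on_compose2[OF G'(1)]) auto
    qed (use x in auto)
    have "((\<lambda>t. cscale (of_real x * (\<i> * cis t)) o\<^sub>L G' (of_real x * cis t)) has_integral
        G (of_real x * cis (c+2*pi)) - G (of_real x * cis c)) {c..c+2*pi}"
    proof (rule fundamental_theorem_of_calculus)
      fix t :: real
      have "((\<lambda>t. of_real x * cis t) has_vector_derivative (of_real x * (\<i> * cis t))) (at t within {c..c+2*pi})"
        by (auto intro!: derivative_eq_intros simp: has_vector_derivative_def scaleR_conv_of_real)
      moreover have "(G has_derivative (\<lambda>h. cscale h o\<^sub>L G' (of_real x * cis t))) (at (of_real x * cis t) within (\<lambda>t. of_real x * cis t) ` {c..c+2*pi})"
        using G'(2)[OF in_S[OF x]] by (rule has_derivative_at_withinI)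
      ultimately show "((\<lambda>t. G (of_real x * cis t)) has_vector_derivative (cscale (of_real x * (\<i> * cis t)) o\<^sub>L G' (of_real x * cis t))) (at t within {c..c+2*pi})"
        by (rule vector_derivative_diff_chain_within[unfolded o_def])
    qed simp
    then have "((\<lambda>t. cscale (of_real x * \<i>) o\<^sub>L (cscale (cis t) o\<^sub>L G' (of_real x * cis t))) has_integral 0) {c..c+2*pi}"
      by (simp add: blinfun_compose_assoc[symmetric] cscale_mult[symmetric] mult.assoc cis_mult[symmetric])
    moreover have "((\<lambda>t. cscale (of_real x * \<i>) o\<^sub>L (cscale (cis t) o\<^sub>L G' (of_real x * cis t))) has_integral (cscale (of_real x * \<i>) o\<^sub>L ?J)) {c..c+2*pi}"
      using has_integral_linear[OF integrable_integral[OF int] blinfun_compose.bounded_linear_right]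
      by (simp add: o_def)
    ultimately have "cscale (of_real x * \<i>) o\<^sub>L ?J = 0"
      by (rule has_integral_unique[rotated])
    then have "cscale (1 / (of_real x * \<i>)) o\<^sub>L (cscale (of_real x * \<i>) o\<^sub>L ?J) = 0"
      by simp
    moreover have "(of_real x :: complex) \<noteq> 0"
      using x \<open>0 \<le> a\<close> by auto
    ultimately have "?J = 0"
      by (simp add: blinfun_compose_assoc[symmetric] cscale_mult[symmetric])
    with * show ?thesis by simp
  qed
  then have "((\<lambda>x. integral (cbox c (c+2*pi)) (\<lambda>t. G (of_real x * cis t))) has_derivative (\<lambda>h. 0)) (at x within {a<..<b})"
    if "x \<in> {a<..<b}" for x
    using that by (auto simp: has_vector_derivative_def)
  from has_derivative_zero_unique[OF convex_real_interval(8) this, of r s] show ?thesis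
    using r s by auto
qed

section \<open>Coefficients of complex differentiable operator functions\<close>

lemma integral_cis_power:
  assumes "k \<le> n" "r > 0"
  shows "((\<lambda>t. inverse ((of_real r * cis t) ^ n) * (of_real r * cis t) ^ k) has_integral
    (if k = n then of_real (2 * pi) else 0)) {c..c + 2*pi}"
proof (cases "k = n")
  case True
  have "((\<lambda>t. 1::complex) has_integral (measure lborel {c..c + 2*pi} *\<^sub>R 1)) {c..c + 2*pi}"
    using has_integral_const_real by blast
  then have "((\<lambda>t. 1::complex) has_integral of_real (2*pi)) {c..c + 2*pi}"
    by (simp add: scaleR_conv_of_real)
  then show ?thesis
    using True assms(2) by (simp add: norm_mult)
next
  case False
  define m where "m = real n - real k"
  have m: "m \<noteq> 0"
    using False by (simp add: m_def)
  define w where "w = (of_real r ^ k * inverse (of_real r ^ n) :: complex)"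
  have eq: "inverse ((of_real r * cis t) ^ n) * (of_real r * cis t) ^ k = w * cis (- m * t)" for t
  proof -
    have "inverse (cis t ^ n) * cis t ^ k = cis (- m * t)"
      by (simp add: Complex.DeMoivre cis_inverse cis_mult m_def algebra_simps)
    then show ?thesis
      by (simp add: w_def power_mult_distrib mult_ac)
  qed
  have per: "cis (- m * (c + 2*pi)) = cis (- m * c)"
  proof -
    have "cis (- m * (c + 2*pi)) = cis (- m * c) * cis (2 * pi * (- m))"
      by (simp add: cis_mult algebra_simps)
    moreover have "- m \<in> \<int>"
      by (simp add: m_def)
    ultimately show ?thesis
      using cis_multiple_2pi[of "- m"] by simp
  qed
  have "((\<lambda>t. w * cis (- m * t)) has_integral
      w * (cis (- m * (c + 2*pi)) / (- of_real m * \<i>)) - w * (cis (- m * c) / (- of_real m * \<i>))) {c..c + 2*pi}"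
  proof (rule fundamental_theorem_of_calculus)
    fix t
    show "((\<lambda>t. w * (cis (- m * t) / (- of_real m * \<i>))) has_vector_derivative w * cis (- m * t)) (at t within {c..c + 2*pi})"
      using m by (auto intro!: derivative_eq_intros simp: has_vector_derivative_def scaleR_conv_of_real field_simps)
  qed simp
  then show ?thesis
    using False per by (simp add: eq)
qed

text \<open>Cauchy's formula for the coefficient \<open>A n\<close>. Only the expansion of \<open>G\<close> at \<open>0\<close> up to order \<open>n\<close> is
used: on small circles the remainder contributes \<open>O(s)\<close>, and the integral does not depend on the
radius.\<close>

lemma holomorphic_coefficient_integral:
  assumes G: "blinfun_holomorphic_on G (ball 0 1)"
    and \<eta>: "\<eta> > 0"
    and expansion: "\<And>z. norm z < \<eta> \<Longrightarrow> norm (G z - (\<Sum>k\<le>n. cscale (z ^ k) o\<^sub>L A k)) \<le> K * norm z ^ Suc n"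
    and r: "0 < r" "r < 1"
  shows "integral {c..c + 2*pi} (\<lambda>t. cscale (inverse ((of_real r * cis t) ^ n)) o\<^sub>L G (of_real r * cis t))
     = (2 * pi) *\<^sub>R A n"
proof -
  let ?z = "\<lambda>s t. complex_of_real s * cis t"
  define I where "I s = integral {c..c + 2*pi} (\<lambda>t. cscale (inverse (?z s t ^ n)) o\<^sub>L G (?z s t))" for s
  have hol: "blinfun_holomorphic_on (\<lambda>z. cscale (inverse (z ^ n)) o\<^sub>L G z) {z. 0 < norm z \<and> norm z < 1}"
  proof (rule blinfun_holomorphic_on_cscale)
    show "((\<lambda>z. inverse (z ^ n)) has_field_derivative - (of_nat n * z ^ (n - 1)) / (z ^ n)\<^sup>2) (at z)"
      if "z \<in> {z. 0 < norm z \<and> norm z < 1}" for z :: complex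
      using that by (auto intro!: derivative_eq_intros simp: power2_eq_square field_simps)
    show "continuous_on {z. 0 < norm z \<and> norm z < 1} (\<lambda>z::complex. - (of_nat n * z ^ (n - 1)) / (z ^ n)\<^sup>2)"
      by (intro continuous_intros) auto
    show "blinfun_holomorphic_on G {z. 0 < cmod z \<and> cmod z < 1}"
      using G by (rule blinfun_holomorphic_on_subset) auto
  qed
  have const: "I s = I r" if "0 < s" "s < 1" for s
    unfolding I_def using that r
    by (intro circle_integral_independent_of_radius[OF hol]) auto
  have contG: "continuous_on (ball 0 1) G"
    using G by (rule blinfun_holomorphic_on_imp_continuous_on)
  have bound: "norm (I r - (2*pi) *\<^sub>R A n) \<le> 4 * pi * K * s" if s: "0 < s" "s < min \<eta> 1" for s
  proof -
    have in_ball: "?z s t \<in> ball 0 1" for t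
      using s by (simp add: norm_mult)
    have int1: "((\<lambda>t. cscale (inverse (?z s t ^ n)) o\<^sub>L G (?z s t)) has_integral I s) {c..c+2*pi}"
      unfolding I_def using s in_ball
      by (intro integrable_integral integrable_continuous_interval continuous_intros
          continuous_on_compose2[OF contG]) auto
    have "((\<lambda>t. \<Sum>k\<le>n. cscale (inverse (?z s t ^ n) * ?z s t ^ k) o\<^sub>L A k) has_integral
        (\<Sum>k\<le>n. cscale (if k = n then of_real (2*pi) else 0) o\<^sub>L A k)) {c..c+2*pi}"
    proof (rule has_integral_sum)
      fix k assume "k \<in> {..n}"
      then have "((\<lambda>t. inverse (?z s t ^ n) * ?z s t ^ k) has_integral
          (if k = n then of_real (2 * pi) else 0)) {c..c + 2*pi}"
        using s by (intro integral_cis_power) auto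
      from has_integral_linear[OF this bounded_bilinear.bounded_linear_left[OF bounded_bilinear_cscale_compose, of "A k"]]
      show "((\<lambda>t. cscale (inverse (?z s t ^ n) * ?z s t ^ k) o\<^sub>L A k) has_integral
          (cscale (if k = n then of_real (2*pi) else 0) o\<^sub>L A k)) {c..c+2*pi}"
        by (simp add: o_def)
    qed simp
    moreover have "(\<Sum>k\<le>n. cscale (if k = n then of_real (2*pi) else 0) o\<^sub>L A k) = (2*pi) *\<^sub>R A n"
    proof -
      have "(\<Sum>k\<le>n. cscale (if k = n then of_real (2*pi) else 0) o\<^sub>L A k)
          = (\<Sum>k\<le>n. if k = n then cscale (of_real (2*pi)) o\<^sub>L A k else 0)"
        by (rule sum.cong) auto
      then show ?thesis
        by (simp only: sum.delta[OF finite_atMost]) (simp add: cscale_of_real blinfun_compose_simps del: of_real_mult)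
    qed
    ultimately have int2: "((\<lambda>t. \<Sum>k\<le>n. cscale (inverse (?z s t ^ n) * ?z s t ^ k) o\<^sub>L A k) has_integral
        (2*pi) *\<^sub>R A n) {c..c+2*pi}"
      by simp
    have int: "((\<lambda>t. cscale (inverse (?z s t ^ n)) o\<^sub>L (G (?z s t) - (\<Sum>k\<le>n. cscale (?z s t ^ k) o\<^sub>L A k)))
        has_integral I s - (2*pi) *\<^sub>R A n) {c..c+2*pi}"
      using has_integral_diff[OF int1 int2]
      by (simp add: blinfun_compose_simps blinfun_compose.sum_right cscale_mult blinfun_compose_assoc)
    have "norm (I s - (2*pi) *\<^sub>R A n) \<le> (2 * (K * s)) * measure lborel (cbox c (c + 2*pi))"
    proof (rule has_integral_bound)
      have "0 \<le> K * norm (of_real s :: complex) ^ Suc n"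
        using s by (intro order_trans[OF norm_ge_zero expansion]) auto
      then show "0 \<le> 2 * (K * s)"
        using s zero_less_power[of s "Suc n"]
        by (metis abs_of_pos mult_nonneg_nonneg norm_of_real zero_le_mult_iff zero_le_numeral not_less less_imp_le)
      fix t
      have "norm (cscale (inverse (?z s t ^ n)) o\<^sub>L (G (?z s t) - (\<Sum>k\<le>n. cscale (?z s t ^ k) o\<^sub>L A k)))
          \<le> 2 * cmod (inverse (?z s t ^ n)) * (K * norm (?z s t) ^ Suc n)"
        using s by (intro order_trans[OF norm_cscale_compose] mult_left_mono expansion) (auto simp: norm_mult)
      also have "\<dots> = 2 * (K * s)"
        using s by (simp add: norm_mult norm_power norm_inverse power_mult_distrib)
      finally show "norm (cscale (inverse (?z s t ^ n)) o\<^sub>L (G (?z s t) - (\<Sum>k\<le>n. cscale (?z s t ^ k) o\<^sub>L A k))) \<le> 2 * (K * s)" .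
    qed (use int in simp)
    then show ?thesis
      using const[of s] s by (simp add: mult_ac)
  qed
  have "((\<lambda>s. 4 * pi * K * s) \<longlongrightarrow> 4 * pi * K * 0) (at_right 0)"
    by (intro tendsto_intros)
  moreover have "\<forall>\<^sub>F s in at_right 0. norm (I r - (2*pi) *\<^sub>R A n) \<le> 4 * pi * K * s"
    using eventually_at_right_real[of 0 "min \<eta> 1"] \<eta> by (auto elim!: eventually_mono intro: bound)
  ultimately have "norm (I r - (2*pi) *\<^sub>R A n) \<le> 4 * pi * K * 0"
    by (intro tendsto_lowerbound[of _ _ "at_right (0::real)"]) auto
  then show ?thesis
    by (simp add: I_def)
qed

text \<open>Turning the circle by \<open>\<pi>/n\<close> multiplies \<open>z\<^sup>n\<close> by \<open>-1\<close>. Hence the \<open>n\<close>-th coefficient of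
\<open>G(z) - G(z e\<^sup>i\<^sup>\<pi>\<^sup>/\<^sup>n)\<close> is \<open>2 A\<^sub>n\<close>, and the smoothness of \<open>G\<close> away from its singularity yields cancellation.\<close>

lemma holomorphic_coefficient_bound:
  assumes G: "blinfun_holomorphic_on G (ball 0 1)"
    and \<eta>: "\<eta> > 0"
    and expansion: "\<And>z. norm z < \<eta> \<Longrightarrow> norm (G z - (\<Sum>k\<le>n. cscale (z ^ k) o\<^sub>L A k)) \<le> K * norm z ^ Suc n"
    and r: "0 < r" "r < 1" and n: "n > 0"
  shows "2 * pi * r ^ n * norm (A n) \<le>
    integral {-pi..pi} (\<lambda>t. norm (G (of_real r * cis t) - G (of_real r * cis (t + pi / n))))"
proof -
  let ?z = "\<lambda>t. complex_of_real r * cis t"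
  define w where "w = cis (pi / n)"
  have w: "w ^ n = -1" "norm w = 1"
    using n Complex.DeMoivre[of "pi / n" n] by (simp_all add: w_def)
  define H where "H z = G z - G (w * z)" for z
  have H: "blinfun_holomorphic_on H (ball 0 1)"
    unfolding H_def
    using blinfun_holomorphic_on_affine[OF G, of "ball 0 1" 0 w] w(2)
    by (intro blinfun_holomorphic_on_diff G) (simp add: norm_mult)
  define B where "B k = cscale (1 - w ^ k) o\<^sub>L A k" for k
  have "norm (H z - (\<Sum>k\<le>n. cscale (z ^ k) o\<^sub>L B k)) \<le> (2 * K) * norm z ^ Suc n" if z: "norm z < \<eta>" for z
  proof -
    have wz: "norm (w * z) = norm z"
      by (simp add: norm_mult w)
    have "cscale (z ^ k) o\<^sub>L B k = (cscale (z ^ k) o\<^sub>L A k) - (cscale ((w * z) ^ k) o\<^sub>L A k)" for k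
      unfolding B_def blinfun_compose_assoc[symmetric] cscale_mult[symmetric] blinfun_compose.diff_left[symmetric] cscale_diff[symmetric]
      by (simp add: power_mult_distrib algebra_simps)
    then have "H z - (\<Sum>k\<le>n. cscale (z ^ k) o\<^sub>L B k) =
       (G z - (\<Sum>k\<le>n. cscale (z ^ k) o\<^sub>L A k)) - (G (w * z) - (\<Sum>k\<le>n. cscale ((w * z) ^ k) o\<^sub>L A k))"
      by (simp add: H_def sum_subtractf)
    then have "norm (H z - (\<Sum>k\<le>n. cscale (z ^ k) o\<^sub>L B k)) \<le> K * norm z ^ Suc n + K * norm (w * z) ^ Suc n"
      using norm_triangle_le_diff[OF add_mono[OF expansion[of z] expansion[of "w * z"]]] z wz
      by (simp only: simp_thms)
    then show ?thesis by (simp add: wz)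
  qed
  from holomorphic_coefficient_integral[OF H \<eta> this r, of "-pi"]
  have eq: "integral {-pi..pi} (\<lambda>t. cscale (inverse (?z t ^ n)) o\<^sub>L H (?z t)) = (2 * pi) *\<^sub>R B n"
    by simp
  have Bn: "B n = 2 *\<^sub>R A n"
  proof -
    have "B n = cscale (of_real 2) o\<^sub>L A n"
      by (simp add: B_def w)
    then show ?thesis
      by (simp only: cscale_of_real blinfun_compose_simps id_blinfun_compose)
  qed
  have contH: "continuous_on (ball 0 1) H"
    using H by (rule blinfun_holomorphic_on_imp_continuous_on)
  have in_ball: "?z t \<in> ball 0 1" for t
    using r by (simp add: norm_mult)
  have int: "(\<lambda>t. norm (H (?z t))) integrable_on {-pi..pi}"
    using in_ball by (intro integrable_continuous_interval continuous_intros continuous_on_compose2[OF contH]) auto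
  have "norm (integral {-pi..pi} (\<lambda>t. cscale (inverse (?z t ^ n)) o\<^sub>L H (?z t)))
      \<le> integral {-pi..pi} (\<lambda>t. 2 / r ^ n * norm (H (?z t)))"
  proof (rule integral_norm_bound_integral)
    show "(\<lambda>t. cscale (inverse (?z t ^ n)) o\<^sub>L H (?z t)) integrable_on {-pi..pi}"
      using in_ball r by (intro integrable_continuous_interval continuous_intros continuous_on_compose2[OF contH]) auto
    show "(\<lambda>t. 2 / r ^ n * norm (H (?z t))) integrable_on {-pi..pi}"
      using integrable_cmul[OF int, of "2 / r ^ n"] by simp
    fix t
    show "norm (cscale (inverse (?z t ^ n)) o\<^sub>L H (?z t)) \<le> 2 / r ^ n * norm (H (?z t))"
      using norm_cscale_compose[of "inverse (?z t ^ n)" "H (?z t)"] r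
      by (simp add: norm_mult norm_power norm_inverse divide_inverse)
  qed
  also have "\<dots> = 2 / r ^ n * integral {-pi..pi} (\<lambda>t. norm (H (?z t)))"
    by simp
  finally have "2 * pi * (2 * norm (A n)) \<le> 2 / r ^ n * integral {-pi..pi} (\<lambda>t. norm (H (?z t)))"
    by (simp add: eq Bn)
  then have "2 * pi * r ^ n * norm (A n) \<le> integral {-pi..pi} (\<lambda>t. norm (H (?z t)))"
    using r by (simp add: field_simps)
  also have "(\<lambda>t. norm (H (?z t))) = (\<lambda>t. norm (G (?z t) - G (?z (t + pi / n))))"
    by (simp add: H_def w_def cis_mult[symmetric] mult_ac)
  finally show ?thesis .
qed

section \<open>Resolvents near a simple eigenvalue\<close>

text \<open>An error that is small relative to the unknown quantity itself can be absorbed.\<close>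

lemma tendsto_of_relative_error:
  fixes A :: "'a \<Rightarrow> 'v::real_normed_vector"
  assumes \<eta>: "(\<eta> \<longlongrightarrow> 0) F" and B: "(B \<longlongrightarrow> b) F"
    and le: "eventually (\<lambda>z. norm (A z - B z) \<le> \<eta> z * (1 + norm (A z))) F"
  shows "(A \<longlongrightarrow> b) F"
proof -
  have "eventually (\<lambda>z. \<bar>\<eta> z\<bar> < 1/2) F"
    using tendsto_rabs_zero[OF \<eta>] by (rule order_tendstoD) simp
  with le have "eventually (\<lambda>z. norm (A z - B z) \<le> 2 * \<bar>\<eta> z\<bar> * (1 + norm (B z))) F"
  proof eventually_elim
    case (elim z)
    have 1: "norm (A z - B z) \<le> \<bar>\<eta> z\<bar> * (1 + norm (A z))"
      by (rule order_trans[OF elim(1)]) (intro mult_right_mono, auto)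
    also have "\<dots> \<le> \<bar>\<eta> z\<bar> * (1 + norm (B z) + norm (A z - B z))"
      using norm_triangle_ineq2[of "A z" "B z"] by (intro mult_left_mono) auto
    also have "\<dots> = \<bar>\<eta> z\<bar> * (1 + norm (B z)) + \<bar>\<eta> z\<bar> * norm (A z - B z)"
      by (simp add: algebra_simps)
    also have "\<bar>\<eta> z\<bar> * norm (A z - B z) \<le> (1/2) * norm (A z - B z)"
      using elim(2) by (intro mult_right_mono) auto
    finally show ?case by simp
  qed
  moreover have "((\<lambda>z. 2 * \<bar>\<eta> z\<bar> * (1 + norm (B z))) \<longlongrightarrow> 2 * \<bar>0\<bar> * (1 + norm b)) F"
    by (intro tendsto_intros \<eta> B)
  then have "((\<lambda>z. 2 * \<bar>\<eta> z\<bar> * (1 + norm (B z))) \<longlongrightarrow> 0) F"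
    by simp
  ultimately have "((\<lambda>z. A z - B z) \<longlongrightarrow> 0) F"
    by (rule Lim_null_comparison)
  from tendsto_add[OF this B] show ?thesis by simp
qed

text \<open>Here \<open>T z = (1 - R z)\<^sup>-\<^sup>1\<close>, \<open>S\<close> is the reduced resolvent of \<open>R0\<close>, and \<open>P (1 - R z) P = \<delta> z P\<close>. If
\<open>R0 - R z\<close> were equal to \<open>\<delta> z P\<close>, then \<open>T z\<close> would be \<open>P / \<delta> z\<close> plus a fixed operator. In general the bound of
\<open>R0 - R z\<close> by a multiple of \<open>\<delta> z\<close>, together with \<open>\<delta> z \<rightarrow> 0\<close>, makes all other terms negligible. The limit is
first shown for \<open>Y z = T z P \<delta> z\<close> and then extended to \<open>T z \<delta> z\<close>.\<close>

lemma resolvent_near_simple_eigenvalue: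
  fixes P S R0 :: "('b::banach \<times> 'b) \<Rightarrow>\<^sub>L ('b \<times> 'b)" and R T :: "'z \<Rightarrow> ('b \<times> 'b) \<Rightarrow>\<^sub>L ('b \<times> 'b)"
  assumes P: "complex_linear P" "P o\<^sub>L P = P" "P o\<^sub>L R0 = P" "R0 o\<^sub>L P = P"
    and S: "S o\<^sub>L (id_blinfun - R0) = id_blinfun - P" "(id_blinfun - R0) o\<^sub>L S = id_blinfun - P"
    and T: "eventually (\<lambda>z. inverse_blinfun (id_blinfun - R z) (T z)) F"
    and \<delta>: "eventually (\<lambda>z. P o\<^sub>L (R z o\<^sub>L P) = cscale (1 - \<delta> z) o\<^sub>L P) F"
    and \<delta>0: "eventually (\<lambda>z. \<delta> z \<noteq> 0) F" "(\<delta> \<longlongrightarrow> 0) F"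
    and R: "eventually (\<lambda>z. norm (R0 - R z) \<le> K * norm (\<delta> z)) F"
  shows "((\<lambda>z. T z o\<^sub>L cscale (\<delta> z)) \<longlongrightarrow> P) F"
proof -
  define d where "d z = norm (R0 - R z)" for z
  define Y where "Y z = T z o\<^sub>L P o\<^sub>L cscale (\<delta> z)" for z
  define Z where "Z z = T z o\<^sub>L cscale (\<delta> z)" for z
  define p where "p = norm P"
  define s where "s = norm S"
  have d0: "(d \<longlongrightarrow> 0) F"
  proof (rule Lim_null_comparison)
    show "eventually (\<lambda>z. norm (d z) \<le> K * norm (\<delta> z)) F"
      using R by (simp add: d_def)
    show "((\<lambda>z. K * norm (\<delta> z)) \<longlongrightarrow> 0) F"
      using tendsto_mult_right_zero[OF tendsto_norm_zero[OF \<delta>0(2)]] by simp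
  qed
  have nb: "norm (A o\<^sub>L B) \<le> a * b" if "norm A \<le> a" "norm B \<le> b" for A B :: "('b \<times> 'b) \<Rightarrow>\<^sub>L ('b \<times> 'b)" and a b
    by (rule order_trans[OF norm_blinfun_compose mult_mono])
      (use that norm_ge_zero order_trans in \<open>blast+\<close>)
  have sub: "y - p = b + e' - e - c" if "y = q + b - c" "p = q + e - e'"
    for y p q b c e e' :: "('b \<times> 'b) \<Rightarrow>\<^sub>L ('b \<times> 'b)"
    using that by simp
  have sub2: "y - q = b - c" if "y = q + b - c" for y q b c :: "('b \<times> 'b) \<Rightarrow>\<^sub>L ('b \<times> 'b)"
    using that by simp
  have ev: "eventually (\<lambda>z. norm (Y z - P) \<le>
        (4 * p * d z * s * p + 2 * norm (\<delta> z) * s * p + 2 * K * p * d z * s + s * d z) * (1 + norm (Y z))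
      \<and> norm (Z z - Y z) \<le> (2 * norm (\<delta> z) * s + 4 * d z * s) * (1 + norm (Z z))) F"
    using T \<delta> \<delta>0(1) R
  proof eventually_elim
    case (elim z)
    define D where "D = R0 - R z"
    define X where "X = T z o\<^sub>L P"
    let ?\<delta> = "cscale (\<delta> z)" and ?\<delta>' = "cscale (1 / \<delta> z)"
    have dd: "?\<delta>' o\<^sub>L ?\<delta> = id_blinfun" "?\<delta> o\<^sub>L ?\<delta>' = id_blinfun"
      using elim(3) by (simp_all add: cscale_mult[symmetric])
    have RD: "id_blinfun - R z = (id_blinfun - R0) + D"
      by (simp add: D_def)
    have TR: "T z o\<^sub>L (id_blinfun - R z) = id_blinfun" "(id_blinfun - R z) o\<^sub>L T z = id_blinfun"
      using elim(1) by (auto simp: inverse_blinfun_def)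
    \<comment> \<open>multiplying the equations for the inverse by \<open>S\<close> and by \<open>P\<close> splits \<open>T z\<close> into its parts on and off the range of \<open>P\<close>\<close>
    have "S o\<^sub>L (((id_blinfun - R0) + D) o\<^sub>L T z) = S"
      using TR(2) by (simp add: RD)
    then have "((S o\<^sub>L (id_blinfun - R0)) o\<^sub>L T z) + (S o\<^sub>L (D o\<^sub>L T z)) = S"
      by (simp add: blinfun_compose_simps blinfun_compose_assoc)
    then have r1: "T z = (P o\<^sub>L T z) + S - (S o\<^sub>L (D o\<^sub>L T z))"
      unfolding S(1) by (simp add: blinfun_compose_simps algebra_simps)
    have "(T z o\<^sub>L ((id_blinfun - R0) + D)) o\<^sub>L S = S"
      using TR(1) by (simp add: RD)
    then have "(T z o\<^sub>L ((id_blinfun - R0) o\<^sub>L S)) + (T z o\<^sub>L (D o\<^sub>L S)) = S"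
      by (simp add: blinfun_compose_simps blinfun_compose_assoc)
    then have r2: "T z = X + S - (T z o\<^sub>L (D o\<^sub>L S))"
      unfolding S(2) X_def by (simp add: blinfun_compose_simps algebra_simps)
    have "P o\<^sub>L (((id_blinfun - R0) + D) o\<^sub>L T z) = P"
      using TR(2) by (simp add: RD)
    then have "(P o\<^sub>L T z) - ((P o\<^sub>L R0) o\<^sub>L T z) + (P o\<^sub>L (D o\<^sub>L T z)) = P"
      by (simp add: blinfun_compose_simps blinfun_compose_assoc algebra_simps)
    then have r3: "P o\<^sub>L (D o\<^sub>L T z) = P"
      unfolding P(3) by simp
    have PDP: "P o\<^sub>L (D o\<^sub>L P) = ?\<delta> o\<^sub>L P"
    proof -
      have "P o\<^sub>L (D o\<^sub>L P) = (P o\<^sub>L R0 o\<^sub>L P) - (P o\<^sub>L (R z o\<^sub>L P))"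
        by (simp add: D_def blinfun_compose_simps blinfun_compose_assoc)
      then show ?thesis
        unfolding elim(2) by (simp add: P cscale_diff blinfun_compose_simps)
    qed
    have P\<delta>: "P o\<^sub>L cscale c = cscale c o\<^sub>L P" for c
      using P(1) by (simp add: complex_linear_def)
    have Yr: "Y z = (P o\<^sub>L Y z) + (S o\<^sub>L P o\<^sub>L ?\<delta>) - (S o\<^sub>L (D o\<^sub>L Y z))"
      unfolding Y_def by (subst r1) (simp add: blinfun_compose_simps blinfun_compose_assoc)
    have Y3: "P o\<^sub>L (D o\<^sub>L Y z) = ?\<delta> o\<^sub>L P"
    proof -
      have "P o\<^sub>L (D o\<^sub>L Y z) = (P o\<^sub>L (D o\<^sub>L T z)) o\<^sub>L (P o\<^sub>L ?\<delta>)"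
        by (simp add: Y_def blinfun_compose_assoc)
      also have "\<dots> = (P o\<^sub>L P) o\<^sub>L ?\<delta>"
        by (simp only: r3 blinfun_compose_assoc)
      finally show ?thesis
        by (simp add: P(2) P\<delta>)
    qed
    have "?\<delta> o\<^sub>L P = P o\<^sub>L (D o\<^sub>L ((P o\<^sub>L Y z) + (S o\<^sub>L P o\<^sub>L ?\<delta>) - (S o\<^sub>L (D o\<^sub>L Y z))))"
      using Y3 Yr by simp
    also have "\<dots> = ((P o\<^sub>L (D o\<^sub>L P)) o\<^sub>L Y z) + (P o\<^sub>L (D o\<^sub>L (S o\<^sub>L (P o\<^sub>L ?\<delta>)))) - (P o\<^sub>L (D o\<^sub>L (S o\<^sub>L (D o\<^sub>L Y z))))"
      by (simp add: blinfun_compose_simps blinfun_compose_assoc)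
    finally have "?\<delta>' o\<^sub>L (?\<delta> o\<^sub>L P) = ?\<delta>' o\<^sub>L (((?\<delta> o\<^sub>L P) o\<^sub>L Y z) + (P o\<^sub>L (D o\<^sub>L (S o\<^sub>L (P o\<^sub>L ?\<delta>)))) - (P o\<^sub>L (D o\<^sub>L (S o\<^sub>L (D o\<^sub>L Y z)))))"
      by (simp add: PDP)
    then have "(?\<delta>' o\<^sub>L ?\<delta>) o\<^sub>L P = ((?\<delta>' o\<^sub>L ?\<delta>) o\<^sub>L (P o\<^sub>L Y z)) + (?\<delta>' o\<^sub>L (P o\<^sub>L (D o\<^sub>L (S o\<^sub>L (P o\<^sub>L ?\<delta>))))) - (?\<delta>' o\<^sub>L (P o\<^sub>L (D o\<^sub>L (S o\<^sub>L (D o\<^sub>L Y z)))))"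
      by (simp add: blinfun_compose_simps blinfun_compose_assoc)
    then have "P = (P o\<^sub>L Y z) + (?\<delta>' o\<^sub>L (P o\<^sub>L (D o\<^sub>L (S o\<^sub>L (P o\<^sub>L ?\<delta>))))) - (?\<delta>' o\<^sub>L (P o\<^sub>L (D o\<^sub>L (S o\<^sub>L (D o\<^sub>L Y z)))))"
      by (simp add: dd)
    \<comment> \<open>an identity for \<open>Y z - P\<close> in which \<open>D\<close> or \<open>\<delta> z\<close> occurs in every summand\<close>
    from sub [OF Yr this] have Yeq: "Y z - P = (S o\<^sub>L P o\<^sub>L ?\<delta>) + (?\<delta>' o\<^sub>L (P o\<^sub>L (D o\<^sub>L (S o\<^sub>L (D o\<^sub>L Y z)))))
        - (?\<delta>' o\<^sub>L (P o\<^sub>L (D o\<^sub>L (S o\<^sub>L (P o\<^sub>L ?\<delta>))))) - (S o\<^sub>L (D o\<^sub>L Y z))" .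
    have nD: "norm D \<le> d z" "norm P \<le> p" "norm S \<le> s" "norm ?\<delta> \<le> 2 * norm (\<delta> z)"
        "norm ?\<delta>' \<le> 2 * (1 / norm (\<delta> z))" "d z \<le> K * norm (\<delta> z)"
      using elim(4) norm_cscale[of "\<delta> z"] norm_cscale[of "1 / \<delta> z"] by (simp_all add: D_def d_def p_def s_def norm_divide)
    have pos: "0 < norm (\<delta> z)" "0 \<le> d z" "0 \<le> p" "0 \<le> s"
      using elim(3) by (auto simp: d_def p_def s_def)
    have n1: "norm (S o\<^sub>L P o\<^sub>L ?\<delta>) \<le> s * p * (2 * norm (\<delta> z))"
      by (intro nb nD)
    have "norm (?\<delta>' o\<^sub>L (P o\<^sub>L (D o\<^sub>L (S o\<^sub>L (P o\<^sub>L ?\<delta>))))) \<le> 2 * (1 / norm (\<delta> z)) * (p * (d z * (s * (p * (2 * norm (\<delta> z))))))"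
      by (intro nb nD)
    then have n2: "norm (?\<delta>' o\<^sub>L (P o\<^sub>L (D o\<^sub>L (S o\<^sub>L (P o\<^sub>L ?\<delta>))))) \<le> 4 * p * d z * s * p"
      using pos by (simp add: field_simps)
    have n3: "norm (S o\<^sub>L (D o\<^sub>L Y z)) \<le> s * (d z * norm (Y z))"
      by (intro nb nD) simp
    have "norm (?\<delta>' o\<^sub>L (P o\<^sub>L (D o\<^sub>L (S o\<^sub>L (D o\<^sub>L Y z))))) \<le> 2 * (1 / norm (\<delta> z)) * (p * (d z * (s * (K * norm (\<delta> z) * norm (Y z)))))"
      by (intro nb nD order_trans[OF nD(1) nD(6)]) simp
    then have n4: "norm (?\<delta>' o\<^sub>L (P o\<^sub>L (D o\<^sub>L (S o\<^sub>L (D o\<^sub>L Y z))))) \<le> 2 * K * p * d z * s * norm (Y z)"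
      using pos by (simp add: field_simps)
    have Kd: "0 \<le> K"
      using nD(6) pos by (smt (verit) mult_neg_pos)
    have "norm (Y z - P) \<le> s * p * (2 * norm (\<delta> z)) + 2 * K * p * d z * s * norm (Y z) + 4 * p * d z * s * p + s * (d z * norm (Y z))"
      unfolding Yeq by (intro norm_triangle_le_diff norm_triangle_le add_mono n1 n2 n3 n4)
    also have "\<dots> \<le> (4 * p * d z * s * p + 2 * norm (\<delta> z) * s * p + 2 * K * p * d z * s + s * d z) * (1 + norm (Y z))"
    proof -
      have "0 \<le> (4 * p * d z * s * p + 2 * norm (\<delta> z) * s * p) * norm (Y z) + (2 * K * p * d z * s + s * d z)"
        using pos Kd by simp
      then show ?thesis by (simp add: algebra_simps)
    qed
    finally have first: "norm (Y z - P) \<le> (4 * p * d z * s * p + 2 * norm (\<delta> z) * s * p + 2 * K * p * d z * s + s * d z) * (1 + norm (Y z))" .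
    have "Z z = (X + S - (T z o\<^sub>L (D o\<^sub>L S))) o\<^sub>L ?\<delta>"
      unfolding Z_def by (subst r2) simp
    also have "T z = Z z o\<^sub>L ?\<delta>'"
      by (simp add: Z_def blinfun_compose_assoc dd)
    finally have "Z z = Y z + (S o\<^sub>L ?\<delta>) - (Z z o\<^sub>L (?\<delta>' o\<^sub>L (D o\<^sub>L (S o\<^sub>L ?\<delta>))))"
      by (simp add: X_def Y_def blinfun_compose_simps blinfun_compose_assoc)
    from sub2[OF this]
    have "Z z - Y z = (S o\<^sub>L ?\<delta>) - (Z z o\<^sub>L (?\<delta>' o\<^sub>L (D o\<^sub>L (S o\<^sub>L ?\<delta>))))" .
    moreover have "norm (S o\<^sub>L ?\<delta>) \<le> s * (2 * norm (\<delta> z))"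
      by (intro nb nD)
    moreover have "norm (Z z o\<^sub>L (?\<delta>' o\<^sub>L (D o\<^sub>L (S o\<^sub>L ?\<delta>)))) \<le> norm (Z z) * (2 * (1 / norm (\<delta> z)) * (d z * (s * (2 * norm (\<delta> z)))))"
      by (intro nb nD) simp
    ultimately have "norm (Z z - Y z) \<le> s * (2 * norm (\<delta> z)) + norm (Z z) * (2 * (1 / norm (\<delta> z)) * (d z * (s * (2 * norm (\<delta> z)))))"
      by (simp only: norm_triangle_le_diff add_mono)
    also have "\<dots> = 2 * norm (\<delta> z) * s + 4 * d z * s * norm (Z z)"
      using pos by (simp add: field_simps)
    also have "\<dots> \<le> (2 * norm (\<delta> z) * s + 4 * d z * s) * (1 + norm (Z z))"
      using pos by (simp add: algebra_simps)
    finally show ?case using first by simp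
  qed
  have "((\<lambda>z. 4 * p * d z * s * p + 2 * norm (\<delta> z) * s * p + 2 * K * p * d z * s + s * d z) \<longlongrightarrow>
      4 * p * 0 * s * p + 2 * norm (0::complex) * s * p + 2 * K * p * 0 * s + s * 0) F"
    by (intro tendsto_intros d0 \<delta>0)
  then have "((\<lambda>z. 4 * p * d z * s * p + 2 * norm (\<delta> z) * s * p + 2 * K * p * d z * s + s * d z) \<longlongrightarrow> 0) F"
    by simp
  from this tendsto_const conjunct1[OF ev[unfolded eventually_conj_iff]]
  have Y: "(Y \<longlongrightarrow> P) F"
    by (rule tendsto_of_relative_error)
  have "((\<lambda>z. 2 * norm (\<delta> z) * s + 4 * d z * s) \<longlongrightarrow> 2 * norm (0::complex) * s + 4 * 0 * s) F"
    by (intro tendsto_intros d0 \<delta>0)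
  then have "((\<lambda>z. 2 * norm (\<delta> z) * s + 4 * d z * s) \<longlongrightarrow> 0) F"
    by simp
  from this Y conjunct2[OF ev[unfolded eventually_conj_iff]] have "(Z \<longlongrightarrow> P) F"
    by (rule tendsto_of_relative_error)
  then show ?thesis
    unfolding Z_def .
qed

section \<open>Spectral projection and reduced resolvent\<close>

lemma inverse_resolvent:
  assumes "z \<notin> cspectrum T"
  shows "inverse_blinfun (cscale z - T) (resolvent T z)"
proof -
  obtain S where "inverse_blinfun (cscale z - T) S"
    using assms by (auto simp: cspectrum_def)
  then show ?thesis
    unfolding resolvent_def by (rule theI) (rule inverse_blinfun_unique[OF _ \<open>inverse_blinfun (cscale z - T) S\<close>])
qed

lemma spectral_projection_eqI:
  assumes "\<delta> > 0" "\<And>r. 0 < r \<Longrightarrow> r < \<delta> \<Longrightarrow> riesz_integral T c r = Q"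
  shows "spectral_projection T c = Q"
  unfolding spectral_projection_def
proof (rule the_equality)
  show ev: "\<forall>\<^sub>F r in at_right 0. riesz_integral T c r = Q"
    using eventually_at_right_real[OF assms(1)] by eventually_elim (use assms(2) in auto)
  fix Q' assume "\<forall>\<^sub>F r in at_right 0. riesz_integral T c r = Q'"
  with ev have "\<forall>\<^sub>F r in at_right (0::real). Q' = Q"
    by eventually_elim simp
  then show "Q' = Q" by simp
qed

text \<open>The two projections agree: integrating over a small circle gives \<open>P Q = Q P = P\<close> for the Riesz
projection \<open>Q\<close>, and both have one-dimensional range. Integrating the resolvent itself, without the
factor \<open>\<zeta>\<close>, gives the inverse of \<open>1 - T\<close> on the complement.\<close>

lemma reduced_resolvent:
  fixes T P :: "('b::banach \<times> 'b) \<Rightarrow>\<^sub>L ('b \<times> 'b)"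
  assumes simple: "simple_isolated_eigenvalue T 1" and T: "complex_linear T"
    and P: "complex_linear P" "P o\<^sub>L T = P" "T o\<^sub>L P = P"
    and e: "P e = e" "e \<noteq> 0" "\<And>v. \<exists>a. P v = cscale a e"
  obtains S where "S o\<^sub>L (id_blinfun - T) = id_blinfun - P" "(id_blinfun - T) o\<^sub>L S = id_blinfun - P"
proof -
  have "1 isolated_in cspectrum T"
    using simple by (simp add: simple_isolated_eigenvalue_def)
  then obtain \<delta> where \<delta>: "\<delta> > 0" "\<And>z. z \<in> cspectrum T \<Longrightarrow> dist 1 z < \<delta> \<Longrightarrow> z = 1"
    unfolding isolated_in_dist_Ex_iff by blast
  define A where "A = {\<zeta>::complex. 0 < norm \<zeta> \<and> norm \<zeta> < \<delta>}"
  define U where "U \<zeta> = resolvent T (1 + \<zeta>)" for \<zeta>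
  have inv: "inverse_blinfun (cscale (1 + \<zeta>) - T) (U \<zeta>)" if "\<zeta> \<in> A" for \<zeta>
    unfolding U_def using that \<delta>(2)[of "1 + \<zeta>"]
    by (intro inverse_resolvent) (auto simp: A_def dist_norm)
  have lin: "complex_linear (U \<zeta>)" if "\<zeta> \<in> A" for \<zeta>
    by (rule complex_linear_inverse[OF inv[OF that] complex_linear_diff[OF complex_linear_cscale T]])
  have "open A"
  proof -
    have "A = ball 0 \<delta> - {0}" by (auto simp: A_def)
    then show ?thesis by (simp add: open_delete)
  qed
  have holU: "blinfun_holomorphic_on U A"
  proof (rule blinfun_holomorphic_on_inverse[OF _ \<open>open A\<close> inv lin])
    show "blinfun_holomorphic_on (\<lambda>\<zeta>. cscale (1 + \<zeta>) - T) A"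
    proof (rule blinfun_holomorphic_onI[where G' = "\<lambda>_. id_blinfun"])
      show "((\<lambda>\<zeta>. cscale (1 + \<zeta>) - T) has_derivative (\<lambda>h. cscale h o\<^sub>L id_blinfun)) (at z)" for z
        by (auto intro!: derivative_eq_intros bounded_linear.has_derivative[OF bounded_linear_cscale])
    qed simp
  qed
  then have contU: "continuous_on A U"
    by (rule blinfun_holomorphic_on_imp_continuous_on)
  have holG: "blinfun_holomorphic_on (\<lambda>\<zeta>. cscale \<zeta> o\<^sub>L U \<zeta>) A"
    by (rule blinfun_holomorphic_on_cscale[OF _ _ holU, where \<phi>' = "\<lambda>_. 1"]) auto
  define r where "r = \<delta> / 2"
  have r: "0 < r" "r < \<delta>" using \<delta>(1) by (simp_all add: r_def)
  have in_A: "of_real s * cis t \<in> A" if "0 < s" "s < \<delta>" for s t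
    using that by (simp add: A_def norm_mult)
  define Q where "Q = riesz_integral T 1 r"
  have riesz: "riesz_integral T 1 s = (1 / (2 * pi)) *\<^sub>R integral {0..0 + 2*pi} (\<lambda>t. cscale (of_real s * cis t) o\<^sub>L U (of_real s * cis t))" for s
    by (simp add: riesz_integral_def U_def)
  have "riesz_integral T 1 s = Q" if "0 < s" "s < \<delta>" for s
    unfolding Q_def riesz
    using circle_integral_independent_of_radius[OF holG[unfolded A_def] order_refl that r, of 0] by simp
  then have Q: "spectral_projection T 1 = Q"
    by (rule spectral_projection_eqI[OF \<delta>(1)])
  let ?z = "\<lambda>t. of_real r * cis t"
  define S where "S = (1 / (2 * pi)) *\<^sub>R integral {0..2*pi} (\<lambda>t. U (?z t))"
  have intU: "((\<lambda>t. U (?z t)) has_integral (2 * pi) *\<^sub>R S) {0..2*pi}"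
    unfolding S_def using in_A[OF r]
    by (auto intro!: integrable_integral integrable_continuous_interval continuous_intros continuous_on_compose2[OF contU])
  have intG: "((\<lambda>t. cscale (?z t) o\<^sub>L U (?z t)) has_integral (2 * pi) *\<^sub>R Q) {0..2*pi}"
    unfolding Q_def riesz using in_A[OF r]
    by (auto intro!: integrable_integral integrable_continuous_interval continuous_intros continuous_on_compose2[OF contU])
  have const: "((\<lambda>t. X) has_integral (2 * pi) *\<^sub>R X) {0..2*pi}" for X :: "('b \<times> 'b) \<Rightarrow>\<^sub>L ('b \<times> 'b)"
    using has_integral_const_real[of X 0 "2 * pi"] by simp
  have cancel: "X = Y" if "((\<lambda>t. F t) has_integral (2 * pi) *\<^sub>R X) {0..2*pi}" "((\<lambda>t. F t) has_integral (2 * pi) *\<^sub>R Y) {0..2*pi}"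
    for F :: "real \<Rightarrow> ('b \<times> 'b) \<Rightarrow>\<^sub>L ('b \<times> 'b)" and X Y
    using has_integral_unique[OF that] by simp
  have comm: "A' o\<^sub>L cscale c = cscale c o\<^sub>L A'" if "complex_linear A'" for A' :: "('b \<times> 'b) \<Rightarrow>\<^sub>L ('b \<times> 'b)" and c
    using that by (simp add: complex_linear_def)
  have left: "(id_blinfun - T) o\<^sub>L U \<zeta> = id_blinfun - (cscale \<zeta> o\<^sub>L U \<zeta>)" and
    right: "U \<zeta> o\<^sub>L (id_blinfun - T) = id_blinfun - (cscale \<zeta> o\<^sub>L U \<zeta>)" if "\<zeta> \<in> A" for \<zeta>
  proof -
    have "(id_blinfun - T) o\<^sub>L U \<zeta> = ((cscale (1 + \<zeta>) - T) o\<^sub>L U \<zeta>) - (cscale \<zeta> o\<^sub>L U \<zeta>)"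
      by (simp add: cscale_add blinfun_compose_simps)
    then show "(id_blinfun - T) o\<^sub>L U \<zeta> = id_blinfun - (cscale \<zeta> o\<^sub>L U \<zeta>)"
      using inv[OF that] by (simp add: inverse_blinfun_def)
    have "U \<zeta> o\<^sub>L (id_blinfun - T) = (U \<zeta> o\<^sub>L (cscale (1 + \<zeta>) - T)) - (U \<zeta> o\<^sub>L cscale \<zeta>)"
      by (simp add: cscale_add blinfun_compose_simps)
    then show "U \<zeta> o\<^sub>L (id_blinfun - T) = id_blinfun - (cscale \<zeta> o\<^sub>L U \<zeta>)"
      using inv[OF that] comm[OF lin[OF that]] by (simp add: inverse_blinfun_def)
  qed
  have PU: "P o\<^sub>L (cscale \<zeta> o\<^sub>L U \<zeta>) = P" and UP: "(cscale \<zeta> o\<^sub>L U \<zeta>) o\<^sub>L P = P" if "\<zeta> \<in> A" for \<zeta>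
  proof -
    have "P o\<^sub>L ((id_blinfun - T) o\<^sub>L U \<zeta>) = 0"
      unfolding blinfun_compose_assoc[symmetric] by (simp add: blinfun_compose_simps P)
    then show "P o\<^sub>L (cscale \<zeta> o\<^sub>L U \<zeta>) = P"
      unfolding left[OF that] by (simp add: blinfun_compose_simps)
    have "(U \<zeta> o\<^sub>L (id_blinfun - T)) o\<^sub>L P = 0"
      unfolding blinfun_compose_assoc by (simp add: blinfun_compose_simps P)
    then show "(cscale \<zeta> o\<^sub>L U \<zeta>) o\<^sub>L P = P"
      unfolding right[OF that] by (simp add: blinfun_compose_simps)
  qed
  have "P o\<^sub>L Q = P"
  proof (rule cancel)
    show "((\<lambda>t. P) has_integral (2 * pi) *\<^sub>R (P o\<^sub>L Q)) {0..2*pi}"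
      using has_integral_linear[OF intG blinfun_compose.bounded_linear_right[of P]]
      by (simp add: o_def PU[OF in_A[OF r]] blinfun_compose_simps)
  qed (rule const)
  have "Q o\<^sub>L P = P"
  proof (rule cancel)
    show "((\<lambda>t. P) has_integral (2 * pi) *\<^sub>R (Q o\<^sub>L P)) {0..2*pi}"
      using has_integral_linear[OF intG blinfun_compose.bounded_linear_left[of P]]
      by (simp add: o_def UP[OF in_A[OF r]] blinfun_compose_simps)
  qed (rule const)
  \<comment> \<open>\<open>e\<close> spans the one-dimensional range of \<open>Q\<close>, so \<open>P\<close> is the identity there and \<open>Q = P o Q = P\<close>\<close>
  have "Q = P"
  proof (rule blinfun_eqI)
    fix v
    obtain x where x: "x \<noteq> 0" "range (blinfun_apply Q) = range (\<lambda>a. blinfun_apply (cscale a) x)"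
      using simple Q by (auto simp: simple_isolated_eigenvalue_def)
    have "Q (P e) = P e"
      using arg_cong[OF \<open>Q o\<^sub>L P = P\<close>, of "\<lambda>X. blinfun_apply X e"] by simp
    then have "e \<in> range (blinfun_apply Q)"
      unfolding e(1) by (intro image_eqI[of _ _ e]) auto
    then obtain a where a: "e = cscale a x"
      unfolding x(2) by blast
    have "a \<noteq> 0" using a e(2) by auto
    obtain b where b: "Q v = cscale b x"
      using rangeI[of "blinfun_apply Q" v] unfolding x(2) by blast
    have "Q v = cscale (b / a) e"
      using \<open>a \<noteq> 0\<close> by (simp add: a b flip: blinfun_apply_blinfun_compose cscale_mult)
    moreover have "P (cscale (b / a) e) = cscale (b / a) e"
      using arg_cong[OF comm[OF P(1), of "b / a"], of "\<lambda>X. blinfun_apply X e"] e(1) by simp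
    ultimately have "Q v = P (Q v)" by simp
    also have "\<dots> = P v"
      using arg_cong[OF \<open>P o\<^sub>L Q = P\<close>, of "\<lambda>X. blinfun_apply X v"] by simp
    finally show "Q v = P v" .
  qed
  have intIG: "((\<lambda>t. id_blinfun - (cscale (?z t) o\<^sub>L U (?z t))) has_integral (2 * pi) *\<^sub>R (id_blinfun - P)) {0..2*pi}"
    using has_integral_diff[OF const intG] by (simp add: \<open>Q = P\<close> scaleR_diff_right)
  show ?thesis
  proof (rule that)
    show "S o\<^sub>L (id_blinfun - T) = id_blinfun - P"
      using has_integral_linear[OF intU blinfun_compose.bounded_linear_left[of "id_blinfun - T"]]
      by (intro cancel[OF _ intIG]) (simp only: o_def right[OF in_A[OF r]] blinfun_compose.scaleR_left)
    show "(id_blinfun - T) o\<^sub>L S = id_blinfun - P"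
      using has_integral_linear[OF intU blinfun_compose.bounded_linear_right[of "id_blinfun - T"]]
      by (intro cancel[OF _ intIG]) (simp only: o_def left[OF in_A[OF r]] blinfun_compose.scaleR_right)
  qed
qed

section \<open>Decreasing sequences and their power series\<close>

text \<open>Riemann sums as integrals of step functions: dominated convergence then applies to averages of
sequences.\<close>

lemma has_integral_floor_step:
  fixes g :: "nat \<Rightarrow> real"
  assumes "n > 0"
  shows "((\<lambda>t. g (nat \<lfloor>real n * t\<rfloor>)) has_integral (\<Sum>k<m. g k) / n) {0..m / n}"
proof (induction m)
  case 0
  show ?case by (simp add: has_integral_refl)
next
  case (Suc m)
  have "((\<lambda>t. g (nat \<lfloor>real n * t\<rfloor>)) has_integral g m / n) (cbox (m / n) (Suc m / n))"
  proof (rule has_integral_spike_interior)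
    have "((\<lambda>t. g m) has_integral (Suc m / n - m / n) *\<^sub>R g m) {m / n..Suc m / n}"
      by (rule has_integral_const_real[THEN has_integral_eq_rhs]) (simp add: divide_right_mono)
    then show "((\<lambda>t. g m) has_integral g m / n) (cbox (m / n) (Suc m / n))"
      using assms by (simp add: field_simps)
    fix t assume "t \<in> box (real m / n) (Suc m / n)"
    then have "real m < n * t" "n * t < real m + 1"
      using assms by (simp_all add: field_simps)
    then have "\<lfloor>real n * t\<rfloor> = int m"
      by linarith
    then show "g (nat \<lfloor>real n * t\<rfloor>) = g m" by simp
  qed
  from has_integral_combine[OF _ _ Suc this[unfolded box_real]] show ?case
    using assms by (simp add: divide_right_mono add_divide_distrib add.commute)
qed

lemma summation_by_parts:
  fixes h :: "nat \<Rightarrow> real" and z :: complex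
  defines "H \<equiv> \<lambda>k. \<Sum>j<k. h j"
  shows "(\<Sum>k<m. of_real (h k) * z ^ k) = of_real (H m) * z ^ m + (1 - z) * (\<Sum>k<m. of_real (H (Suc k)) * z ^ k)"
  by (induction m) (simp_all add: H_def algebra_simps)

text \<open>Summation by parts trades the terms \<open>h k\<close> for their partial sums. This is useful where only the
partial sums of two sequences are close to each other.\<close>

lemma norm_sum_le_partial_sums:
  fixes h :: "nat \<Rightarrow> real" and z :: complex
  defines "H \<equiv> \<lambda>k. \<Sum>j<k. h j"
  assumes "norm z \<le> 1"
  shows "norm (\<Sum>k<m. of_real (h k) * z ^ k) \<le> \<bar>H m\<bar> + norm (1 - z) * (\<Sum>k<Suc m. \<bar>H k\<bar>)"
proof -
  have zk: "norm (z ^ k) \<le> 1" for k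
    using assms(2) by (simp add: norm_power power_le_one)
  have "norm (\<Sum>k<m. of_real (H (Suc k)) * z ^ k) \<le> (\<Sum>k<m. \<bar>H (Suc k)\<bar>)"
    by (intro order_trans[OF norm_sum] sum_mono) (use zk in \<open>simp add: norm_mult mult_left_le\<close>)
  also have "\<dots> \<le> (\<Sum>k<Suc m. \<bar>H k\<bar>)"
    by (subst sum.lessThan_Suc_shift) simp
  finally have 1: "norm (\<Sum>k<m. of_real (H (Suc k)) * z ^ k) \<le> (\<Sum>k<Suc m. \<bar>H k\<bar>)" .
  have "norm (\<Sum>k<m. of_real (h k) * z ^ k) \<le> norm (of_real (H m) * z ^ m) + norm ((1 - z) * (\<Sum>k<m. of_real (H (Suc k)) * z ^ k))"
    unfolding summation_by_parts[of h] H_def by (rule norm_triangle_ineq)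
  also have "norm (of_real (H m) * z ^ m) \<le> \<bar>H m\<bar>"
    using zk[of m] by (simp add: norm_mult mult_left_le)
  also have "norm ((1 - z) * (\<Sum>k<m. of_real (H (Suc k)) * z ^ k)) \<le> norm (1 - z) * (\<Sum>k<Suc m. \<bar>H k\<bar>)"
    unfolding norm_mult using 1 by (rule mult_left_mono) simp
  finally show ?thesis by simp
qed

text \<open>The letter \<open>p\<close> stands for the tails of the return time, the drops \<open>p k - p (k + 1)\<close> for its
distribution, and \<open>M\<close> for the truncated mean.\<close>

locale decreasing_seq =
  fixes p :: "nat \<Rightarrow> real"
  assumes decreasing: "decseq p" and nonneg: "\<And>n. p n \<ge> 0"
begin

definition M :: "nat \<Rightarrow> real" where "M n = (\<Sum>k<n. p k)"

definition gen :: "complex \<Rightarrow> complex" where "gen z = (\<Sum>k. of_real (p k) * z ^ k)"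

lemma p_le: "j \<le> k \<Longrightarrow> p k \<le> p j"
  using decreasing by (simp add: decseq_def)

lemma M_mono: "j \<le> k \<Longrightarrow> M j \<le> M k"
  unfolding M_def by (rule sum_mono2) (auto simp: nonneg)

lemma M_nonneg: "0 \<le> M n"
  unfolding M_def by (rule sum_nonneg) (simp add: nonneg)

lemma M_0 [simp]: "M 0 = 0"
  by (simp add: M_def)

lemma M_Suc: "M (Suc n) = M n + p n"
  by (simp add: M_def)

lemma p_le_average: "n * p n \<le> M n"
  using sum_mono[of "{..<n}" "\<lambda>_. p n" p] by (simp add: M_def p_le)

lemma summable_drops: "summable (\<lambda>k. p k - p (Suc k))"
proof (rule summableI_nonneg_bounded[where x = "p 0"])
  show "(\<Sum>k<n. p k - p (Suc k)) \<le> p 0" for n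
    using sum_lessThan_telescope'[of p n] nonneg[of n] by simp
qed (simp add: p_le)

lemma suminf_drops_le: "(\<Sum>k. p k - p (Suc k)) \<le> p 0"
proof (rule suminf_le_const[OF summable_drops])
  show "(\<Sum>k<n. p k - p (Suc k)) \<le> p 0" for n
    using sum_lessThan_telescope'[of p n] nonneg[of n] by simp
qed

lemma summable_gen: "norm z < 1 \<Longrightarrow> summable (\<lambda>k. of_real (p k) * z ^ k :: complex)"
proof (rule summable_comparison_test'[where N = 0 and g = "\<lambda>k. p 0 * norm z ^ k"])
  show "summable (\<lambda>k. p 0 * norm z ^ k)" if "norm z < 1"
    using that by (intro summable_mult summable_geometric) simp
  show "norm (of_real (p n) * z ^ n) \<le> p 0 * norm z ^ n" for n
    by (simp add: norm_mult norm_power nonneg p_le mult_right_mono)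
qed

lemma summable_drops_power:
  "norm z \<le> 1 \<Longrightarrow> summable (\<lambda>k. norm (of_real (p k - p (Suc k)) * z ^ Suc k :: complex))"
  by (rule summable_comparison_test'[OF summable_drops, where N = 0])
    (simp add: norm_mult norm_power p_le mult_left_le power_le_one mult_le_one del: power_Suc of_real_diff)

lemma one_minus_times_gen:
  assumes "norm z < 1"
  shows "(1 - z) * gen z = of_real (p 0) - (\<Sum>k. of_real (p k - p (Suc k)) * z ^ Suc k)"
proof -
  have s: "summable (\<lambda>k. of_real (p k) * z ^ k)"
    by (rule summable_gen[OF assms])
  then have s1: "summable (\<lambda>k. of_real (p (Suc k)) * z ^ Suc k)"
    by (subst summable_Suc_iff)
  have s2: "summable (\<lambda>k. of_real (p k) * z ^ Suc k)"
    using summable_mult[OF s, of z] by (simp add: mult_ac)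
  have "(\<Sum>k. of_real (p k - p (Suc k)) * z ^ Suc k) =
      (\<Sum>k. of_real (p k) * z ^ Suc k) - (\<Sum>k. of_real (p (Suc k)) * z ^ Suc k)"
    by (subst suminf_diff[OF s2 s1]) (simp add: algebra_simps)
  also have "(\<Sum>k. of_real (p k) * z ^ Suc k) = z * gen z"
    unfolding gen_def by (subst suminf_mult[OF s, symmetric]) (simp add: mult_ac)
  also have "(\<Sum>k. of_real (p (Suc k)) * z ^ Suc k) = gen z - of_real (p 0)"
    unfolding gen_def by (subst suminf_split_head[OF s]) simp
  finally show ?thesis by (simp add: algebra_simps)
qed

lemma norm_one_minus_times_gen_le:
  assumes "norm z < 1"
  shows "norm ((1 - z) * gen z) \<le> 2 * p 0"
proof -
  have "norm (\<Sum>k. of_real (p k - p (Suc k)) * z ^ Suc k) \<le> (\<Sum>k. norm (of_real (p k - p (Suc k)) * z ^ Suc k))"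
    using assms by (intro summable_norm summable_drops_power) simp
  also have "\<dots> \<le> (\<Sum>k. p k - p (Suc k))"
    using assms
    by (intro suminf_le summable_drops_power summable_drops)
      (simp_all add: norm_mult norm_power p_le mult_left_le power_le_one mult_le_one del: power_Suc of_real_diff)
  also have "\<dots> \<le> p 0"
    by (rule suminf_drops_le)
  finally have "norm (of_real (p 0) - (\<Sum>k. of_real (p k - p (Suc k)) * z ^ Suc k)) \<le> \<bar>p 0\<bar> + p 0"
    by (intro norm_triangle_le_diff add_mono) simp_all
  then show ?thesis
    using one_minus_times_gen[OF assms] nonneg[of 0] by simp
qed

lemma decreasing_seq_shift: "decreasing_seq (\<lambda>k. p (k + m))"
  by unfold_locales (auto simp: decseq_def p_le nonneg)

text \<open>Monotonicity replaces absolute summability: multiplying by \<open>1 - z\<close> telescopes the tail of the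
series.\<close>

lemma gen_tail_bound:
  assumes "norm z < 1"
  shows "norm (1 - z) * norm (gen z - (\<Sum>k<m. of_real (p k) * z ^ k)) \<le> 2 * p m"
proof -
  have "gen z - (\<Sum>k<m. of_real (p k) * z ^ k) = (\<Sum>k. of_real (p (k + m)) * z ^ (k + m))"
    unfolding gen_def by (rule suminf_minus_initial_segment[OF summable_gen[OF assms], symmetric])
  also have "\<dots> = z ^ m * decreasing_seq.gen (\<lambda>k. p (k + m)) z"
    unfolding decreasing_seq.gen_def[OF decreasing_seq_shift]
    by (subst suminf_mult[OF decreasing_seq.summable_gen[OF decreasing_seq_shift assms], symmetric])
      (simp add: power_add mult_ac)
  finally have "norm (1 - z) * norm (gen z - (\<Sum>k<m. of_real (p k) * z ^ k))
      = norm z ^ m * norm ((1 - z) * decreasing_seq.gen (\<lambda>k. p (k + m)) z)"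
    by (simp add: norm_mult norm_power)
  also have "\<dots> \<le> 1 * (2 * p m)"
    using assms decreasing_seq.norm_one_minus_times_gen_le[OF decreasing_seq_shift assms, of m]
    by (intro mult_mono) (auto simp: power_le_one)
  finally show ?thesis by simp
qed

text \<open>The truncated mean \<open>\<Sum>\<^sub>k P(\<phi> = k + 1) min (k + 1, N)\<close> of the return time \<open>\<phi>\<close> equals \<open>M N\<close>, up to a boundary term.\<close>

lemma sum_drops_min: "(\<Sum>k<K. (p k - p (Suc k)) * real (min (Suc k) N)) = M (min K N) - p K * real (min K N)"
proof (induction K)
  case 0
  then show ?case by (simp add: M_def)
next
  case (Suc K)
  show ?case
  proof (cases "K < N")
    case True
    then have "min (Suc K) N = Suc K" "min K N = K" by simp_all
    with Suc show ?thesis by (simp add: M_Suc algebra_simps)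
  next
    case False
    then have "min (Suc K) N = N" "min K N = N" by simp_all
    with Suc show ?thesis by (simp add: algebra_simps)
  qed
qed

text \<open>A modulus of continuity at scale \<open>1/N\<close> for the generating function of the drops: for \<open>k < N\<close> the
powers differ by at most \<open>(k + 1) |z - w|\<close>, for larger \<open>k\<close> by at most \<open>2\<close>, and the truncated mean
collects both contributions.\<close>

lemma drops_power_diff:
  fixes z w :: complex
  assumes "norm z \<le> 1" "norm w \<le> 1" "K \<ge> 2" "N > 0" "norm (z - w) \<le> K / N"
  shows "summable (\<lambda>k. (p k - p (Suc k)) * norm (z ^ Suc k - w ^ Suc k))"
    and "(\<Sum>k. (p k - p (Suc k)) * norm (z ^ Suc k - w ^ Suc k)) \<le> K * M N / N"
proof -
  have le: "norm (z ^ Suc k - w ^ Suc k) \<le> K / N * real (min (Suc k) N)" for k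
  proof (cases "Suc k \<le> N")
    case True
    have "norm (z ^ Suc k - w ^ Suc k) \<le> Suc k * norm (z - w)"
      by (rule norm_power_diff[OF assms(1,2)])
    also have "\<dots> \<le> Suc k * (K / N)"
      by (rule mult_left_mono[OF assms(5)]) simp
    finally show ?thesis using True by (simp add: mult.commute min_absorb1)
  next
    case False
    have "norm (z ^ Suc k - w ^ Suc k) \<le> norm z ^ Suc k + norm w ^ Suc k"
      by (metis norm_power norm_triangle_ineq4)
    also have "\<dots> \<le> 1 + 1"
      using assms(1,2) by (intro add_mono power_le_one) auto
    finally show ?thesis using False assms(3,4) by (simp add: min_absorb2)
  qed
  have bound: "(\<Sum>k<m. (p k - p (Suc k)) * norm (z ^ Suc k - w ^ Suc k)) \<le> K * M N / N" for m
  proof -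
    have "(\<Sum>k<m. (p k - p (Suc k)) * norm (z ^ Suc k - w ^ Suc k)) \<le>
        (\<Sum>k<m. (p k - p (Suc k)) * (K / N * real (min (Suc k) N)))"
      by (intro sum_mono mult_left_mono le) (simp add: p_le)
    also have "\<dots> = K / N * (\<Sum>k<m. (p k - p (Suc k)) * real (min (Suc k) N))"
      by (simp add: sum_distrib_left mult_ac)
    also have "\<dots> \<le> K / N * M N"
    proof (rule mult_left_mono)
      show "(\<Sum>k<m. (p k - p (Suc k)) * real (min (Suc k) N)) \<le> M N"
        unfolding sum_drops_min using M_mono[of "min m N" N] nonneg[of m]
        by (smt (verit) min.cobounded2 mult_nonneg_nonneg of_nat_0_le_iff)
    qed (use assms in simp)
    finally show ?thesis by simp
  qed
  show s: "summable (\<lambda>k. (p k - p (Suc k)) * norm (z ^ Suc k - w ^ Suc k))"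
    by (rule summableI_nonneg_bounded[OF _ bound]) (simp add: p_le)
  show "(\<Sum>k. (p k - p (Suc k)) * norm (z ^ Suc k - w ^ Suc k)) \<le> K * M N / N"
    by (rule suminf_le_const[OF s bound])
qed

end

section \<open>The model sequence\<close>

text \<open>Coefficients of \<open>(1 - z)\<^sup>-\<^sup>b\<close>. They serve as the exactly solvable case both in the Abelian theorem
(with \<open>b = \<alpha>\<close>) and for the singular part of the resolvent (with \<open>b = 1 - \<alpha>\<close>).\<close>

definition model :: "real \<Rightarrow> nat \<Rightarrow> real" where "model b k = pochhammer b k / fact k"

lemma model_Suc: "model b (Suc k) = model b k * (b + k) / (Suc k)"
  by (simp add: model_def pochhammer_Suc divide_simps)

lemma model_nonneg: "0 \<le> b \<Longrightarrow> 0 \<le> model b k"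
  by (induction k) (simp_all add: model_Suc, simp add: model_def)

lemma decreasing_model:
  assumes "0 \<le> b" "b \<le> 1"
  shows "decreasing_seq (model b)"
proof
  have "model b (Suc k) \<le> model b k" for k
    using mult_left_mono[of "b + k" "Suc k" "model b k"] assms
    by (simp add: model_Suc model_nonneg divide_simps)
  then show "decseq (model b)"
    by (rule decseq_SucI)
qed (simp add: model_nonneg assms)

lemma sum_model: "(\<Sum>k<Suc n. model b k) = model (1 + b) n"
proof (induction n)
  case (Suc n)
  have "model (1 + b) (Suc n) = model (1 + b) n * (1 + b + n) / Suc n"
    by (rule model_Suc)
  moreover have "model b (Suc n) = model (1 + b) n * b / Suc n"
  proof -
    have "b * pochhammer (1 + b) n = pochhammer b (Suc n)"
      by (simp add: pochhammer_rec add.commute)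
    then show ?thesis
      by (simp add: model_def divide_simps mult.commute)
  qed
  moreover have "(\<Sum>k<Suc (Suc n). model b k) = model (1 + b) n + model b (Suc n)"
    using Suc by simp
  ultimately show ?case
    by (simp only:) (simp add: field_simps)
qed (simp add: model_def)

lemma model_sums:
  fixes z :: complex
  assumes "norm z < 1"
  shows "(\<lambda>k. of_real (model b k) * z ^ k) sums ((1 - z) powr (- of_real b))"
proof -
  have "(\<lambda>k. ((- of_real b) gchoose k) * (- z) ^ k) sums (1 + (- z)) powr (- of_real b)"
    using assms by (intro gen_binomial_complex) simp
  moreover have "((- of_real b) gchoose k) * (- z) ^ k = of_real (model b k) * z ^ k" for k
  proof -
    have "(- z) ^ k = (- 1) ^ k * z ^ k"
      by (metis mult_minus1 power_mult_distrib)
    moreover have "(- 1) ^ k * (- 1) ^ k = (1 :: complex)"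
      by (simp flip: power_mult_distrib)
    ultimately show ?thesis
      by (simp add: gbinomial_pochhammer model_def pochhammer_of_real mult_ac)
  qed
  ultimately show ?thesis by simp
qed

lemma model_asymptotics:
  assumes "b > 0"
  shows "(\<lambda>n. model b n * real n powr (1 - b)) \<longlonglongrightarrow> 1 / Gamma b"
proof -
  have "(\<lambda>n. inverse (Gamma_series b n)) \<longlonglongrightarrow> inverse (Gamma b)"
    by (intro tendsto_inverse Gamma_series_LIMSEQ less_imp_neq[OF Gamma_real_pos[OF assms], symmetric])
  moreover have "(\<lambda>n. real n / (b + real n)) \<longlonglongrightarrow> 1"
  proof -
    have "(\<lambda>n. 1 / (b / real n + 1)) \<longlonglongrightarrow> 1 / (0 + 1)"
      by (intro tendsto_intros lim_const_over_n) simp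
    moreover have "\<forall>\<^sub>F n in sequentially. 1 / (b / real n + 1) = real n / (b + real n)"
      using eventually_gt_at_top[of 0] by eventually_elim (use assms in \<open>simp add: field_simps\<close>)
    ultimately show ?thesis
      by (simp add: filterlim_cong)
  qed
  ultimately have "(\<lambda>n. inverse (Gamma_series b n) * (real n / (b + real n))) \<longlonglongrightarrow> inverse (Gamma b) * 1"
    by (rule tendsto_mult)
  moreover have "\<forall>\<^sub>F n in sequentially. inverse (Gamma_series b n) * (real n / (b + real n)) = model b n * real n powr (1 - b)"
    using eventually_gt_at_top[of 0]
  proof eventually_elim
    case (elim n)
    have "exp (b * ln (real n)) = real n powr b"
      using elim by (simp add: powr_def)
    moreover have "b + real n \<noteq> 0"
      using assms by linarith
    ultimately have "inverse (Gamma_series b n) = pochhammer b n * (b + n) / (fact n * real n powr b)"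
      using elim by (simp add: Gamma_series_def pochhammer_Suc)
    then show ?case
      using elim \<open>b + real n \<noteq> 0\<close> by (simp add: model_def powr_diff)
  qed
  ultimately show ?thesis
    by (simp add: filterlim_cong inverse_eq_divide)
qed

lemma nat_floor_over_n:
  assumes "t > 0"
  shows "(\<lambda>n. real (nat \<lfloor>real n * t\<rfloor>) / real n) \<longlonglongrightarrow> t"
    and "filterlim (\<lambda>n. nat \<lfloor>real n * t\<rfloor>) at_top sequentially"
proof -
  have "(\<lambda>n. t - 1 / real n) \<longlonglongrightarrow> t - 0"
    by (intro tendsto_intros lim_1_over_n)
  then have "(\<lambda>n. t - 1 / real n) \<longlonglongrightarrow> t" by simp
  then show lim: "(\<lambda>n. real (nat \<lfloor>real n * t\<rfloor>) / real n) \<longlonglongrightarrow> t"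
  proof (rule real_tendsto_sandwich[rotated 2])
    show "\<forall>\<^sub>F n in sequentially. t - 1 / real n \<le> real (nat \<lfloor>real n * t\<rfloor>) / real n"
      using eventually_gt_at_top[of 0]
    proof eventually_elim
      case (elim n)
      have "real n * t - 1 \<le> real (nat \<lfloor>real n * t\<rfloor>)" by linarith
      then have "(real n * t - 1) / real n \<le> real (nat \<lfloor>real n * t\<rfloor>) / real n"
        by (rule divide_right_mono) simp
      then show ?case using elim by (simp add: diff_divide_distrib)
    qed
    show "\<forall>\<^sub>F n in sequentially. real (nat \<lfloor>real n * t\<rfloor>) / real n \<le> t"
      using eventually_gt_at_top[of 0]
    proof eventually_elim
      case (elim n)
      have "0 \<le> real n * t" using assms by simp
      then have "real (nat \<lfloor>real n * t\<rfloor>) \<le> real n * t" by linarith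
      then show ?case using elim by (simp add: field_simps)
    qed
  qed simp
  have "filterlim (\<lambda>n. real (nat \<lfloor>real n * t\<rfloor>) / real n * real n) at_top sequentially"
    by (rule filterlim_tendsto_pos_mult_at_top[OF lim assms filterlim_real_sequentially])
  moreover have "\<forall>\<^sub>F n in sequentially. real (nat \<lfloor>real n * t\<rfloor>) / real n * real n = real (nat \<lfloor>real n * t\<rfloor>)"
    using eventually_gt_at_top[of 0] by eventually_elim simp
  ultimately have "filterlim (\<lambda>n. real (nat \<lfloor>real n * t\<rfloor>)) at_top sequentially"
    by (simp add: filterlim_cong)
  then show "filterlim (\<lambda>n. nat \<lfloor>real n * t\<rfloor>) at_top sequentially"
    by (simp add: filterlim_sequentially_iff_filterlim_real)
qed

lemma sum_model_asymptotics:
  assumes "0 \<le> \<alpha>"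
  shows "(\<lambda>n. (\<Sum>k<n. model \<alpha> k) / real n powr \<alpha>) \<longlonglongrightarrow> 1 / Gamma (1 + \<alpha>)"
proof (rule LIMSEQ_imp_Suc)
  have "(\<lambda>n. model (1 + \<alpha>) n * real n powr (1 - (1 + \<alpha>)) * (real n / real (Suc n)) powr \<alpha>) \<longlonglongrightarrow> 1 / Gamma (1 + \<alpha>) * 1 powr \<alpha>"
    using assms by (intro tendsto_intros model_asymptotics LIMSEQ_n_over_Suc_n) auto
  moreover have "\<forall>\<^sub>F n in sequentially. model (1 + \<alpha>) n * real n powr (1 - (1 + \<alpha>)) * (real n / real (Suc n)) powr \<alpha> =
      (\<Sum>k<Suc n. model \<alpha> k) / real (Suc n) powr \<alpha>"
    using eventually_gt_at_top[of 0]
    by eventually_elim (simp add: sum_model powr_divide powr_minus field_simps del: sum.lessThan_Suc)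
  ultimately show "(\<lambda>n. (\<Sum>k<Suc n. model \<alpha> k) / real (Suc n) powr \<alpha>) \<longlonglongrightarrow> 1 / Gamma (1 + \<alpha>)"
    by (simp add: filterlim_cong del: sum.lessThan_Suc)
qed

lemma sum_model_limit:
  assumes "0 \<le> \<alpha>" "\<alpha> \<le> 1" "t > 0"
  shows "(\<lambda>n. decreasing_seq.M (model \<alpha>) (nat \<lfloor>real n * t\<rfloor>) / real n powr \<alpha>) \<longlonglongrightarrow> t powr \<alpha> / Gamma (1 + \<alpha>)"
proof -
  interpret model: decreasing_seq "model \<alpha>"
    using decreasing_model assms by simp
  let ?k = "\<lambda>n. nat \<lfloor>real n * t\<rfloor>"
  have "(\<lambda>n. model.M (?k n) / real (?k n) powr \<alpha> * (real (?k n) / real n) powr \<alpha>) \<longlonglongrightarrow> 1 / Gamma (1 + \<alpha>) * t powr \<alpha>"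
    unfolding model.M_def
    using assms by (intro tendsto_intros filterlim_compose[OF sum_model_asymptotics nat_floor_over_n(2)] nat_floor_over_n(1)) auto
  moreover have "\<forall>\<^sub>F n in sequentially. model.M (?k n) / real (?k n) powr \<alpha> * (real (?k n) / real n) powr \<alpha> = model.M (?k n) / real n powr \<alpha>"
    using eventually_gt_at_top[of 0] eventually_compose_filterlim[OF eventually_gt_at_top[of 0] nat_floor_over_n(2)[OF assms(3)]]
    by eventually_elim (simp add: powr_divide)
  ultimately show ?thesis
    by (simp add: filterlim_cong)
qed

section \<open>An Abelian theorem on circular sectors\<close>

context decreasing_seq
begin

text \<open>Compare \<open>p\<close> with the model sequence of the same index, scaled by \<open>c n M n\<close> so that the partial sums of both are
asymptotically equal up to every fixed multiple of \<open>n\<close>. Summation by parts shows that the generating functions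
truncated at \<open>n B\<close> differ by \<open>o(M n)\<close>, and the tails beyond \<open>n B\<close> are small for large \<open>B\<close> because \<open>\<alpha> < 1\<close>.
The estimate holds for complex \<open>z\<close> in the disc with \<open>|1 - z|\<close> of order \<open>1/n\<close>, in any direction, as the
coefficient integral requires.\<close>

lemma abelian:
  fixes \<alpha> K \<epsilon> :: real
  assumes RV: "\<And>t. t > 0 \<Longrightarrow> (\<lambda>n. M (nat \<lfloor>real n * t\<rfloor>) / M n) \<longlonglongrightarrow> t powr \<alpha>"
    and \<alpha>: "0 \<le> \<alpha>" "\<alpha> < 1" and pos: "p 0 > 0"
    and K: "K > 0" and \<epsilon>: "\<epsilon> > 0"
  shows "\<forall>\<^sub>F n in sequentially. \<forall>z. norm z < 1 \<longrightarrow> 1 / (K * n) \<le> norm (1 - z) \<longrightarrow> norm (1 - z) \<le> K / n \<longrightarrow>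
     norm (gen z - of_real (Gamma (1 + \<alpha>) * real n powr (- \<alpha>) * M n) * (1 - z) powr (- of_real \<alpha>)) \<le> \<epsilon> * M n"
proof -
  interpret model: decreasing_seq "model \<alpha>"
    using decreasing_model \<alpha> by simp
  have M_pos: "M n > 0" if "n > 0" for n
    using M_mono[of 1 n] that pos by (simp add: M_def)
  have \<Gamma>: "Gamma (1 + \<alpha>) > 0"
    using \<alpha> by (intro Gamma_real_pos) simp
  define c where "c n = Gamma (1 + \<alpha>) * real n powr (- \<alpha>)" for n
  have c_nonneg: "c n \<ge> 0" for n
    using \<Gamma> by (simp add: c_def)
  have RVm: "(\<lambda>n. c n * model.M (nat \<lfloor>real n * t\<rfloor>)) \<longlonglongrightarrow> t powr \<alpha>" if "t > 0" for t
  proof -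
    have "(\<lambda>n. Gamma (1 + \<alpha>) * (model.M (nat \<lfloor>real n * t\<rfloor>) / real n powr \<alpha>)) \<longlonglongrightarrow> Gamma (1 + \<alpha>) * (t powr \<alpha> / Gamma (1 + \<alpha>))"
      by (intro tendsto_mult_left sum_model_limit \<alpha>(1) less_imp_le[OF \<alpha>(2)] that)
    then show ?thesis
      using \<Gamma> by (simp add: c_def powr_minus_divide)
  qed
  define H where "H n k = M k / M n - c n * model.M k" for n k
  have floor_nat: "nat \<lfloor>real n * real B\<rfloor> = n * B" for n B
    by (simp flip: of_nat_mult)
  have H0: "(\<lambda>n. H n (nat \<lfloor>real n * t\<rfloor>)) \<longlonglongrightarrow> 0" if "t \<ge> 0" for t
  proof (cases "t = 0")
    case True
    then show ?thesis by (simp add: H_def M_def model.M_def)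
  next
    case False
    then show ?thesis
      using tendsto_diff[OF RV[of t] RVm[of t]] that unfolding H_def by simp
  qed
  \<comment> \<open>pointwise convergence of the rescaled partial sums, averaged by dominated convergence\<close>
  have mean: "(\<lambda>n. (\<Sum>k<n * B. \<bar>H n k\<bar>) / n) \<longlonglongrightarrow> 0" if "B > 0" for B
  proof -
    have "Bseq (\<lambda>n. M (n * B) / M n + c n * model.M (n * B))"
      using tendsto_add[OF RV[of B] RVm[of B]] that unfolding floor_nat
      by (intro convergent_imp_Bseq convergentI) auto
    then obtain D where D: "\<And>n. \<bar>M (n * B) / M n + c n * model.M (n * B)\<bar> \<le> D"
      unfolding Bseq_def by auto
    have "(\<lambda>n. integral {0..real B} (\<lambda>t. \<bar>H n (nat \<lfloor>real n * t\<rfloor>)\<bar>)) \<longlonglongrightarrow> integral {0..real B} (\<lambda>t. 0)"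
    proof (rule dominated_convergence)
      fix n
      show "(\<lambda>t. \<bar>H n (nat \<lfloor>real n * t\<rfloor>)\<bar>) integrable_on {0..real B}"
      proof (cases "n = 0")
        case False
        then show ?thesis
          using has_integral_floor_step[of n "\<lambda>k. \<bar>H n k\<bar>" "n * B"] by (auto simp: has_integral_iff)
      qed (simp add: H_def integrable_const_ivl)
      fix t assume t: "t \<in> {0..real B}"
      let ?k = "nat \<lfloor>real n * t\<rfloor>"
      have "?k \<le> n * B"
        using t mult_left_mono[of t "real B" "real n"] by (simp add: nat_le_iff floor_le_iff)
      then have "M ?k / M n \<le> M (n * B) / M n" "c n * model.M ?k \<le> c n * model.M (n * B)"
        by (simp_all add: M_mono M_nonneg divide_right_mono model.M_mono mult_left_mono c_nonneg)
      moreover have "0 \<le> M ?k / M n" "0 \<le> c n * model.M ?k"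
        by (simp_all add: M_nonneg model.M_nonneg c_nonneg)
      ultimately show "norm \<bar>H n ?k\<bar> \<le> D"
        using D[of n] unfolding H_def by simp
    next
      show "(\<lambda>t. D) integrable_on {0..real B}"
        by (rule integrable_const_ivl)
      show "(\<lambda>n. \<bar>H n (nat \<lfloor>real n * t\<rfloor>)\<bar>) \<longlonglongrightarrow> 0" if "t \<in> {0..real B}" for t
        using H0[of t] that by (simp add: tendsto_rabs_zero)
    qed
    moreover have "\<forall>\<^sub>F n in sequentially. integral {0..real B} (\<lambda>t. \<bar>H n (nat \<lfloor>real n * t\<rfloor>)\<bar>) = (\<Sum>k<n * B. \<bar>H n k\<bar>) / n"
      using eventually_gt_at_top[of 0]
    proof eventually_elim
      case (elim n)
      then show ?case
        using has_integral_floor_step[of n "\<lambda>k. \<bar>H n k\<bar>" "n * B"] by (simp add: has_integral_iff)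
    qed
    ultimately show ?thesis
      by (simp add: filterlim_cong)
  qed
  have "((\<lambda>B. 4 * K * B powr (\<alpha> - 1)) \<longlongrightarrow> 4 * K * 0) at_top"
    using \<alpha> by (intro tendsto_intros tendsto_neg_powr filterlim_ident) simp
  then have "((\<lambda>B. 4 * K * real B powr (\<alpha> - 1)) \<longlongrightarrow> 4 * K * 0) sequentially"
    by (rule filterlim_compose[OF _ filterlim_real_sequentially])
  then have "\<forall>\<^sub>F B in sequentially. 4 * K * real B powr (\<alpha> - 1) < \<epsilon> \<and> B > 0"
    using \<epsilon> by (intro eventually_conj order_tendstoD(2) eventually_gt_at_top) auto
  then obtain B :: nat where B: "4 * K * real B powr (\<alpha> - 1) < \<epsilon>" "B > 0"
    by (auto dest: eventually_happens)
  \<comment> \<open>\<open>E n\<close> collects the two tails and the head after division by \<open>M n\<close>; its limit is the quantity by which \<open>B\<close> was chosen\<close>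
  define E where "E n = 2 * K / B * (M (n * B) / M n + c n * model.M (n * B))
      + \<bar>H n (n * B)\<bar> + K * ((\<Sum>k<n * B. \<bar>H n k\<bar>) / n + \<bar>H n (n * B)\<bar> / n)" for n
  have HB: "(\<lambda>n. \<bar>H n (n * B)\<bar>) \<longlonglongrightarrow> 0"
    using H0[of "real B"] by (simp add: floor_nat tendsto_rabs_zero)
  have "E \<longlonglongrightarrow> 2 * K / B * (B powr \<alpha> + B powr \<alpha>) + 0 + K * (0 + 0)"
    unfolding E_def
    using RV[of "real B"] RVm[of "real B"] B(2) HB tendsto_mult[OF HB lim_inverse_n]
    unfolding floor_nat by (intro tendsto_intros mean) (simp_all add: divide_inverse)
  moreover have "2 * K / B * (B powr \<alpha> + B powr \<alpha>) + 0 + K * (0 + 0) = 4 * K * real B powr (\<alpha> - 1)"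
    using B(2) by (simp add: powr_diff)
  ultimately have "\<forall>\<^sub>F n in sequentially. E n < \<epsilon>"
    using B(1) by (metis order_tendstoD(2))
  then show ?thesis
    using eventually_gt_at_top[of 0]
  proof eventually_elim
    case (elim n)
    show ?case
    proof (intro allI impI)
      fix z :: complex assume z: "norm z < 1" "1 / (K * n) \<le> norm (1 - z)" "norm (1 - z) \<le> K / n"
      let ?m = "n * B"
      have m: "real ?m > 0" using elim B by simp
      have z1: "0 < norm (1 - z)"
        using z(1) by auto
      have inv: "1 / norm (1 - z) \<le> K * n"
        using z(2) z1 K elim by (simp add: field_simps)
      have mgen: "model.gen z = (1 - z) powr (- of_real \<alpha>)"
        unfolding model.gen_def using model_sums[OF z(1), of \<alpha>] by (rule sums_unique[symmetric])
      have tail: "norm (decreasing_seq.gen q z - (\<Sum>k<?m. of_real (q k) * z ^ k)) \<le> 2 * K / B * decreasing_seq.M q ?m"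
        if q: "decreasing_seq q" for q
      proof -
        have "norm (decreasing_seq.gen q z - (\<Sum>k<?m. of_real (q k) * z ^ k)) \<le> 2 * q ?m * (1 / norm (1 - z))"
          using decreasing_seq.gen_tail_bound[OF q z(1), of ?m] z1 by (simp add: field_simps)
        also have "\<dots> \<le> 2 * q ?m * (K * n)"
          using decreasing_seq.nonneg[OF q] by (intro mult_left_mono inv) simp
        also have "\<dots> = 2 * K / B * (?m * q ?m)"
          using B(2) by simp
        also have "\<dots> \<le> 2 * K / B * decreasing_seq.M q ?m"
          using decreasing_seq.p_le_average[OF q, of ?m] K by (intro mult_left_mono) auto
        finally show ?thesis .
      qed
      define h where "h k = p k - c n * M n * model \<alpha> k" for k
      have Hh: "(\<Sum>j<k. h j) = M n * H n k" for k
      proof -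
        have "(\<Sum>j<k. h j) = M k - c n * M n * model.M k"
          by (simp add: h_def M_def[of k] model.M_def[of k] sum_subtractf sum_distrib_left)
        then show ?thesis
          using M_pos[OF elim(2)] by (simp add: H_def algebra_simps)
      qed
      have "norm (\<Sum>k<?m. of_real (h k) * z ^ k) \<le> \<bar>M n * H n ?m\<bar> + norm (1 - z) * (\<Sum>k<Suc ?m. \<bar>M n * H n k\<bar>)"
        using norm_sum_le_partial_sums[of z h ?m] z(1) unfolding Hh by simp
      also have "\<dots> \<le> \<bar>M n * H n ?m\<bar> + (K / n) * (\<Sum>k<Suc ?m. \<bar>M n * H n k\<bar>)"
        by (intro add_left_mono mult_right_mono z(3) sum_nonneg) simp
      also have "\<dots> = M n * (\<bar>H n ?m\<bar> + K * ((\<Sum>k<?m. \<bar>H n k\<bar>) / n + \<bar>H n ?m\<bar> / n))"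
        using M_pos[OF elim(2)] by (simp add: abs_mult sum_distrib_left sum_divide_distrib algebra_simps add_divide_distrib)
      finally have head: "norm (\<Sum>k<?m. of_real (h k) * z ^ k) \<le> M n * (\<bar>H n ?m\<bar> + K * ((\<Sum>k<?m. \<bar>H n k\<bar>) / n + \<bar>H n ?m\<bar> / n))" .
      have "gen z - of_real (c n * M n) * model.gen z
          = (gen z - (\<Sum>k<?m. of_real (p k) * z ^ k)) - of_real (c n * M n) * (model.gen z - (\<Sum>k<?m. of_real (model \<alpha> k) * z ^ k))
            + (\<Sum>k<?m. of_real (h k) * z ^ k)"
        by (simp add: h_def sum_subtractf sum_distrib_left algebra_simps)
      also have "norm \<dots> \<le> 2 * K / B * M ?m + (c n * M n) * (2 * K / B * model.M ?m)
          + M n * (\<bar>H n ?m\<bar> + K * ((\<Sum>k<?m. \<bar>H n k\<bar>) / n + \<bar>H n ?m\<bar> / n))"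
      proof (rule norm_triangle_le[OF add_mono[OF norm_triangle_le_diff[OF add_mono] head]])
        show "norm (gen z - (\<Sum>k<?m. of_real (p k) * z ^ k)) \<le> 2 * K / B * M ?m"
          by (rule tail[OF decreasing_seq_axioms])
        show "norm (of_real (c n * M n) * (model.gen z - (\<Sum>k<?m. of_real (model \<alpha> k) * z ^ k))) \<le> (c n * M n) * (2 * K / B * model.M ?m)"
          unfolding norm_mult norm_of_real using c_nonneg[of n] M_nonneg[of n]
          by (intro mult_mono tail[OF model.decreasing_seq_axioms]) simp_all
      qed
      also have "\<dots> = M n * E n"
        using M_pos[OF elim(2)] by (simp add: E_def algebra_simps)
      also have "\<dots> \<le> M n * \<epsilon>"
        using elim(1) M_nonneg[of n] by (intro mult_left_mono) auto
      finally show "norm (gen z - of_real (Gamma (1 + \<alpha>) * real n powr (- \<alpha>) * M n) * (1 - z) powr (- of_real \<alpha>)) \<le> \<epsilon> * M n"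
        by (simp add: mgen c_def mult_ac)
    qed
  qed
qed

end

section \<open>Regular variation of the partial sums\<close>

lemma stolz_cesaro:
  fixes a b :: "nat \<Rightarrow> real"
  assumes b: "\<And>n. b n > 0" and lim: "(\<lambda>n. a n / b n) \<longlonglongrightarrow> L"
    and div: "filterlim (\<lambda>n. \<Sum>k<n. b k) at_top sequentially"
  shows "(\<lambda>n. (\<Sum>k<n. a k) / (\<Sum>k<n. b k)) \<longlonglongrightarrow> L"
proof (rule tendstoI)
  fix e :: real assume "e > 0"
  then have "\<forall>\<^sub>F k in sequentially. dist (a k / b k) L < e / 2"
    using lim by (intro tendstoD) auto
  then obtain N where N: "\<And>k. k \<ge> N \<Longrightarrow> dist (a k / b k) L < e / 2"
    by (auto simp: eventually_sequentially)
  have d: "\<bar>a k - L * b k\<bar> \<le> e / 2 * b k" if "k \<ge> N" for k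
  proof -
    have "\<bar>a k - L * b k\<bar> = \<bar>a k / b k - L\<bar> * b k"
      using b[of k] by (simp add: abs_mult_pos'[symmetric] field_simps flip: abs_mult_pos)
    also have "\<dots> \<le> e / 2 * b k"
      using N[OF that] b[of k] by (intro mult_right_mono) (auto simp: dist_real_def)
    finally show ?thesis .
  qed
  define C where "C = \<bar>\<Sum>k<N. a k - L * b k\<bar>"
  have bound: "\<bar>\<Sum>k<n. a k - L * b k\<bar> \<le> C + e / 2 * (\<Sum>k<n. b k)" if "n \<ge> N" for n
    using that
  proof (induction n rule: dec_induct)
    case base
    have "0 \<le> (\<Sum>k<N. b k)"
      by (intro sum_nonneg less_imp_le b)
    then show ?case using \<open>e > 0\<close> by (simp add: C_def)
  next
    case (step n)
    have "\<bar>\<Sum>k<Suc n. a k - L * b k\<bar> \<le> \<bar>\<Sum>k<n. a k - L * b k\<bar> + \<bar>a n - L * b n\<bar>"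
      unfolding sum.lessThan_Suc by (rule abs_triangle_ineq)
    also have "\<dots> \<le> C + e / 2 * (\<Sum>k<n. b k) + e / 2 * b n"
      using step by (intro add_mono d) auto
    finally show ?case
      by (simp add: distrib_left add.assoc)
  qed
  have "\<forall>\<^sub>F n in sequentially. (\<Sum>k<n. b k) > 2 * C / e"
    using div by (simp add: filterlim_at_top_dense)
  moreover have "\<forall>\<^sub>F n in sequentially. (\<Sum>k<n. b k) > 0"
    using div by (simp add: filterlim_at_top_dense)
  ultimately show "\<forall>\<^sub>F n in sequentially. dist ((\<Sum>k<n. a k) / (\<Sum>k<n. b k)) L < e"
    using eventually_ge_at_top[of N]
  proof eventually_elim
    case (elim n)
    let ?B = "\<Sum>k<n. b k"
    have "(\<Sum>k<n. a k) / ?B - L = (\<Sum>k<n. a k - L * b k) / ?B"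
      using elim(2) by (simp add: sum_subtractf sum_distrib_left field_simps)
    then have "dist ((\<Sum>k<n. a k) / ?B) L = \<bar>\<Sum>k<n. a k - L * b k\<bar> / ?B"
      using elim(2) by (simp add: dist_real_def)
    also have "\<dots> \<le> (C + e / 2 * ?B) / ?B"
      using bound[OF elim(3)] elim(2) by (intro divide_right_mono) auto
    also have "\<dots> < e"
      using elim \<open>e > 0\<close> by (simp add: field_simps)
    finally show ?case .
  qed
qed

context decreasing_seq
begin

text \<open>Eventually \<open>p (2 * n)\<close> exceeds \<open>p n / 2\<close>, so each dyadic block contributes
at least a fixed amount to \<open>M\<close>.\<close>

lemma M_at_top_of_regular_variation:
  assumes pos: "\<And>n. p n > 0" and lim: "(\<lambda>n. p (2 * n) / p n) \<longlonglongrightarrow> 2 powr (- \<beta>)" and "\<beta> < 1"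
  shows "filterlim M at_top sequentially"
proof -
  have "(2::real) powr (- 1) < 2 powr (- \<beta>)"
    using \<open>\<beta> < 1\<close> by (intro powr_less_mono) auto
  moreover have "2 powr (- 1) = (1 / 2 :: real)"
    by (subst powr_minus) simp
  ultimately have "1 / 2 < 2 powr (- \<beta>)"
    by (simp only:)
  then have "\<forall>\<^sub>F n in sequentially. p (2 * n) / p n > 1 / 2"
    by (intro order_tendstoD(1)[OF lim])
  then obtain N where N: "\<And>n. n \<ge> N \<Longrightarrow> p n \<le> 2 * p (2 * n)"
    using pos by (auto simp: eventually_sequentially field_simps intro: less_imp_le)
  define K where "K = Suc N"
  have low: "K * p K \<le> (2 ^ j * K) * p (2 ^ j * K)" for j
  proof (induction j)
    case (Suc j)
    have "p (2 ^ j * K) \<le> 2 * p (2 * (2 ^ j * K))"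
      by (rule N) (rule le_trans[of _ "1 * K"], simp add: K_def, rule mult_le_mono1, simp)
    then have "(2 ^ j * K) * p (2 ^ j * K) \<le> (2 ^ j * K) * (2 * p (2 * (2 ^ j * K)))"
      by (rule mult_left_mono) simp
    with Suc show ?case by (simp add: mult_ac)
  qed simp
  have grow: "j * (K * p K / 2) \<le> M (2 ^ j * K)" for j
  proof (induction j)
    case 0
    then show ?case by (simp add: M_nonneg)
  next
    case (Suc j)
    let ?n = "2 ^ j * K"
    have "M (2 * ?n) = M ?n + (\<Sum>k=?n..<2 * ?n. p k)"
      unfolding M_def by (subst sum.atLeastLessThan_concat[of 0 ?n "2 * ?n", symmetric, folded lessThan_atLeast0]) (auto simp: lessThan_atLeast0)
    moreover have "(\<Sum>k=?n..<2 * ?n. p (2 * ?n)) \<le> (\<Sum>k=?n..<2 * ?n. p k)"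
      by (rule sum_mono) (simp add: p_le)
    moreover have "K * p K / 2 \<le> ?n * p (2 * ?n)"
      using low[of "Suc j"] by (simp add: mult_ac)
    ultimately show ?case using Suc by (simp add: algebra_simps)
  qed
  show ?thesis
    unfolding filterlim_at_top
  proof
    fix Z
    have "0 < K * p K / 2" using pos by (simp add: K_def)
    then obtain j where "Z < real j * (K * p K / 2)"
      using reals_Archimedean3 by blast
    then have "Z \<le> M n" if "n \<ge> 2 ^ j * K" for n
      using grow[of j] M_mono[OF that] by linarith
    then show "\<forall>\<^sub>F n in sequentially. Z \<le> M n"
      unfolding eventually_sequentially by blast
  qed
qed

text \<open>Cut \<open>M (m * n)\<close> into \<open>n\<close> blocks of length \<open>m\<close> and replace each block by \<open>m\<close> times its first or its
last term; the resulting sums are compared with \<open>M n\<close> by the Stolz-Cesaro theorem.\<close>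

lemma M_ratio_integer:
  assumes pos: "\<And>n. p n > 0" and lim: "(\<lambda>n. p (m * n) / p n) \<longlonglongrightarrow> real m powr (- \<beta>)" and m: "m > 0"
    and div: "filterlim M at_top sequentially"
  shows "(\<lambda>n. M (m * n) / M n) \<longlonglongrightarrow> real m powr (1 - \<beta>)"
proof -
  define S where "S n = (\<Sum>k<n. p (m * k))" for n
  have S: "(\<lambda>n. S n / M n) \<longlonglongrightarrow> real m powr (- \<beta>)"
    using stolz_cesaro[OF pos lim] div unfolding S_def M_def[abs_def] by simp
  have blocks: "M (m * n) = (\<Sum>k<n. \<Sum>i=k * m..<k * m + m. p i)" for n
    unfolding M_def by (simp add: sum.nat_group mult.commute)
  have upper: "M (m * n) \<le> m * S n" for n
  proof -
    have "M (m * n) \<le> (\<Sum>k<n. \<Sum>i=k * m..<k * m + m. p (m * k))"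
      unfolding blocks by (intro sum_mono p_le) (simp add: mult.commute)
    then show ?thesis by (simp add: S_def sum_distrib_left)
  qed
  have lower: "m * S n - m * p 0 \<le> M (m * n)" for n
  proof -
    have "(\<Sum>k<n. \<Sum>i=k * m..<k * m + m. p (m * Suc k)) \<le> M (m * n)"
      unfolding blocks by (intro sum_mono p_le) (simp add: mult.commute)
    then have "m * (\<Sum>k<n. p (m * Suc k)) \<le> M (m * n)"
      by (simp add: sum_distrib_left)
    moreover have "(\<Sum>k<n. p (m * Suc k)) = S (Suc n) - p 0"
      unfolding S_def by (subst sum.lessThan_Suc_shift) simp
    moreover have "S n \<le> S (Suc n)"
      using pos[of "m * n"] by (simp add: S_def)
    ultimately show ?thesis
      using mult_left_mono[of "S n" "S (Suc n)" "real m"] by (simp add: right_diff_distrib)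
  qed
  have inv: "(\<lambda>n. m * p 0 / M n) \<longlonglongrightarrow> 0"
    by (rule tendsto_divide_0[OF tendsto_const filterlim_at_top_imp_at_infinity[OF div]])
  have eq: "m * real m powr (- \<beta>) = real m powr (1 - \<beta>)"
    using m by (simp add: powr_diff powr_minus_divide)
  show ?thesis
  proof (rule real_tendsto_sandwich)
    show "(\<lambda>n. m * (S n / M n) - m * p 0 / M n) \<longlonglongrightarrow> real m powr (1 - \<beta>)"
      using tendsto_diff[OF tendsto_mult_left[OF S, of "real m"] inv] by (simp add: eq)
    show "(\<lambda>n. m * (S n / M n)) \<longlonglongrightarrow> real m powr (1 - \<beta>)"
      using tendsto_mult_left[OF S, of "real m"] by (simp add: eq)
    show "\<forall>\<^sub>F n in sequentially. m * (S n / M n) - m * p 0 / M n \<le> M (m * n) / M n"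
      using divide_right_mono[OF lower M_nonneg] by (auto simp: diff_divide_distrib)
    show "\<forall>\<^sub>F n in sequentially. M (m * n) / M n \<le> m * (S n / M n)"
      using divide_right_mono[OF upper M_nonneg] by auto
  qed
qed

text \<open>For rational \<open>t = a / b\<close> write \<open>n\<close> as a multiple of \<open>b\<close> up to a bounded error. Monotonicity of \<open>M\<close> allows
to squeeze general \<open>t\<close> between such quotients.\<close>

lemma M_ratio_real:
  assumes lim: "\<And>m. m > 0 \<Longrightarrow> (\<lambda>n. M (m * n) / M n) \<longlonglongrightarrow> real m powr \<alpha>" and p0: "p 0 > 0"
    and div: "filterlim M at_top sequentially" and t: "t > 0"
  shows "(\<lambda>n. M (nat \<lfloor>real n * t\<rfloor>) / M n) \<longlonglongrightarrow> t powr \<alpha>"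
proof -
  have M_pos: "M n > 0" if "n > 0" for n
    using M_mono[of 1 n] that p0 by (simp add: M_def)
  have Suc: "(\<lambda>n. M (Suc n) / M n) \<longlonglongrightarrow> 1"
  proof (rule real_tendsto_sandwich)
    show "\<forall>\<^sub>F n in sequentially. 1 \<le> M (Suc n) / M n"
      using eventually_gt_at_top[of 0] by eventually_elim (simp add: M_pos M_Suc nonneg)
    show "\<forall>\<^sub>F n in sequentially. M (Suc n) / M n \<le> 1 + p 0 / M n"
      using eventually_gt_at_top[of 0]
    proof eventually_elim
      case (elim n)
      then show ?case using M_pos[of n] p_le[of 0 n] by (simp add: M_Suc field_simps)
    qed
    have "(\<lambda>n. 1 + p 0 / M n) \<longlonglongrightarrow> 1 + 0"
      by (intro tendsto_intros tendsto_divide_0[OF tendsto_const filterlim_at_top_imp_at_infinity[OF div]])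
    then show "(\<lambda>n. 1 + p 0 / M n) \<longlonglongrightarrow> 1" by simp
  qed simp
  have div_at_top: "filterlim (\<lambda>n. n div b) at_top sequentially" if "b > 0" for b :: nat
    unfolding filterlim_at_top
  proof
    fix Z show "\<forall>\<^sub>F n in sequentially. Z \<le> n div b"
      using eventually_ge_at_top[of "Z * b"]
      by eventually_elim (use that in \<open>simp add: less_eq_div_iff_mult_less_eq\<close>)
  qed
  have pow: "(\<lambda>b. (real (nat \<lfloor>real b * t\<rfloor>) / real b) powr \<alpha>) \<longlonglongrightarrow> t powr \<alpha>"
    using t by (intro tendsto_intros nat_floor_over_n) auto
  have pow': "(\<lambda>b. (real (Suc (nat \<lfloor>real b * t\<rfloor>)) / real b) powr \<alpha>) \<longlonglongrightarrow> t powr \<alpha>"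
  proof -
    have "(\<lambda>b. (real (nat \<lfloor>real b * t\<rfloor>) / real b + 1 / real b) powr \<alpha>) \<longlonglongrightarrow> (t + 0) powr \<alpha>"
      using t by (intro tendsto_intros nat_floor_over_n lim_1_over_n) auto
    then show ?thesis by (simp add: add_divide_distrib add.commute)
  qed
  have nt: "real n * t \<ge> 0" for n using t by simp
  show ?thesis
  proof (rule order_tendstoI)
    fix u assume "u < t powr \<alpha>"
    then have "\<forall>\<^sub>F b in sequentially. u < (real (nat \<lfloor>real b * t\<rfloor>) / real b) powr \<alpha> \<and> b > 0 \<and> nat \<lfloor>real b * t\<rfloor> > 0"
      by (intro eventually_conj order_tendstoD(1)[OF pow] eventually_gt_at_top
          eventually_compose_filterlim[OF eventually_gt_at_top nat_floor_over_n(2)[OF t]])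
    then obtain b where b: "u < (real (nat \<lfloor>real b * t\<rfloor>) / real b) powr \<alpha>" "b > 0" "nat \<lfloor>real b * t\<rfloor> > 0"
      by (auto dest: eventually_happens)
    define a where "a = nat \<lfloor>real b * t\<rfloor>"
    have a: "a > 0" "real a \<le> real b * t"
      using b nt[of b] unfolding a_def by linarith+
    have "(\<lambda>m. (M (a * m) / M m) / ((M (b * Suc m) / M (Suc m)) * (M (Suc m) / M m))) \<longlonglongrightarrow> real a powr \<alpha> / (real b powr \<alpha> * 1)"
      using b a by (intro tendsto_intros lim Suc LIMSEQ_Suc[OF lim]) auto
    then have "\<forall>\<^sub>F m in sequentially. u < (M (a * m) / M m) / ((M (b * Suc m) / M (Suc m)) * (M (Suc m) / M m))"
      using b a by (intro order_tendstoD(1)) (auto simp: powr_divide a_def)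
    from eventually_compose_filterlim[OF eventually_conj[OF this eventually_gt_at_top[of 0]] div_at_top[OF b(2)]]
    show "\<forall>\<^sub>F n in sequentially. u < M (nat \<lfloor>real n * t\<rfloor>) / M n"
      using eventually_gt_at_top[of 0]
    proof eventually_elim
      case (elim n)
      let ?m = "n div b"
      have "real (a * ?m) \<le> (real b * t) * real ?m"
        using a by (simp add: mult_right_mono)
      also have "\<dots> \<le> real n * t"
      proof -
        have "real (b * ?m) \<le> real n"
          unfolding of_nat_le_iff by simp
        from mult_right_mono[OF this, of t] t show ?thesis
          by (simp add: mult_ac)
      qed
      finally have "a * ?m \<le> nat \<lfloor>real n * t\<rfloor>"
        using nt[of n] by linarith
      then have 1: "M (a * ?m) \<le> M (nat \<lfloor>real n * t\<rfloor>)" by (rule M_mono)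
      have "n \<le> b * Suc ?m"
        using b(2) by (metis dividend_less_times_div less_imp_le mult_Suc_right add.commute)
      then have 2: "M n \<le> M (b * Suc ?m)" by (rule M_mono)
      have "(M (a * ?m) / M ?m) / ((M (b * Suc ?m) / M (Suc ?m)) * (M (Suc ?m) / M ?m)) = M (a * ?m) / M (b * Suc ?m)"
        using M_pos[of ?m] M_pos[of "Suc ?m"] elim by simp
      also have "\<dots> \<le> M (nat \<lfloor>real n * t\<rfloor>) / M n"
        using elim M_pos[of n] by (intro frac_le 1 2 M_nonneg) auto
      finally show ?case using elim by simp
    qed
  next
    fix u assume "t powr \<alpha> < u"
    then have "\<forall>\<^sub>F b in sequentially. (real (Suc (nat \<lfloor>real b * t\<rfloor>)) / real b) powr \<alpha> < u \<and> b > 0"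
      by (intro eventually_conj order_tendstoD(2)[OF pow'] eventually_gt_at_top)
    then obtain b where b: "(real (Suc (nat \<lfloor>real b * t\<rfloor>)) / real b) powr \<alpha> < u" "b > 0"
      by (auto dest: eventually_happens)
    define a where "a = Suc (nat \<lfloor>real b * t\<rfloor>)"
    have a: "a > 0" "real b * t \<le> real a"
      using nt[of b] unfolding a_def by linarith+
    have "(\<lambda>m. (M (a * Suc m) / M (Suc m)) * (M (Suc m) / M m) / (M (b * m) / M m)) \<longlonglongrightarrow> real a powr \<alpha> * 1 / real b powr \<alpha>"
      using b a by (intro tendsto_intros lim Suc LIMSEQ_Suc[OF lim]) auto
    then have "\<forall>\<^sub>F m in sequentially. (M (a * Suc m) / M (Suc m)) * (M (Suc m) / M m) / (M (b * m) / M m) < u"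
      using b a by (intro order_tendstoD(2)) (auto simp: powr_divide a_def)
    from eventually_compose_filterlim[OF eventually_conj[OF this eventually_gt_at_top[of 0]] div_at_top[OF b(2)]]
    show "\<forall>\<^sub>F n in sequentially. M (nat \<lfloor>real n * t\<rfloor>) / M n < u"
      using eventually_gt_at_top[of 0]
    proof eventually_elim
      case (elim n)
      let ?m = "n div b"
      have "n \<le> b * Suc ?m"
        using b(2) by (metis dividend_less_times_div less_imp_le mult_Suc_right add.commute)
      then have "real n * t \<le> real (b * Suc ?m) * t"
        using t by (intro mult_right_mono) (auto simp del: of_nat_mult)
      also have "\<dots> \<le> real a * real (Suc ?m)"
        using mult_right_mono[OF a(2), of "real (Suc ?m)"] by (simp add: algebra_simps)
      finally have "real n * t \<le> real (a * Suc ?m)" by (simp only: of_nat_mult)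
      then have "nat \<lfloor>real n * t\<rfloor> \<le> a * Suc ?m"
        by linarith
      then have 1: "M (nat \<lfloor>real n * t\<rfloor>) \<le> M (a * Suc ?m)" by (rule M_mono)
      have 2: "M (b * ?m) \<le> M n"
        by (rule M_mono) simp
      have "M (nat \<lfloor>real n * t\<rfloor>) / M n \<le> M (a * Suc ?m) / M (b * ?m)"
        using elim M_pos[of "b * ?m"] b(2) by (intro frac_le 1 2 M_nonneg) auto
      also have "\<dots> = (M (a * Suc ?m) / M (Suc ?m)) * (M (Suc ?m) / M ?m) / (M (b * ?m) / M ?m)"
        using M_pos[of ?m] M_pos[of "Suc ?m"] elim by simp
      finally show ?case using elim by simp
    qed
  qed
qed

text \<open>Since \<open>p\<close> decreases, \<open>p n\<close> lies between the difference quotients of \<open>M\<close> to the right and to the left of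
\<open>n\<close>. Rescaled, these tend to difference quotients of \<open>x \<mapsto> x\<^sup>\<alpha>\<close> at \<open>1\<close>, whose derivative there is \<open>\<alpha>\<close>.\<close>

lemma monotone_density:
  assumes RV: "\<And>t. t > 0 \<Longrightarrow> (\<lambda>n. M (nat \<lfloor>real n * t\<rfloor>) / M n) \<longlonglongrightarrow> t powr \<alpha>" and p0: "p 0 > 0"
  shows "(\<lambda>n. real n * p n / M n) \<longlonglongrightarrow> \<alpha>"
proof -
  have M_pos: "M n > 0" if "n > 0" for n
    using M_mono[of 1 n] that p0 by (simp add: M_def)
  have "((\<lambda>x::real. x powr \<alpha>) has_field_derivative \<alpha>) (at 1)"
    by (auto intro!: derivative_eq_intros)
  then have der: "((\<lambda>x::real. (x powr \<alpha> - 1) / (x - 1)) \<longlongrightarrow> \<alpha>) (at 1)"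
    by (simp add: has_field_derivative_iff)
  have quot: "(\<lambda>n. (M (nat \<lfloor>real n * x\<rfloor>) / M n - 1) / (real (nat \<lfloor>real n * x\<rfloor>) / real n - 1)) \<longlonglongrightarrow> (x powr \<alpha> - 1) / (x - 1)"
    if "x > 0" "x \<noteq> 1" for x
    using that by (intro tendsto_intros RV nat_floor_over_n) auto
  show ?thesis
  proof (rule order_tendstoI)
    fix u assume "u < \<alpha>"
    then have "\<forall>\<^sub>F x in at_right 1. u < (x powr \<alpha> - 1) / (x - 1) \<and> x \<in> {1<..<2}"
      by (intro eventually_conj order_tendstoD(1)[OF filterlim_mono[OF der order_refl]] at_le eventually_at_right_real) auto
    then obtain x where x: "u < (x powr \<alpha> - 1) / (x - 1)" "1 < x"
      by (auto dest: eventually_happens)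
    have "\<forall>\<^sub>F n in sequentially. u < (M (nat \<lfloor>real n * x\<rfloor>) / M n - 1) / (real (nat \<lfloor>real n * x\<rfloor>) / real n - 1)"
      using x by (intro order_tendstoD(1)[OF quot]) auto
    moreover have "\<forall>\<^sub>F n in sequentially. 1 < real (nat \<lfloor>real n * x\<rfloor>) / real n"
      using x by (intro order_tendstoD(1)[OF nat_floor_over_n(1)]) auto
    ultimately show "\<forall>\<^sub>F n in sequentially. u < real n * p n / M n"
      using eventually_gt_at_top[of 0]
    proof eventually_elim
      case (elim n)
      let ?k = "nat \<lfloor>real n * x\<rfloor>"
      have k: "n < ?k" using elim by (simp add: field_simps del: of_nat_less_iff) 
      have "M ?k - M n = (\<Sum>j=n..<?k. p j)"
        unfolding M_def using k by (simp add: sum_diff_nat_ivl lessThan_atLeast0 sum_diff_nat_ivl[of 0 n ?k p])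
      also have "\<dots> \<le> (\<Sum>j=n..<?k. p n)"
        by (rule sum_mono) (simp add: p_le)
      finally have "M ?k - M n \<le> (real ?k - real n) * p n"
        using k by (simp add: of_nat_diff)
      then have "(M ?k - M n) / M n \<le> ((real ?k - real n) * p n) / M n"
        by (rule divide_right_mono) (rule M_nonneg)
      also have "\<dots> = (real n * p n / M n) * ((real ?k - real n) / real n)"
        using elim(3) by simp
      finally have "((M ?k - M n) / M n) / ((real ?k - real n) / real n) \<le> real n * p n / M n"
        using k elim(3) by (subst pos_divide_le_eq) auto
      moreover have "(M ?k - M n) / M n = M ?k / M n - 1" "(real ?k - real n) / real n = real ?k / real n - 1"
        using M_pos[of n] elim(3) by (simp_all add: diff_divide_distrib)
      ultimately have "(M ?k / M n - 1) / (real ?k / real n - 1) \<le> real n * p n / M n"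
        by simp
      with elim show ?case by simp
    qed
  next
    fix u assume "\<alpha> < u"
    then have "\<forall>\<^sub>F x in at_left 1. (x powr \<alpha> - 1) / (x - 1) < u \<and> x \<in> {0<..<1}"
      by (intro eventually_conj order_tendstoD(2)[OF filterlim_mono[OF der order_refl]] at_le eventually_at_left_real) auto
    then obtain x where x: "(x powr \<alpha> - 1) / (x - 1) < u" "0 < x" "x < 1"
      by (auto dest: eventually_happens)
    have "\<forall>\<^sub>F n in sequentially. (M (nat \<lfloor>real n * x\<rfloor>) / M n - 1) / (real (nat \<lfloor>real n * x\<rfloor>) / real n - 1) < u"
      using x by (intro order_tendstoD(2)[OF quot]) auto
    moreover have "\<forall>\<^sub>F n in sequentially. real (nat \<lfloor>real n * x\<rfloor>) / real n < 1"
      using x by (intro order_tendstoD(2)[OF nat_floor_over_n(1)]) auto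
    ultimately show "\<forall>\<^sub>F n in sequentially. real n * p n / M n < u"
      using eventually_gt_at_top[of 0]
    proof eventually_elim
      case (elim n)
      let ?k = "nat \<lfloor>real n * x\<rfloor>"
      have k: "?k < n" using elim by (simp add: field_simps del: of_nat_less_iff)
      have "M n - M ?k = (\<Sum>j=?k..<n. p j)"
        unfolding M_def using k by (simp add: lessThan_atLeast0 sum_diff_nat_ivl[of 0 ?k n p])
      moreover have "(\<Sum>j=?k..<n. p n) \<le> (\<Sum>j=?k..<n. p j)"
        by (rule sum_mono) (simp add: p_le)
      ultimately have "(real n - real ?k) * p n \<le> M n - M ?k"
        using k by (simp add: of_nat_diff)
      then have "((real n - real ?k) * p n) / M n \<le> (M n - M ?k) / M n"
        by (rule divide_right_mono) (rule M_nonneg)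
      moreover have "((real n - real ?k) * p n) / M n = (real n * p n / M n) * ((real n - real ?k) / real n)"
        using elim(3) by simp
      ultimately have "real n * p n / M n \<le> ((M n - M ?k) / M n) / ((real n - real ?k) / real n)"
        using k elim(3) by (subst pos_le_divide_eq) auto
      moreover have "(M n - M ?k) / M n = - (M ?k / M n - 1)" "(real n - real ?k) / real n = - (real ?k / real n - 1)"
        using M_pos[of n] elim(3) by (simp_all add: diff_divide_distrib)
      ultimately have "real n * p n / M n \<le> (M ?k / M n - 1) / (real ?k / real n - 1)"
        by (simp only: minus_divide_divide)
      with elim show ?case by simp
    qed
  qed
qed

text \<open>Iterate \<open>M (2 * n) \<le> 2\<^sup>\<gamma> M n\<close>, which holds for large \<open>n\<close>; the remaining small indices only affect the constant.\<close>

lemma potter_bound: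
  assumes lim: "(\<lambda>n. M (2 * n) / M n) \<longlonglongrightarrow> 2 powr \<alpha>" and p0: "p 0 = 1" and \<gamma>: "\<alpha> < \<gamma>" "0 \<le> \<gamma>"
  obtains C where "C > 0" "\<And>j n. 1 \<le> j \<Longrightarrow> j \<le> n \<Longrightarrow> M n \<le> C * (real n / real j) powr \<gamma> * M j"
proof -
  have M_pos: "M n \<ge> 1" if "n > 0" for n
    using M_mono[of 1 n] that p0 by (simp add: M_def)
  have "\<forall>\<^sub>F n in sequentially. M (2 * n) / M n < 2 powr \<gamma>"
    using \<gamma> by (intro order_tendstoD(2)[OF lim]) simp
  then have "\<forall>\<^sub>F n in sequentially. M (2 * n) \<le> 2 powr \<gamma> * M n"
    using eventually_gt_at_top[of 0]
  proof eventually_elim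
    case (elim n)
    then show ?case using M_pos[of n] by (simp add: field_simps)
  qed
  then obtain N0 where N0: "\<And>n. n \<ge> N0 \<Longrightarrow> M (2 * n) \<le> 2 powr \<gamma> * M n"
    by (auto simp: eventually_sequentially)
  define N where "N = Suc N0"
  have large: "M n \<le> 2 powr \<gamma> * (real n / real j) powr \<gamma> * M j" if "N \<le> j" "j \<le> n" for j n
    using that
  proof (induction "n - j" arbitrary: j rule: less_induct)
    case less
    have j: "j > 0" "M (2 * j) \<le> 2 powr \<gamma> * M j"
      using less.prems N0[of j] by (auto simp: N_def)
    show ?case
    proof (cases "n < 2 * j")
      case True
      have "1 powr \<gamma> \<le> (real n / real j) powr \<gamma>"
        using less.prems j \<gamma> by (intro powr_mono2) auto
      have "M n \<le> M (2 * j)"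
        using True by (intro M_mono) simp
      also have "\<dots> \<le> 2 powr \<gamma> * 1 * M j"
        using j by simp
      also have "\<dots> \<le> 2 powr \<gamma> * (real n / real j) powr \<gamma> * M j"
        using \<open>1 powr \<gamma> \<le> _\<close> by (intro mult_right_mono mult_left_mono M_nonneg) simp_all
      finally show ?thesis .
    next
      case False
      have "M n \<le> 2 powr \<gamma> * (real n / real (2 * j)) powr \<gamma> * M (2 * j)"
        using False less.prems j by (intro less.hyps) auto
      also have "\<dots> \<le> 2 powr \<gamma> * (real n / real (2 * j)) powr \<gamma> * (2 powr \<gamma> * M j)"
        by (intro mult_left_mono j) simp
      also have "(real n / real (2 * j)) powr \<gamma> = (real n / real j) powr \<gamma> / 2 powr \<gamma>"
        by (subst powr_divide[symmetric]) (auto simp: mult.commute)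
      finally show ?thesis by (simp add: mult_ac)
    qed
  qed
  show ?thesis
  proof (rule that[of "2 powr \<gamma> * N"])
    show "2 powr \<gamma> * N > 0" by (simp add: N_def)
    fix j n :: nat assume j: "1 \<le> j" "j \<le> n"
    have ge1: "1 \<le> (real n / real j) powr \<gamma>"
      using powr_mono2[of \<gamma> 1 "real n / real j"] j \<gamma> by simp
    have g1: "1 \<le> 2 powr \<gamma>" using \<gamma> by (simp add: ge_one_powr_ge_zero)
    have MN: "M k \<le> real N" if "k \<le> N" for k
    proof -
      have "M k \<le> M N" by (rule M_mono[OF that])
      also have "\<dots> \<le> (\<Sum>k<N. 1)"
        unfolding M_def using p_le[of 0] p0 by (intro sum_mono) simp
      finally show ?thesis by simp
    qed
    consider "N \<le> j" | "n \<le> N" | "j < N" "N < n" by linarith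
    then show "M n \<le> 2 powr \<gamma> * N * (real n / real j) powr \<gamma> * M j"
    proof cases
      case 1
      have "M n \<le> 2 powr \<gamma> * 1 * (real n / real j) powr \<gamma> * M j"
        using large[OF 1 j(2)] by simp
      also have "\<dots> \<le> 2 powr \<gamma> * N * (real n / real j) powr \<gamma> * M j"
        by (intro mult_right_mono mult_left_mono M_nonneg) (simp_all add: N_def)
      finally show ?thesis .
    next
      case 2
      have "M n \<le> 1 * real N * 1 * 1"
        using MN[OF 2] by simp
      also have "\<dots> \<le> 2 powr \<gamma> * N * (real n / real j) powr \<gamma> * M j"
        using M_pos[of j] j by (intro mult_mono g1 ge1) simp_all
      finally show ?thesis .
    next
      case 3
      have "M n \<le> 2 powr \<gamma> * (real n / real N) powr \<gamma> * M N"
        using 3 by (intro large) auto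
      also have "\<dots> \<le> 2 powr \<gamma> * (real n / real j) powr \<gamma> * N"
        using 3 j \<gamma> by (intro mult_mono powr_mono2 mult_left_mono MN divide_left_mono M_nonneg) simp_all
      also have "\<dots> \<le> 2 powr \<gamma> * (real n / real j) powr \<gamma> * (N * M j)"
        using M_pos[of j] j mult_left_mono[of 1 "M j" "real N"] by (intro mult_left_mono) simp_all
      finally show ?thesis by (simp add: mult_ac)
    qed
  qed
qed

end

section \<open>Operator renewal sequences\<close>

fun renewal_sequence :: "(nat \<Rightarrow> 'b::banach \<Rightarrow>\<^sub>L 'b) \<Rightarrow> nat \<Rightarrow> 'b \<Rightarrow>\<^sub>L 'b" where
  "renewal_sequence Rn n = (if n = 0 then id_blinfun else
     (\<Sum>j\<in>{1..n}. renewal_sequence Rn (n - j) o\<^sub>L Rn j))"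

declare renewal_sequence.simps [simp del]

lemma operator_power_series_continuous:
  fixes A :: "nat \<Rightarrow> ('b::banach \<times> 'b) \<Rightarrow>\<^sub>L ('b \<times> 'b)"
  assumes sum: "summable (\<lambda>n. norm (A n))"
  shows "continuous_on (cball 0 1) (\<lambda>z. \<Sum>n. cscale (z ^ Suc n) o\<^sub>L A n)"
proof -
  have "uniform_limit (cball 0 1) (\<lambda>n z. \<Sum>i<n. cscale (z ^ Suc i) o\<^sub>L A i) (\<lambda>z. \<Sum>i. cscale (z ^ Suc i) o\<^sub>L A i) sequentially"
  proof (rule Weierstrass_m_test)
    fix n and z :: complex assume z: "z \<in> cball 0 1"
    have "norm (cscale (z ^ Suc n) o\<^sub>L A n) \<le> 2 * norm (z ^ Suc n) * norm (A n)"
      by (rule norm_cscale_compose)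
    also have "\<dots> \<le> 2 * 1 * norm (A n)"
      using z by (intro mult_right_mono mult_left_mono) (auto simp: norm_power power_le_one simp del: power_Suc)
    finally show "norm (cscale (z ^ Suc n) o\<^sub>L A n) \<le> 2 * norm (A n)" by simp
  next
    show "summable (\<lambda>n. 2 * norm (A n))"
      by (rule summable_mult[OF sum])
  qed
  then show ?thesis
    by (rule uniform_limit_theorem[rotated]) (auto intro!: always_eventually continuous_intros)
qed

lemma operator_power_series_summable:
  fixes A :: "nat \<Rightarrow> ('b::banach \<times> 'b) \<Rightarrow>\<^sub>L ('b \<times> 'b)"
  assumes sum: "summable (\<lambda>n. norm (A n))" and z: "norm z \<le> 1"
  shows "summable (\<lambda>n. norm (cscale (z ^ Suc n) o\<^sub>L A n))"
proof (rule summable_comparison_test'[where N = 0])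
  show "summable (\<lambda>n. 2 * norm (A n))"
    by (rule summable_mult[OF sum])
  fix n
  have "norm (cscale (z ^ Suc n) o\<^sub>L A n) \<le> 2 * norm (z ^ Suc n) * norm (A n)"
    by (rule norm_cscale_compose)
  also have "\<dots> \<le> 2 * 1 * norm (A n)"
    using z by (intro mult_right_mono mult_left_mono) (auto simp: norm_power power_le_one simp del: power_Suc)
  finally show "norm (norm (cscale (z ^ Suc n) o\<^sub>L A n)) \<le> 2 * norm (A n)" by simp
qed

text \<open>Termwise differentiation: the derived series converges uniformly on smaller discs.\<close>

lemma operator_power_series_holomorphic:
  fixes A :: "nat \<Rightarrow> ('b::banach \<times> 'b) \<Rightarrow>\<^sub>L ('b \<times> 'b)"
  assumes sum: "summable (\<lambda>n. norm (A n))"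
  shows "blinfun_holomorphic_on (\<lambda>z. \<Sum>n. cscale (z ^ Suc n) o\<^sub>L A n) (ball 0 1)"
proof -
  let ?f = "\<lambda>n z. cscale (z ^ Suc n) o\<^sub>L A n"
  define d where "d n z = cscale (of_nat (Suc n) * z ^ n) o\<^sub>L A n" for n z
  define D where "D z = (\<Sum>n. d n z)" for z
  have unif: "uniform_limit (ball 0 r) (\<lambda>n z. \<Sum>i<n. d i z) D sequentially" if r: "0 < r" "r < 1" for r
    unfolding D_def
  proof (rule Weierstrass_m_test)
    fix n and z :: complex assume z: "z \<in> ball 0 r"
    have "norm (d n z) \<le> 2 * norm (of_nat (Suc n) * z ^ n) * norm (A n)"
      unfolding d_def by (rule norm_cscale_compose)
    also have "norm (of_nat (Suc n) * z ^ n) \<le> real (Suc n) * r ^ n"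
      unfolding norm_mult norm_of_nat norm_power using z by (intro mult_left_mono power_mono) auto
    finally show "norm (d n z) \<le> 2 * (real (Suc n) * r ^ n) * norm (A n)"
      by (simp add: mult_right_mono)
  next
    have "(\<lambda>n. real n * r ^ n) \<longlonglongrightarrow> 0"
      using powser_times_n_limit_0[of r] r by simp
    then have "Bseq (\<lambda>n. real n * r ^ n)"
      by (intro convergent_imp_Bseq convergentI)
    then obtain C where C: "\<And>n. real n * r ^ n \<le> C"
      unfolding Bseq_def by (auto simp: abs_le_iff)
    show "summable (\<lambda>n. 2 * (real (Suc n) * r ^ n) * norm (A n))"
    proof (rule summable_comparison_test'[where N = 0])
      show "summable (\<lambda>n. 2 * (C + 1) * norm (A n))"
        by (rule summable_mult[OF sum])
      fix n
      have "real (Suc n) * r ^ n \<le> C + 1"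
        using C[of n] r power_le_one[of r n] by (simp add: algebra_simps)
      then show "norm (2 * (real (Suc n) * r ^ n) * norm (A n)) \<le> 2 * (C + 1) * norm (A n)"
        using r by (simp add: mult_right_mono abs_mult)
    qed
  qed
  have deriv: "((\<lambda>z. \<Sum>n. ?f n z) has_derivative (\<lambda>h. cscale h o\<^sub>L D z)) (at z)" if z: "z \<in> ball 0 1" for z
  proof -
    define r where "r = (norm z + 1) / 2"
    have r: "0 < r" "r < 1" "z \<in> ball 0 r"
      using z unfolding r_def by (auto simp: add_nonneg_pos)
    have "\<exists>g. \<forall>x\<in>ball 0 r. (\<lambda>n. ?f n x) sums (g x) \<and> (g has_derivative (\<lambda>h. cscale h o\<^sub>L D x)) (at x within ball 0 r)"
    proof (rule has_derivative_series)
      fix n and x :: complex assume "x \<in> ball 0 r"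
      have "((\<lambda>z. cscale (z ^ Suc n)) has_derivative (\<lambda>h. cscale (of_nat (Suc n) * x ^ n * h))) (at x within ball 0 r)"
        using bounded_linear.has_derivative[OF bounded_linear_cscale
            has_derivative_power[OF has_derivative_ident, of "Suc n" x "ball 0 r"]]
        by (simp add: mult_ac)
      then show "((\<lambda>z. cscale (z ^ Suc n) o\<^sub>L A n) has_derivative (\<lambda>h. cscale (of_nat (Suc n) * x ^ n * h) o\<^sub>L A n)) (at x within ball 0 r)"
        by (rule bounded_linear.has_derivative[OF blinfun_compose.bounded_linear_left])
    next
      fix \<epsilon> :: real assume "\<epsilon> > 0"
      have "\<forall>\<^sub>F n in sequentially. \<forall>x\<in>ball 0 r. dist (\<Sum>i<n. d i x) (D x) < \<epsilon> / 2"
        using unif[OF r(1,2)] \<open>\<epsilon> > 0\<close> by (intro uniform_limitD) auto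
      then show "\<forall>\<^sub>F n in sequentially. \<forall>x\<in>ball 0 r. \<forall>h. norm ((\<Sum>i<n. cscale (of_nat (Suc i) * x ^ i * h) o\<^sub>L A i) - (cscale h o\<^sub>L D x)) \<le> \<epsilon> * norm h"
      proof eventually_elim
        case (elim n)
        show ?case
        proof (intro ballI allI)
          fix x h assume x: "x \<in> ball (0::complex) r"
          have "(\<Sum>i<n. cscale (of_nat (Suc i) * x ^ i * h) o\<^sub>L A i) = cscale h o\<^sub>L (\<Sum>i<n. d i x)"
            unfolding d_def blinfun_compose.sum_right
            by (intro sum.cong refl) (simp add: blinfun_compose_assoc[symmetric] cscale_mult[symmetric] mult_ac del: of_nat_Suc)
          then have "(\<Sum>i<n. cscale (of_nat (Suc i) * x ^ i * h) o\<^sub>L A i) - (cscale h o\<^sub>L D x) = cscale h o\<^sub>L ((\<Sum>i<n. d i x) - D x)"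
            by (simp add: blinfun_compose_simps)
          also have "norm \<dots> \<le> 2 * norm h * norm ((\<Sum>i<n. d i x) - D x)"
            by (rule norm_cscale_compose)
          also have "\<dots> \<le> 2 * norm h * (\<epsilon> / 2)"
            using elim x by (intro mult_left_mono) (auto simp: dist_norm intro: less_imp_le)
          finally show "norm ((\<Sum>i<n. cscale (of_nat (Suc i) * x ^ i * h) o\<^sub>L A i) - (cscale h o\<^sub>L D x)) \<le> \<epsilon> * norm h"
            by (simp add: mult.commute)
        qed
      qed
    next
      show "(0::complex) \<in> ball 0 r" using r by simp
      show "(\<lambda>n. cscale (0 ^ Suc n) o\<^sub>L A n) sums 0" by simp
    qed simp
    then obtain g where g: "\<And>x. x \<in> ball 0 r \<Longrightarrow> (\<lambda>n. ?f n x) sums (g x)"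
        "\<And>x. x \<in> ball 0 r \<Longrightarrow> (g has_derivative (\<lambda>h. cscale h o\<^sub>L D x)) (at x within ball 0 r)"
      by blast
    have "(g has_derivative (\<lambda>h. cscale h o\<^sub>L D z)) (at z)"
      using g(2)[OF r(3)] at_within_open[OF r(3) open_ball] by simp
    then show ?thesis
    proof (rule has_derivative_transform_within_open[OF _ open_ball r(3)])
      show "g x = (\<Sum>n. ?f n x)" if "x \<in> ball 0 r" for x
        using g(1)[OF that] by (rule sums_unique)
    qed
  qed
  have "continuous_on (ball 0 1) D"
    unfolding continuous_on_eq_continuous_at[OF open_ball]
  proof
    fix z :: complex assume z: "z \<in> ball 0 1"
    define r where "r = (norm z + 1) / 2"
    have r: "0 < r" "r < 1" "z \<in> ball 0 r"
      using z unfolding r_def by (auto simp: add_nonneg_pos)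
    have "continuous_on (ball 0 r) D"
      by (rule uniform_limit_theorem[OF _ unif[OF r(1,2)]])
        (auto intro!: always_eventually continuous_intros simp: d_def)
    then show "isCont D z"
      using r(3) by (simp add: continuous_on_eq_continuous_at)
  qed
  with deriv show ?thesis
    by (intro blinfun_holomorphic_onI) auto
qed

lemma renewal_sequence_0: "renewal_sequence Rn 0 = id_blinfun"
  by (subst renewal_sequence.simps) simp

lemma sum_triangle_swap:
  fixes g :: "nat \<Rightarrow> nat \<Rightarrow> 'v::comm_monoid_add"
  shows "(\<Sum>k\<in>{1..n}. \<Sum>j\<in>{1..k}. g (k - j) j) = (\<Sum>j\<in>{1..n}. \<Sum>i\<le>n - j. g i j)"
  unfolding sum.Sigma[OF finite_atLeastAtMost ballI[OF finite_atLeastAtMost]]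
    sum.Sigma[OF finite_atLeastAtMost ballI[OF finite_atMost]]
  by (rule sum.reindex_bij_witness[where i = "\<lambda>(j, i). (i + j, j)" and j = "\<lambda>(k, j). (j, k - j)"]) auto

text \<open>The operators \<open>T\<^sub>k\<close> are the Taylor coefficients of \<open>(1 - R(z))\<^sup>-\<^sup>1\<close> at \<open>0\<close>. By strong induction on the order:
in \<open>T z = 1 + T z R(z)\<close> the factor \<open>R(z)\<close> has no constant term, so an expansion of \<open>T z\<close> of lower order
suffices on the right.\<close>

lemma renewal_expansion:
  fixes Rn :: "nat \<Rightarrow> 'b::banach \<Rightarrow>\<^sub>L 'b"
  assumes sum: "summable (\<lambda>n. norm (Rn (Suc n)))"
    and T: "\<And>z. norm z \<le> 1/2 \<Longrightarrow> inverse_blinfun (id_blinfun - R_z Rn z) (T z)"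
    and bounded: "\<And>z. norm z \<le> 1/2 \<Longrightarrow> norm (T z) \<le> B"
  shows "\<exists>K. \<forall>z. norm z \<le> 1/2 \<longrightarrow>
    norm (T z - (\<Sum>k\<le>n. cscale (z ^ k) o\<^sub>L complexify (renewal_sequence Rn k))) \<le> K * norm z ^ Suc n"
proof (induction n rule: less_induct)
  case (less n)
  let ?T = "\<lambda>k. complexify (renewal_sequence Rn k)"
  let ?R = "\<lambda>k. complexify (Rn k)"
  have "\<forall>m\<in>{..<n}. \<exists>K. \<forall>z. norm z \<le> 1/2 \<longrightarrow> norm (T z - (\<Sum>k\<le>m. cscale (z ^ k) o\<^sub>L ?T k)) \<le> K * norm z ^ Suc m"
    using less by blast
  from bchoice[OF this] obtain K where K: "\<And>m z. m < n \<Longrightarrow> norm z \<le> 1/2 \<Longrightarrow> norm (T z - (\<Sum>k\<le>m. cscale (z ^ k) o\<^sub>L ?T k)) \<le> K m * norm z ^ Suc m"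
    by (auto simp del: power_Suc)
  have sumc: "summable (\<lambda>n. norm (?R (Suc n)))"
    by (rule summable_comparison_test'[OF sum, where N = 0]) (simp add: norm_complexify)
  define V where "V = (\<Sum>k. norm (?R (Suc (k + n))))"
  define E where "E z = R_z Rn z - (\<Sum>j\<in>{1..n}. cscale (z ^ j) o\<^sub>L ?R j)" for z
  have E: "norm (E z) \<le> 2 * V * norm z ^ Suc n" if z: "norm z \<le> 1/2" for z
  proof -
    let ?a = "\<lambda>k. cscale (z ^ Suc k) o\<^sub>L ?R (Suc k)"
    have z1: "norm z \<le> 1" using z by simp
    have s: "summable ?a"
      by (rule summable_norm_cancel[OF operator_power_series_summable[OF sumc z1]])
    have s': "summable (\<lambda>k. norm (?R (Suc (k + n))))"
      using summable_ignore_initial_segment[OF sumc, of n] by simp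
    have "(\<Sum>j\<in>{1..n}. cscale (z ^ j) o\<^sub>L ?R j) = (\<Sum>k<n. ?a k)"
      by (rule sum.reindex_bij_witness[where i = Suc and j = "\<lambda>j. j - 1"]) auto
    then have "E z = (\<Sum>k. ?a (k + n))"
      unfolding E_def R_z_def using suminf_minus_initial_segment[OF s, of n] by simp
    also have "norm \<dots> \<le> (\<Sum>k. 2 * norm z ^ Suc n * norm (?R (Suc (k + n))))"
    proof (rule norm_suminf_le)
      show "summable (\<lambda>k. 2 * norm z ^ Suc n * norm (?R (Suc (k + n))))"
        by (rule summable_mult[OF s'])
      fix k
      have "norm (?a (k + n)) \<le> 2 * norm (z ^ Suc (k + n)) * norm (?R (Suc (k + n)))"
        by (rule norm_cscale_compose)
      also have "norm (z ^ Suc (k + n)) \<le> norm z ^ Suc n"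
        unfolding norm_power using z1 by (intro power_decreasing) auto
      finally show "norm (?a (k + n)) \<le> 2 * norm z ^ Suc n * norm (?R (Suc (k + n)))"
        by (simp add: mult_right_mono)
    qed
    also have "\<dots> = 2 * norm z ^ Suc n * V"
      unfolding V_def by (rule suminf_mult[OF s'])
    finally show ?thesis by (simp add: mult_ac)
  qed
  define K' where "K' = (\<Sum>j\<in>{1..n}. 2 * \<bar>K (n - j)\<bar> * norm (?R j)) + B * (2 * V)"
  show ?case
  proof (intro exI[of _ K'] allI impI)
    fix z :: complex assume z: "norm z \<le> 1/2"
    have lin: "?T i o\<^sub>L cscale c = cscale c o\<^sub>L ?T i" for i c
      using complex_linear_complexify[of "renewal_sequence Rn i"] by (simp add: complex_linear_def)
    have "T z o\<^sub>L (id_blinfun - R_z Rn z) = id_blinfun"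
      using T[OF z] by (simp add: inverse_blinfun_def)
    then have "T z = id_blinfun + (T z o\<^sub>L R_z Rn z)"
      by (simp add: blinfun_compose_simps algebra_simps)
    also have "R_z Rn z = (\<Sum>j\<in>{1..n}. cscale (z ^ j) o\<^sub>L ?R j) + E z"
      by (simp add: E_def)
    finally have 1: "T z = id_blinfun + (\<Sum>j\<in>{1..n}. T z o\<^sub>L (cscale (z ^ j) o\<^sub>L ?R j)) + (T z o\<^sub>L E z)"
      by (simp add: blinfun_compose_simps blinfun_compose.sum_right add.assoc)
    have "(\<Sum>k\<le>n. cscale (z ^ k) o\<^sub>L ?T k) = id_blinfun + (\<Sum>k\<in>{1..n}. cscale (z ^ k) o\<^sub>L ?T k)"
    proof -
      have "{..n} = insert 0 {1..n}" by auto
      then show ?thesis by (simp add: renewal_sequence_0)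
    qed
    also have "(\<Sum>k\<in>{1..n}. cscale (z ^ k) o\<^sub>L ?T k) = (\<Sum>k\<in>{1..n}. \<Sum>j\<in>{1..k}. (cscale (z ^ (k - j)) o\<^sub>L ?T (k - j)) o\<^sub>L (cscale (z ^ j) o\<^sub>L ?R j))"
    proof (rule sum.cong)
      fix k assume k: "k \<in> {1..n}"
      have "?T k = (\<Sum>j\<in>{1..k}. ?T (k - j) o\<^sub>L ?R j)"
        using k by (subst renewal_sequence.simps)
          (simp add: linear_sum[OF bounded_linear.linear[OF bounded_linear_complexify]] complexify_compose)
      then have "cscale (z ^ k) o\<^sub>L ?T k = (\<Sum>j\<in>{1..k}. cscale (z ^ k) o\<^sub>L (?T (k - j) o\<^sub>L ?R j))"
        by (simp add: blinfun_compose.sum_right)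
      also have "\<dots> = (\<Sum>j\<in>{1..k}. (cscale (z ^ (k - j)) o\<^sub>L ?T (k - j)) o\<^sub>L (cscale (z ^ j) o\<^sub>L ?R j))"
      proof (rule sum.cong)
        fix j assume "j \<in> {1..k}"
        then have zk: "z ^ k = z ^ (k - j) * z ^ j"
          by (simp flip: power_add)
        have "(cscale (z ^ (k - j)) o\<^sub>L ?T (k - j)) o\<^sub>L (cscale (z ^ j) o\<^sub>L ?R j)
            = cscale (z ^ (k - j)) o\<^sub>L ((?T (k - j) o\<^sub>L cscale (z ^ j)) o\<^sub>L ?R j)"
          by (simp add: blinfun_compose_assoc)
        also have "\<dots> = cscale (z ^ k) o\<^sub>L (?T (k - j) o\<^sub>L ?R j)"
          unfolding lin zk cscale_mult by (simp add: blinfun_compose_assoc)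
        finally show "cscale (z ^ k) o\<^sub>L (?T (k - j) o\<^sub>L ?R j) = (cscale (z ^ (k - j)) o\<^sub>L ?T (k - j)) o\<^sub>L (cscale (z ^ j) o\<^sub>L ?R j)"
          by simp
      qed simp
      finally show "cscale (z ^ k) o\<^sub>L ?T k = (\<Sum>j\<in>{1..k}. (cscale (z ^ (k - j)) o\<^sub>L ?T (k - j)) o\<^sub>L (cscale (z ^ j) o\<^sub>L ?R j))" .
    qed simp
    also have "\<dots> = (\<Sum>j\<in>{1..n}. \<Sum>i\<le>n - j. (cscale (z ^ i) o\<^sub>L ?T i) o\<^sub>L (cscale (z ^ j) o\<^sub>L ?R j))"
      by (rule sum_triangle_swap)
    also have "\<dots> = (\<Sum>j\<in>{1..n}. (\<Sum>i\<le>n - j. cscale (z ^ i) o\<^sub>L ?T i) o\<^sub>L (cscale (z ^ j) o\<^sub>L ?R j))"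
      by (simp add: blinfun_compose.sum_left)
    finally have 2: "(\<Sum>k\<le>n. cscale (z ^ k) o\<^sub>L ?T k) = id_blinfun + (\<Sum>j\<in>{1..n}. (\<Sum>i\<le>n - j. cscale (z ^ i) o\<^sub>L ?T i) o\<^sub>L (cscale (z ^ j) o\<^sub>L ?R j))" .
    have "T z - (\<Sum>k\<le>n. cscale (z ^ k) o\<^sub>L ?T k) =
       (\<Sum>j\<in>{1..n}. (T z - (\<Sum>i\<le>n - j. cscale (z ^ i) o\<^sub>L ?T i)) o\<^sub>L (cscale (z ^ j) o\<^sub>L ?R j)) + (T z o\<^sub>L E z)"
      unfolding 2 by (subst 1) (simp add: blinfun_compose.diff_left sum_subtractf)
    also have "norm \<dots> \<le> (\<Sum>j\<in>{1..n}. 2 * \<bar>K (n - j)\<bar> * norm (?R j) * norm z ^ Suc n) + B * (2 * V * norm z ^ Suc n)"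
    proof (rule norm_triangle_le[OF add_mono])
      show "norm (\<Sum>j\<in>{1..n}. (T z - (\<Sum>i\<le>n - j. cscale (z ^ i) o\<^sub>L ?T i)) o\<^sub>L (cscale (z ^ j) o\<^sub>L ?R j))
        \<le> (\<Sum>j\<in>{1..n}. 2 * \<bar>K (n - j)\<bar> * norm (?R j) * norm z ^ Suc n)"
      proof (rule order_trans[OF norm_sum sum_mono])
        fix j assume j: "j \<in> {1..n}"
        have "norm ((T z - (\<Sum>i\<le>n - j. cscale (z ^ i) o\<^sub>L ?T i)) o\<^sub>L (cscale (z ^ j) o\<^sub>L ?R j))
            \<le> norm (T z - (\<Sum>i\<le>n - j. cscale (z ^ i) o\<^sub>L ?T i)) * norm (cscale (z ^ j) o\<^sub>L ?R j)"
          by (rule norm_blinfun_compose)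
        also have "\<dots> \<le> (\<bar>K (n - j)\<bar> * norm z ^ Suc (n - j)) * (2 * norm (z ^ j) * norm (?R j))"
        proof (intro mult_mono norm_cscale_compose)
          have "norm (T z - (\<Sum>i\<le>n - j. cscale (z ^ i) o\<^sub>L ?T i)) \<le> K (n - j) * norm z ^ Suc (n - j)"
            using j z by (intro K) auto
          also have "\<dots> \<le> \<bar>K (n - j)\<bar> * norm z ^ Suc (n - j)"
            by (intro mult_right_mono) auto
          finally show "norm (T z - (\<Sum>i\<le>n - j. cscale (z ^ i) o\<^sub>L ?T i)) \<le> \<bar>K (n - j)\<bar> * norm z ^ Suc (n - j)" .
        qed auto
        also have "\<dots> = 2 * \<bar>K (n - j)\<bar> * norm (?R j) * (norm z ^ Suc (n - j) * norm z ^ j)"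
          by (simp add: norm_power mult_ac)
        also have "norm z ^ Suc (n - j) * norm z ^ j = norm z ^ Suc n"
          using j by (simp flip: power_add)
        finally show "norm ((T z - (\<Sum>i\<le>n - j. cscale (z ^ i) o\<^sub>L ?T i)) o\<^sub>L (cscale (z ^ j) o\<^sub>L ?R j))
           \<le> 2 * \<bar>K (n - j)\<bar> * norm (?R j) * norm z ^ Suc n" .
      qed
      have "norm (T z o\<^sub>L E z) \<le> norm (T z) * norm (E z)"
        by (rule norm_blinfun_compose)
      also have "\<dots> \<le> B * (2 * V * norm z ^ Suc n)"
        using bounded[OF z] by (intro mult_mono bounded E z) (auto intro: order_trans[OF norm_ge_zero])
      finally show "norm (T z o\<^sub>L E z) \<le> B * (2 * V * norm z ^ Suc n)" .
    qed
    also have "\<dots> = K' * norm z ^ Suc n"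
      by (simp only: K'_def distrib_right sum_distrib_right mult.assoc)
    finally show "norm (T z - (\<Sum>k\<le>n. cscale (z ^ k) o\<^sub>L ?T k)) \<le> K' * norm z ^ Suc n" .
  qed
qed

section \<open>The resolvent near the singular point 1\<close>

text \<open>The analytic setting, detached from dynamics: \<open>p\<close> are the tails of the return time, with regularly
varying partial sums of index \<open>\<alpha> < 1/2\<close>, and \<open>S\<close> is the reduced resolvent of \<open>R(1)\<close>.\<close>

locale renewal_operators = decreasing_seq p
  for p :: "nat \<Rightarrow> real" +
  fixes Rn :: "nat \<Rightarrow> 'b::banach \<Rightarrow>\<^sub>L 'b" and P :: "'b \<Rightarrow>\<^sub>L 'b" and C \<alpha> :: real
    and S :: "('b \<times> 'b) \<Rightarrow>\<^sub>L ('b \<times> 'b)"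
  assumes p0: "p 0 = 1"
    and RV: "\<And>t. t > 0 \<Longrightarrow> (\<lambda>n. M (nat \<lfloor>real n * t\<rfloor>) / M n) \<longlonglongrightarrow> t powr \<alpha>"
    and \<alpha>: "0 \<le> \<alpha>" "\<alpha> < 1 / 2"
    and C: "C > 0" "\<And>n. norm (Rn (Suc n)) \<le> C * (p n - p (Suc n))"
    and P: "P o\<^sub>L P = P" "\<And>n. P o\<^sub>L (Rn (Suc n) o\<^sub>L P) = (p n - p (Suc n)) *\<^sub>R P"
    and PR: "complexify P o\<^sub>L R_z Rn 1 = complexify P" "R_z Rn 1 o\<^sub>L complexify P = complexify P"
    and S: "S o\<^sub>L (id_blinfun - R_z Rn 1) = id_blinfun - complexify P"
      "(id_blinfun - R_z Rn 1) o\<^sub>L S = id_blinfun - complexify P"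
    and inv: "\<And>z. norm z \<le> 1 \<Longrightarrow> z \<noteq> 1 \<Longrightarrow> 1 \<notin> cspectrum (R_z Rn z)"
begin

abbreviation "Pc \<equiv> complexify P"

definition T where "T z = resolvent (R_z Rn z) 1"

definition \<delta> where "\<delta> z = (1 - z) * gen z"

text \<open>An exponent strictly between \<open>\<alpha>\<close> and \<open>1/2\<close>: above \<open>\<alpha>\<close> to have Potter's bound, below \<open>1/2\<close> to make the square of
\<open>x\<^sup>\<gamma>\<^sup>-\<^sup>1\<close> integrable at infinity.\<close>

definition \<gamma> where "\<gamma> = (\<alpha> + 1 / 2) / 2"

lemma \<gamma>: "\<alpha> < \<gamma>" "\<gamma> < 1 / 2" "0 < \<gamma>"
  using \<alpha> by (auto simp: \<gamma>_def)

lemma summable_Rn: "summable (\<lambda>n. norm (Rn (Suc n)))"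
  by (rule summable_comparison_test'[OF summable_mult[OF summable_drops, of C], where N = 0]) (simp add: C)

lemma summable_Rn_complex: "summable (\<lambda>n. norm (complexify (Rn (Suc n))))"
  by (rule summable_comparison_test'[OF summable_Rn, where N = 0]) (simp add: norm_complexify)

lemma T_inverse: "norm z \<le> 1 \<Longrightarrow> z \<noteq> 1 \<Longrightarrow> inverse_blinfun (id_blinfun - R_z Rn z) (T z)"
  using inverse_resolvent[OF inv, of z] by (simp add: T_def)

lemma R_z_terms_summable:
  "norm z \<le> 1 \<Longrightarrow> summable (\<lambda>n. norm (cscale (z ^ Suc n) o\<^sub>L complexify (Rn (Suc n))))"
  by (rule operator_power_series_summable[OF summable_Rn_complex])

lemma R_z_complex_linear: "norm z \<le> 1 \<Longrightarrow> complex_linear (R_z Rn z)"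
  unfolding R_z_def
  by (rule complex_linear_suminf[OF complex_linear_compose[OF complex_linear_cscale complex_linear_complexify]
        summable_norm_cancel[OF R_z_terms_summable]])

lemma T_complex_linear: "norm z \<le> 1 \<Longrightarrow> z \<noteq> 1 \<Longrightarrow> complex_linear (T z)"
  by (rule complex_linear_inverse[OF T_inverse complex_linear_diff[OF complex_linear_id R_z_complex_linear]])

lemma T_holomorphic: "blinfun_holomorphic_on T (ball 0 1)"
proof (rule blinfun_holomorphic_on_inverse)
  show "blinfun_holomorphic_on (\<lambda>z. id_blinfun - R_z Rn z) (ball 0 1)"
    unfolding R_z_def
    by (intro blinfun_holomorphic_on_diff blinfun_holomorphic_on_const operator_power_series_holomorphic summable_Rn_complex)
qed (auto intro!: T_inverse T_complex_linear)

lemma T_continuous: "continuous_on (cball 0 1 - {1}) T"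
  unfolding continuous_on_def
proof
  fix z :: complex assume z: "z \<in> cball 0 1 - {1}"
  have "continuous_on (cball 0 1) (R_z Rn)"
    unfolding R_z_def by (rule operator_power_series_continuous[OF summable_Rn_complex])
  then have "continuous_on (cball 0 1 - {1}) (\<lambda>z. id_blinfun - R_z Rn z)"
    by (intro continuous_intros) (auto intro: continuous_on_subset)
  then have "((\<lambda>z. id_blinfun - R_z Rn z) \<longlongrightarrow> id_blinfun - R_z Rn z) (at z within cball 0 1 - {1})"
    using z by (simp add: continuous_on_def)
  then show "(T \<longlongrightarrow> T z) (at z within cball 0 1 - {1})"
  proof (rule tendsto_inverse_blinfun[rotated 2])
    show "\<forall>\<^sub>F x in at z within cball 0 1 - {1}. inverse_blinfun (id_blinfun - R_z Rn x) (T x)"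
      by (auto simp: eventually_at_filter intro!: always_eventually T_inverse)
    show "inverse_blinfun (id_blinfun - R_z Rn z) (T z)"
      using z by (intro T_inverse) auto
  qed
qed

text \<open>Since the norm of \<open>R\<^sub>k\<close> is controlled by the drops of \<open>p\<close>, the operator function \<open>R\<close> inherits their modulus of continuity.\<close>

lemma R_z_diff_bound:
  assumes "norm z \<le> 1" "norm w \<le> 1" "K \<ge> 2" "N > 0" "norm (z - w) \<le> K / real N"
  shows "norm (R_z Rn z - R_z Rn w) \<le> 2 * C * (K * M N / N)"
proof -
  let ?a = "\<lambda>z k. cscale (z ^ Suc k) o\<^sub>L complexify (Rn (Suc k))"
  note drops = drops_power_diff[OF assms]
  have s: "summable (\<lambda>k. 2 * C * ((p k - p (Suc k)) * norm (z ^ Suc k - w ^ Suc k)))"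
    by (rule summable_mult[OF drops(1)])
  have "R_z Rn z - R_z Rn w = (\<Sum>k. ?a z k - ?a w k)"
    unfolding R_z_def
    using assms by (intro suminf_diff summable_norm_cancel[OF R_z_terms_summable]) auto
  also have "norm \<dots> \<le> (\<Sum>k. 2 * C * ((p k - p (Suc k)) * norm (z ^ Suc k - w ^ Suc k)))"
  proof (rule norm_suminf_le[OF _ s])
    fix k
    have "?a z k - ?a w k = cscale (z ^ Suc k - w ^ Suc k) o\<^sub>L complexify (Rn (Suc k))"
      by (simp add: cscale_diff blinfun_compose_simps)
    also have "norm \<dots> \<le> 2 * norm (z ^ Suc k - w ^ Suc k) * norm (complexify (Rn (Suc k)))"
      by (rule norm_cscale_compose)
    also have "\<dots> \<le> 2 * norm (z ^ Suc k - w ^ Suc k) * (C * (p k - p (Suc k)))"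
      by (intro mult_left_mono order_trans[OF norm_complexify C(2)]) auto
    finally show "norm (?a z k - ?a w k) \<le> 2 * C * ((p k - p (Suc k)) * norm (z ^ Suc k - w ^ Suc k))"
      by (simp add: mult_ac)
  qed
  also have "\<dots> = 2 * C * (\<Sum>k. (p k - p (Suc k)) * norm (z ^ Suc k - w ^ Suc k))"
    by (rule suminf_mult[OF drops(1)])
  also have "\<dots> \<le> 2 * C * (K * M N / N)"
    using C(1) by (intro mult_left_mono drops(2)) simp
  finally show ?thesis .
qed

text \<open>On the range of \<open>P\<close> the operator \<open>R(z)\<close> acts as the generating function \<open>\<Sum>\<^sub>k (p k - p (k + 1)) z\<^sup>k\<^sup>+\<^sup>1\<close> of the return time,
which equals \<open>1 - (1 - z) \<Sum>\<^sub>k p k z\<^sup>k\<close>.\<close>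

lemma P_R_z_P:
  assumes "norm z < 1"
  shows "Pc o\<^sub>L (R_z Rn z o\<^sub>L Pc) = cscale (1 - \<delta> z) o\<^sub>L Pc"
proof -
  have z1: "norm z \<le> 1" using assms by simp
  have lin: "Pc o\<^sub>L cscale c = cscale c o\<^sub>L Pc" for c
    using complex_linear_complexify[of P] by (simp add: complex_linear_def)
  have "(\<lambda>k. cscale (z ^ Suc k) o\<^sub>L complexify (Rn (Suc k))) sums R_z Rn z"
    unfolding R_z_def by (intro summable_sums summable_norm_cancel[OF R_z_terms_summable[OF z1]])
  from bounded_linear.sums[OF blinfun_compose.bounded_linear_right[of Pc]
      bounded_linear.sums[OF blinfun_compose.bounded_linear_left[of Pc] this]]
  have 1: "(\<lambda>k. Pc o\<^sub>L ((cscale (z ^ Suc k) o\<^sub>L complexify (Rn (Suc k))) o\<^sub>L Pc)) sums (Pc o\<^sub>L (R_z Rn z o\<^sub>L Pc))" .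
  have "Pc o\<^sub>L ((cscale (z ^ Suc k) o\<^sub>L complexify (Rn (Suc k))) o\<^sub>L Pc)
      = cscale (of_real (p k - p (Suc k)) * z ^ Suc k) o\<^sub>L Pc" for k
  proof -
    have "Pc o\<^sub>L ((cscale (z ^ Suc k) o\<^sub>L complexify (Rn (Suc k))) o\<^sub>L Pc)
       = (Pc o\<^sub>L cscale (z ^ Suc k)) o\<^sub>L complexify (Rn (Suc k) o\<^sub>L P)"
      by (simp add: blinfun_compose_assoc complexify_compose)
    also have "\<dots> = cscale (z ^ Suc k) o\<^sub>L complexify (P o\<^sub>L (Rn (Suc k) o\<^sub>L P))"
      unfolding lin by (simp add: blinfun_compose_assoc complexify_compose)
    also have "\<dots> = cscale (of_real (p k - p (Suc k)) * z ^ Suc k) o\<^sub>L Pc"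
      unfolding P complexify_scaleR cscale_scaleR[unfolded scaleR_conv_of_real] by (simp add: blinfun_compose_simps)
    finally show ?thesis .
  qed
  with 1 have 2: "(\<lambda>k. cscale (of_real (p k - p (Suc k)) * z ^ Suc k) o\<^sub>L Pc) sums (Pc o\<^sub>L (R_z Rn z o\<^sub>L Pc))"
    by simp
  have "(\<Sum>k. of_real (p k - p (Suc k)) * z ^ Suc k) = 1 - \<delta> z"
    unfolding \<delta>_def one_minus_times_gen[OF assms] by (simp add: p0)
  then have "(\<lambda>k. of_real (p k - p (Suc k)) * z ^ Suc k) sums (1 - \<delta> z)"
    using summable_sums[OF summable_norm_cancel[OF summable_drops_power[OF z1]]] by simp
  from bounded_linear.sums[OF blinfun_compose.bounded_linear_left[of Pc] bounded_linear.sums[OF bounded_linear_cscale this]]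
  show ?thesis by (rule sums_unique2[OF 2])
qed

lemma M_1: "M (Suc 0) = 1"
  by (simp add: M_def p0)

lemma M_ge_1: "n > 0 \<Longrightarrow> M n \<ge> 1"
  using M_mono[of "Suc 0" n] by (simp add: M_1)

lemma potter_bound_\<gamma>:
  "\<exists>K>0. \<forall>j n. 1 \<le> j \<longrightarrow> j \<le> n \<longrightarrow> M n \<le> K * (real n / real j) powr \<gamma> * M j"
proof -
  have "nat \<lfloor>real n * 2\<rfloor> = 2 * n" for n
    by linarith
  then have "(\<lambda>n. M (2 * n) / M n) \<longlonglongrightarrow> 2 powr \<alpha>"
    using RV[of 2] by simp
  from potter_bound[OF this p0 \<gamma>(1) less_imp_le[OF \<gamma>(3)]] show ?thesis by metis
qed

lemma M_over_n_tendsto_0: "(\<lambda>n. M n / n) \<longlonglongrightarrow> 0"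
proof -
  obtain K where K: "K > 0" "\<And>j n. 1 \<le> j \<Longrightarrow> j \<le> n \<Longrightarrow> M n \<le> K * (real n / real j) powr \<gamma> * M j"
    using potter_bound_\<gamma> by blast
  have "(\<lambda>n. K * real n powr (\<gamma> - 1)) \<longlonglongrightarrow> K * 0"
    using \<gamma> by (intro tendsto_mult_left tendsto_neg_powr filterlim_real_sequentially) simp
  then have lim: "(\<lambda>n. K * real n powr (\<gamma> - 1)) \<longlonglongrightarrow> 0" by simp
  show ?thesis
  proof (rule Lim_null_comparison[OF _ lim])
    show "\<forall>\<^sub>F n in sequentially. norm (M n / n) \<le> K * real n powr (\<gamma> - 1)"
      using eventually_gt_at_top[of 0]
    proof eventually_elim
      case (elim n)
      have "M n \<le> K * real n powr \<gamma>"
        using K(2)[of 1 n] elim by (simp add: M_1)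
      then have "M n / n \<le> K * real n powr \<gamma> / n"
        by (rule divide_right_mono) simp
      then show ?case using elim M_nonneg[of n] by (simp add: powr_diff)
    qed
  qed
qed

text \<open>The scale that belongs to \<open>z\<close>: an integer comparable to \<open>1 / |1 - z|\<close>.\<close>

definition N where "N z = nat \<lfloor>1 / norm (1 - z :: complex)\<rfloor>"

lemma N_bounds:
  assumes "z \<noteq> 1" "norm (1 - z) \<le> 1"
  shows "N z > 0" "norm (1 - z) \<le> 1 / N z" "1 / N z \<le> 2 * norm (1 - z)"
proof -
  define \<rho> where "\<rho> = norm (1 - z)"
  have \<rho>: "0 < \<rho>" "\<rho> \<le> 1" using assms by (auto simp: \<rho>_def)
  have "1 \<le> 1 / \<rho>" using \<rho> by simp
  then have N: "real (N z) \<le> 1 / \<rho>" "1 / \<rho> < real (N z) + 1" "1 \<le> N z"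
    unfolding N_def \<rho>_def[symmetric] by linarith+
  then show "N z > 0" by simp
  show "norm (1 - z) \<le> 1 / N z"
    using N \<rho> unfolding \<rho>_def[symmetric] by (simp add: field_simps)
  have "1 / \<rho> \<le> 2 * real (N z)" using N by linarith
  then show "1 / N z \<le> 2 * norm (1 - z)"
    using N \<rho> unfolding \<rho>_def[symmetric] by (simp add: field_simps)
qed

lemma N_at_top: "filterlim N at_top (at 1 within ball 0 1)"
  unfolding filterlim_at_top
proof
  fix Z :: nat
  have "dist z 1 < 1 / (real Z + 1) \<Longrightarrow> z \<noteq> 1 \<Longrightarrow> Z \<le> N z" for z
  proof -
    assume z: "dist z 1 < 1 / (real Z + 1)" "z \<noteq> 1"
    have "norm (1 - z) > 0" using z by simp
    have "norm (1 - z) * (real Z + 1) < 1"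
      using z(1) by (simp add: dist_norm norm_minus_commute field_simps)
    moreover have "norm (1 - z) * real Z \<le> norm (1 - z) * (real Z + 1)"
      by (intro mult_left_mono) auto
    ultimately have "real Z * norm (1 - z) \<le> 1"
      by (simp only: mult.commute[of "real Z"])
    then have "real Z \<le> 1 / norm (1 - z)"
      using \<open>norm (1 - z) > 0\<close> by (simp only: pos_le_divide_eq)
    then show "Z \<le> N z"
      unfolding N_def by linarith
  qed
  then show "\<forall>\<^sub>F z in at 1 within ball 0 1. Z \<le> N z"
    unfolding eventually_at by (intro exI[of _ "1 / (real Z + 1)"]) auto
qed

lemma eventually_in_disc: "\<forall>\<^sub>F z in at 1 within ball 0 1. norm (z::complex) < 1 \<and> z \<noteq> 1 \<and> norm (1 - z) \<le> 1"
  unfolding eventually_at by (intro exI[of _ 1]) (auto simp: dist_norm norm_minus_commute)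

text \<open>Apply the Abelian theorem at the scale \<open>N z\<close>: the main term has size at least \<open>\<Gamma>(1 + \<alpha>) M (N z)\<close>, the error at most half of that.\<close>

lemma gen_lower_bound:
  "\<forall>\<^sub>F z in at 1 within ball 0 1. Gamma (1 + \<alpha>) / 2 * M (N z) \<le> norm (gen z)"
proof -
  have \<Gamma>: "Gamma (1 + \<alpha>) > 0"
    using \<alpha> by (intro Gamma_real_pos) simp
  have "\<forall>\<^sub>F n in sequentially. \<forall>z. norm z < 1 \<longrightarrow> 1 / (2 * real n) \<le> norm (1 - z) \<longrightarrow> norm (1 - z) \<le> 2 / n \<longrightarrow>
     norm (gen z - of_real (Gamma (1 + \<alpha>) * real n powr (- \<alpha>) * M n) * (1 - z) powr (- of_real \<alpha>)) \<le> Gamma (1 + \<alpha>) / 2 * M n"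
    using \<alpha> \<Gamma> by (intro abelian RV) (auto simp: p0)
  from eventually_compose_filterlim[OF this N_at_top]
  show ?thesis
    using eventually_in_disc
  proof eventually_elim
    case (elim z)
    note a = elim(1)
    have z: "norm z < 1" "z \<noteq> 1" "norm (1 - z) \<le> 1"
      using elim(2) by auto
    note N = N_bounds[OF z(2,3)]
    have \<rho>: "0 < norm (1 - z)" using z by simp
    let ?main = "of_real (Gamma (1 + \<alpha>) * real (N z) powr (- \<alpha>) * M (N z)) * (1 - z) powr (- of_real \<alpha>)"
    have "norm (1 - z) \<le> 2 / N z"
      using N(2) by (rule order_trans) (simp add: divide_right_mono)
    moreover have "1 / (2 * real (N z)) \<le> norm (1 - z)"
      using N(3) by (simp add: field_simps)
    ultimately have "norm (gen z - ?main) \<le> Gamma (1 + \<alpha>) / 2 * M (N z)"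
      using a z by blast
    moreover have "Gamma (1 + \<alpha>) * M (N z) \<le> norm ?main"
    proof -
      have "real (N z) * norm (1 - z) \<le> 1"
        using N by (simp add: field_simps)
      then have "1 \<le> (real (N z) * norm (1 - z)) powr (- \<alpha>)"
        using powr_mono2'[of "- \<alpha>" "real (N z) * norm (1 - z)" 1] \<alpha> N(1) \<rho> by simp
      then have "Gamma (1 + \<alpha>) * M (N z) * 1 \<le> Gamma (1 + \<alpha>) * M (N z) * (real (N z) * norm (1 - z)) powr (- \<alpha>)"
        using \<Gamma> M_nonneg[of "N z"] by (intro mult_left_mono) auto
      also have "\<dots> = norm ?main"
        using \<Gamma> M_nonneg[of "N z"] \<rho> by (simp add: norm_mult norm_powr_real_powr' powr_mult abs_mult)
      finally show ?thesis by simp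
    qed
    moreover have "norm ?main \<le> norm (gen z) + norm (gen z - ?main)"
      using norm_triangle_ineq2[of ?main "gen z"] by (simp add: norm_minus_commute)
    ultimately show ?case
      by simp
  qed
qed

text \<open>It remains to compare \<open>R(1) - R(z)\<close>, which is of order \<open>M (N z) / N z\<close>, with \<open>\<delta> z\<close>, which is of at least that order.\<close>

lemma T_asymptotics: "((\<lambda>z. T z o\<^sub>L cscale (\<delta> z)) \<longlongrightarrow> Pc) (at 1 within ball 0 1)"
proof -
  have \<Gamma>: "Gamma (1 + \<alpha>) > 0"
    using \<alpha> by (intro Gamma_real_pos) simp
  have MN: "((\<lambda>z. 5 * (M (N z) / N z)) \<longlongrightarrow> 0) (at 1 within ball 0 1)"
    using tendsto_mult_right_zero[OF filterlim_compose[OF M_over_n_tendsto_0 N_at_top], of 5] by simp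
  have \<delta>_le: "\<forall>\<^sub>F z in at 1 within ball 0 1. norm (\<delta> z) \<le> 5 * (M (N z) / N z)"
    using eventually_in_disc
  proof eventually_elim
    case (elim z)
    note Nb = N_bounds[of z]
    let ?s = "\<Sum>k<N z. of_real (p k) * z ^ k"
    have "norm ?s \<le> (\<Sum>k<N z. p k)"
      using elim by (intro order_trans[OF norm_sum] sum_mono)
        (simp add: norm_mult norm_power nonneg mult_left_le power_le_one)
    then have "norm (1 - z) * norm ?s \<le> 1 / N z * M (N z)"
      unfolding M_def using elim Nb by (intro mult_mono) auto
    moreover have "norm (1 - z) * norm (gen z - ?s) \<le> 2 * (2 * (M (N z) / N z))"
    proof -
      have "norm (1 - z) * norm (gen z - ?s) \<le> 2 * p (N z)"
        using elim by (intro gen_tail_bound) simp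
      also have "p (N z) \<le> M (N z) / N z"
        using p_le_average[of "N z"] Nb elim by (simp add: field_simps)
      also have "2 * (M (N z) / N z) \<le> 2 * (2 * (M (N z) / N z))"
        using divide_nonneg_nonneg[OF M_nonneg[of "N z"] of_nat_0_le_iff[of "N z"]] by linarith
      finally show ?thesis by simp
    qed
    moreover have "norm (\<delta> z) \<le> norm (1 - z) * norm ?s + norm (1 - z) * norm (gen z - ?s)"
      unfolding \<delta>_def norm_mult distrib_left[symmetric]
      using norm_triangle_sub[of "gen z" ?s] by (intro mult_left_mono) auto
    ultimately show ?case by (simp add: field_simps)
  qed
  show ?thesis
  proof (rule resolvent_near_simple_eigenvalue[where ?R0.0 = "R_z Rn 1" and R = "R_z Rn" and S = S and K = "16 * C / Gamma (1 + \<alpha>)"])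
    show "complex_linear Pc" by (rule complex_linear_complexify)
    show "Pc o\<^sub>L Pc = Pc" by (simp add: P complexify_compose[symmetric])
    show "\<forall>\<^sub>F z in at 1 within ball 0 1. inverse_blinfun (id_blinfun - R_z Rn z) (T z)"
      using eventually_in_disc by eventually_elim (rule T_inverse, auto)
    show "\<forall>\<^sub>F z in at 1 within ball 0 1. Pc o\<^sub>L (R_z Rn z o\<^sub>L Pc) = cscale (1 - \<delta> z) o\<^sub>L Pc"
      using eventually_in_disc by eventually_elim (rule P_R_z_P, auto)
    show "(\<delta> \<longlongrightarrow> 0) (at 1 within ball 0 1)"
      by (rule Lim_null_comparison[OF \<delta>_le MN])
    show "\<forall>\<^sub>F z in at 1 within ball 0 1. \<delta> z \<noteq> 0"
      using eventually_in_disc gen_lower_bound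
    proof eventually_elim
      case (elim z)
      have "0 < Gamma (1 + \<alpha>) / 2 * M (N z)"
        using \<Gamma> M_ge_1[OF N_bounds(1)[of z]] elim by simp
      then show ?case using elim by (auto simp: \<delta>_def)
    qed
    show "\<forall>\<^sub>F z in at 1 within ball 0 1. norm (R_z Rn 1 - R_z Rn z) \<le> 16 * C / Gamma (1 + \<alpha>) * norm (\<delta> z)"
      using eventually_in_disc gen_lower_bound
    proof eventually_elim
      case (elim z)
      note Nb = N_bounds[of z]
      have "norm (1 - z) \<le> 2 / N z"
        using Nb(2) elim by (auto intro: order_trans[OF _ divide_right_mono])
      then have "norm (R_z Rn 1 - R_z Rn z) \<le> 2 * C * (2 * M (N z) / N z)"
        using elim Nb(1) by (intro R_z_diff_bound) auto
      also have "\<dots> = 4 * C * M (N z) * (1 / N z)"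
        by simp
      also have "\<dots> \<le> 4 * C * M (N z) * (2 * norm (1 - z))"
        using Nb(3) elim C(1) M_nonneg[of "N z"] by (intro mult_left_mono) auto
      also have "\<dots> = 16 * C / Gamma (1 + \<alpha>) * (norm (1 - z) * (Gamma (1 + \<alpha>) / 2 * M (N z)))"
        using \<Gamma> by simp
      also have "\<dots> \<le> 16 * C / Gamma (1 + \<alpha>) * (norm (1 - z) * norm (gen z))"
        using elim \<Gamma> C(1) by (intro mult_left_mono) auto
      finally show ?case by (simp add: \<delta>_def norm_mult)
    qed
  qed (rule PR S)+
qed

text \<open>Near \<open>1\<close> the resolvent is of order \<open>1 / (|1 - z| M (N z))\<close>, and Potter's bound compares \<open>M (N z)\<close> with \<open>M n\<close>.
Away from \<open>1\<close> it is bounded by compactness.\<close>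

lemma T_bound:
  assumes c: "c > 0"
  obtains K where "K > 0" "\<And>n z. n > 0 \<Longrightarrow> norm z < 1 \<Longrightarrow> c \<le> n * norm (1 - z) \<Longrightarrow>
    norm (T z) \<le> K * (n / M n) * (n * norm (1 - z)) powr (\<gamma> - 1)"
proof -
  obtain KP where KP: "KP > 0" "\<And>j n. 1 \<le> j \<Longrightarrow> j \<le> n \<Longrightarrow> M n \<le> KP * (real n / real j) powr \<gamma> * M j"
    using potter_bound_\<gamma> by blast
  have \<Gamma>: "Gamma (1 + \<alpha>) > 0"
    using \<alpha> by (intro Gamma_real_pos) simp
  define a where "a = 4 * (norm Pc + 1) / Gamma (1 + \<alpha>)"
  have a: "a > 0" using \<Gamma> by (simp add: a_def add_nonneg_pos)
  have "\<forall>\<^sub>F z in at 1 within ball 0 1. norm (T z o\<^sub>L cscale (\<delta> z)) < norm Pc + 1"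
    by (rule order_tendstoD(2)[OF tendsto_norm[OF T_asymptotics]]) simp
  then have "\<forall>\<^sub>F z in at 1 within ball 0 1. N z > 0 \<and> 1 / N z \<le> 2 * norm (1 - z) \<and> N z \<le> 1 / norm (1 - z) \<and> norm (T z) \<le> a / (norm (1 - z) * M (N z))"
    using eventually_in_disc gen_lower_bound
  proof eventually_elim
    case (elim z)
    note Nb = N_bounds[of z]
    have N: "N z > 0" using Nb elim by simp
    have \<rho>: "0 < norm (1 - z)" using elim by simp
    have M: "0 < M (N z)" using M_ge_1[OF N] by simp
    have "0 < norm (1 - z) * (Gamma (1 + \<alpha>) / 2 * M (N z))"
      using \<Gamma> M \<rho> by simp
    moreover have low: "norm (1 - z) * (Gamma (1 + \<alpha>) / 2 * M (N z)) \<le> norm (\<delta> z)"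
      unfolding \<delta>_def norm_mult using elim by (intro mult_left_mono) auto
    ultimately have \<delta>: "0 < norm (\<delta> z)" by (rule order_less_le_trans)
    then have "T z = (T z o\<^sub>L cscale (\<delta> z)) o\<^sub>L cscale (1 / \<delta> z)"
      by (simp add: blinfun_compose_assoc cscale_mult[symmetric])
    then have "norm (T z) \<le> 2 * norm (1 / \<delta> z) * norm (T z o\<^sub>L cscale (\<delta> z))"
      by (metis norm_compose_cscale)
    also have "\<dots> \<le> 2 * norm (1 / \<delta> z) * (norm Pc + 1)"
      using elim by (intro mult_left_mono) auto
    also have "\<dots> = 2 * (norm Pc + 1) / norm (\<delta> z)"
      by (simp add: norm_divide)
    also have "\<dots> \<le> 2 * (norm Pc + 1) / (norm (1 - z) * (Gamma (1 + \<alpha>) / 2 * M (N z)))"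
      using low \<delta> \<open>0 < norm (1 - z) * _\<close> by (intro divide_left_mono) auto
    also have "\<dots> = a / (norm (1 - z) * M (N z))"
      using \<Gamma> by (simp add: a_def)
    finally have "norm (T z) \<le> a / (norm (1 - z) * M (N z))" .
    moreover have "N z \<le> 1 / norm (1 - z)"
      using Nb(2) elim N \<rho> by (simp add: field_simps)
    ultimately show ?case using N Nb(3) elim by simp
  qed
  then obtain \<eta> where \<eta>: "\<eta> > 0" "\<And>z. norm z < 1 \<Longrightarrow> z \<noteq> 1 \<Longrightarrow> norm (1 - z) < \<eta> \<Longrightarrow>
      N z > 0 \<and> 1 / N z \<le> 2 * norm (1 - z) \<and> N z \<le> 1 / norm (1 - z) \<and> norm (T z) \<le> a / (norm (1 - z) * M (N z))"
    unfolding eventually_at by (auto simp: dist_norm norm_minus_commute)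
  have "compact (cball 0 1 - ball 1 \<eta> :: complex set)"
    by (intro compact_diff) auto
  then have "bounded (T ` (cball 0 1 - ball 1 \<eta>))"
    using \<eta>(1) by (intro compact_imp_bounded compact_continuous_image continuous_on_subset[OF T_continuous]) auto
  then obtain B where B: "B > 0" "\<And>z. z \<in> cball 0 1 - ball 1 \<eta> \<Longrightarrow> norm (T z) \<le> B"
    unfolding bounded_pos by auto
  define K where "K = a * KP * 2 powr \<gamma> + a * c powr (- \<gamma>) + B * KP * 2 powr (1 - \<gamma>)"
  show ?thesis
  proof (rule that[of K])
    show "K > 0"
      using a KP(1) B(1) c by (simp add: K_def add_pos_pos)
    fix n :: nat and z :: complex
    assume n: "n > 0" and z: "norm z < 1" and nz: "c \<le> n * norm (1 - z)"
    define \<rho> where "\<rho> = norm (1 - z)"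
    define X where "X = n * \<rho>"
    have \<rho>: "\<rho> > 0" "\<rho> \<le> 2"
      using z norm_triangle_ineq4[of 1 z] by (auto simp: \<rho>_def)
    have X: "X > 0" "c \<le> X" using \<rho> n nz by (auto simp: X_def \<rho>_def)
    have Mn: "M n > 0" using M_ge_1[OF n] by simp
    have z1: "z \<noteq> 1" using z by auto
    let ?Z = "(n / M n) * X powr (\<gamma> - 1)"
    have Zpos: "0 \<le> ?Z" using Mn by simp
    have X1: "X powr (\<gamma> - 1) = X powr \<gamma> / X"
      using X by (simp add: powr_diff)
    consider "\<rho> < \<eta>" "N z \<le> n" | "\<rho> < \<eta>" "n < N z" | "\<eta> \<le> \<rho>" by linarith
    then have "norm (T z) \<le> (a * KP * 2 powr \<gamma>) * ?Z \<or> norm (T z) \<le> (a * c powr (- \<gamma>)) * ?Z \<or> norm (T z) \<le> (B * KP * 2 powr (1 - \<gamma>)) * ?Z"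
    proof cases
      case 1
      have h: "N z > 0" "1 / N z \<le> 2 * \<rho>" "norm (T z) \<le> a / (\<rho> * M (N z))"
        using \<eta>(2)[OF z z1] 1 by (auto simp: \<rho>_def)
      have MN: "M (N z) > 0" using M_ge_1[OF h(1)] by simp
      have "real n / real (N z) \<le> 2 * X"
        using mult_left_mono[OF h(2), of "real n"] by (simp add: X_def)
      then have "(real n / real (N z)) powr \<gamma> \<le> (2 * X) powr \<gamma>"
        using \<gamma> by (intro powr_mono2) auto
      then have "M n \<le> KP * (2 * X) powr \<gamma> * M (N z)"
        using KP(2)[of "N z" n] h(1) 1(2) KP(1) MN
        by (smt (verit) mult_left_mono mult_right_mono One_nat_def Suc_leI)
      then have "1 / M (N z) \<le> KP * (2 * X) powr \<gamma> / M n"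
        using Mn MN by (simp add: field_simps)
      then have "a / \<rho> * (1 / M (N z)) \<le> a / \<rho> * (KP * (2 * X) powr \<gamma> / M n)"
        using a \<rho> by (intro mult_left_mono) auto
      also have "\<dots> = (a * KP * 2 powr \<gamma>) * ?Z"
        using \<rho> n X(1) unfolding X1 by (simp add: X_def powr_mult field_simps)
      finally show ?thesis using h(3) by simp
    next
      case 2
      have h: "N z > 0" "norm (T z) \<le> a / (\<rho> * M (N z))"
        using \<eta>(2)[OF z z1] 2 by (auto simp: \<rho>_def)
      have "M n \<le> M (N z)" using 2 by (intro M_mono) simp
      then have "a / (\<rho> * M (N z)) \<le> a / (\<rho> * M n)"
        using a \<rho> Mn by (intro divide_left_mono mult_left_mono) auto
      also have "\<dots> = a * (n / M n) * (1 / X)"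
        using n \<rho> by (simp add: X_def)
      also have "\<dots> = a * (n / M n) * (X powr (\<gamma> - 1) * X powr (- \<gamma>))"
      proof -
        have "X powr (\<gamma> - 1) * X powr (- \<gamma>) = X powr (\<gamma> - 1 + - \<gamma>)"
          by (rule powr_add[symmetric])
        also have "\<gamma> - 1 + - \<gamma> = - 1" by simp
        also have "X powr - 1 = 1 / X"
          using X(1) powr_minus_divide[of X 1] by simp
        finally show ?thesis by simp
      qed
      also have "\<dots> \<le> a * (n / M n) * (X powr (\<gamma> - 1) * c powr (- \<gamma>))"
        using a Mn X c \<gamma> by (intro mult_left_mono powr_mono2') auto
      finally show ?thesis using h(2) by (simp add: mult_ac)
    next
      case 3
      have "norm (T z) \<le> B"
        using 3 z by (intro B(2)) (auto simp: \<rho>_def dist_norm)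
      moreover have "1 \<le> KP * 2 powr (1 - \<gamma>) * ?Z"
      proof -
        have "M n \<le> KP * real n powr \<gamma>"
          using KP(2)[of 1 n] n by (simp add: M_1)
        then have "1 \<le> KP * real n powr \<gamma> / M n"
          using Mn by simp
        also have "\<dots> = KP * 2 powr (1 - \<gamma>) * ((n / M n) * (2 * real n) powr (\<gamma> - 1))"
          using n by (simp add: powr_mult powr_diff field_simps)
        also have "\<dots> \<le> KP * 2 powr (1 - \<gamma>) * ?Z"
          using KP(1) Mn X \<rho> n \<gamma> by (intro mult_left_mono powr_mono2') (auto simp: X_def)
        finally show ?thesis .
      qed
      then have "B * 1 \<le> B * (KP * 2 powr (1 - \<gamma>) * ?Z)"
        using B(1) by (intro mult_left_mono) auto
      ultimately show ?thesis by (simp add: mult_ac)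
    qed
    moreover have "(a * KP * 2 powr \<gamma>) * ?Z \<le> K * ?Z" "(a * c powr (- \<gamma>)) * ?Z \<le> K * ?Z" "(B * KP * 2 powr (1 - \<gamma>)) * ?Z \<le> K * ?Z"
      using a KP(1) B(1) c by (intro mult_right_mono Zpos, simp add: K_def)+
    ultimately have "norm (T z) \<le> K * ?Z" by linarith
    then show "norm (T z) \<le> K * (n / M n) * (n * norm (1 - z)) powr (\<gamma> - 1)"
      by (simp add: X_def \<rho>_def mult_ac)
  qed
qed

end

section \<open>Points on a circle slightly inside the unit circle\<close>

text \<open>Jordan's inequality up to \<open>\<pi>/2\<close>, and by reflection a bit beyond. The range \<open>3\<pi>/4\<close> corresponds to half the
angle of points of the circle turned by \<open>\<pi>/n\<close>, for \<open>n \<ge> 2\<close>.\<close>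

lemma sin_ge_sixth:
  assumes "0 \<le> u" "u \<le> 3 * pi / 4"
  shows "u / 6 \<le> sin u"
proof -
  have low: "2 * u / pi \<le> sin u" if "0 \<le> u" "u \<le> pi / 2" for u :: real
  proof -
    have "concave_on {0..pi} sin"
    proof (rule f''_le0_imp_concave)
      show "(sin has_real_derivative cos x) (at x)" for x :: real
        by (auto intro!: derivative_eq_intros)
      show "(cos has_real_derivative - sin x) (at x)" for x :: real
        by (auto intro!: derivative_eq_intros)
      show "- sin x \<le> 0" if "x \<in> {0..pi}" for x
        using sin_ge_zero[of x] that by simp
    qed simp
    from concave_onD[OF this, of "2 * u / pi" 0 "pi / 2"] that show ?thesis
      by (simp add: field_simps)
  qed
  show ?thesis
  proof (cases "u \<le> pi / 2")
    case True
    have "u / 6 \<le> 2 * u / pi"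
      using assms pi_less_4 mult_left_mono[of pi 12 u] by (simp add: field_simps)
    then show ?thesis using low[OF assms(1) True] by simp
  next
    case False
    have "2 * (pi - u) / pi \<le> sin u"
      using low[of "pi - u"] False assms by (simp add: sin_diff)
    moreover have "1 / 2 \<le> 2 * (pi - u) / pi"
      using assms by (simp add: field_simps)
    moreover have "u / 6 \<le> 1 / 2"
      using assms pi_less_4 by simp
    ultimately show ?thesis
      by linarith
  qed
qed

text \<open>In the rescaled angle \<open>x\<close>, the point of the circle of radius \<open>exp(-1/n)\<close> at angle \<open>x/n\<close> has distance of order \<open>(1 + |x|)/n\<close>
from \<open>1\<close>: the radius accounts for the \<open>1\<close> and the angle for \<open>|x|\<close>.\<close>

lemma circle_point_distance:
  fixes n :: nat and x :: real
  assumes n: "n > 0" and x: "\<bar>x\<bar> \<le> 3 / 2 * pi * n"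
  shows "(1 + \<bar>x\<bar>) / 24 \<le> n * norm (1 - of_real (exp (- 1 / n)) * cis (x / n))"
proof -
  define r where "r = exp (- 1 / real n)"
  have r: "0 < r" "r < 1" using n by (auto simp: r_def)
  define t where "t = 1 / real n"
  have t: "0 < t" "t \<le> 1" "r = exp (- t)" using n by (auto simp: t_def r_def)
  have r1: "1 / (2 * real n) \<le> 1 - r"
  proof -
    have "r \<le> 1 / (1 + t)"
      unfolding t(3) exp_minus inverse_eq_divide
      using exp_ge_add_one_self[of t] t(1) by (intro divide_left_mono) auto
    also have "\<dots> \<le> 1 - t / 2"
      using t mult_left_mono[of t 1 t] by (simp add: field_simps)
    finally show ?thesis by (simp add: t_def)
  qed
  have r2: "1 / 4 \<le> r"
  proof -
    have "1 / 4 \<le> 1 / exp (1::real)"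
      using exp_le by (intro divide_left_mono) auto
    also have "\<dots> = exp (- 1)" by (simp add: exp_minus field_simps)
    also have "\<dots> \<le> r" using t by simp
    finally show ?thesis .
  qed
  let ?w = "1 - of_real r * cis (x / n)"
  have "1 - r \<le> norm ?w"
    using norm_triangle_ineq2[of 1 "of_real r * cis (x / n)"] r by (simp add: norm_mult)
  with r1 have "1 / (2 * real n) \<le> norm ?w" by linarith
  then have a: "1 / 2 \<le> n * norm ?w"
    using n by (simp add: field_simps)
  have "\<bar>x\<bar> / (12 * n) \<le> norm ?w"
  proof -
    define u where "u = \<bar>x\<bar> / (2 * n)"
    have u: "0 \<le> u" "u \<le> 3 * pi / 4"
      using x n by (auto simp: u_def field_simps)
    have "(norm ?w)\<^sup>2 = (1 - r)\<^sup>2 + 4 * r * (sin u)\<^sup>2"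
    proof -
      have "cos (x / n) = cos (2 * u)"
        unfolding u_def by (cases "0 \<le> x") simp_all
      then have c: "cos (x / n) = 1 - 2 * (sin u)\<^sup>2"
        by (simp add: cos_double_sin)
      have "(norm ?w)\<^sup>2 = (1 - r * cos (x / n))\<^sup>2 + (r * sin (x / n))\<^sup>2"
        by (simp add: cmod_power2 cis.sel)
      also have "\<dots> = (1 - r * cos (x / n))\<^sup>2 + r\<^sup>2 * (1 - (cos (x / n))\<^sup>2)"
        by (simp add: power_mult_distrib sin_squared_eq)
      also have "\<dots> = 1 - 2 * r * cos (x / n) + r\<^sup>2"
        by (simp add: power2_eq_square algebra_simps)
      finally show ?thesis
        unfolding c by (simp add: power2_eq_square algebra_simps)
    qed
    moreover have "(u / 6)\<^sup>2 \<le> (sin u)\<^sup>2"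
      using sin_ge_sixth[OF u] u(1) by (intro power_mono) auto
    moreover have "1 * (sin u)\<^sup>2 \<le> (4 * r) * (sin u)\<^sup>2"
      using r2 by (intro mult_right_mono) auto
    ultimately have "(u / 6)\<^sup>2 \<le> (norm ?w)\<^sup>2"
      using zero_le_power2[of "1 - r"] by linarith
    then have "u / 6 \<le> norm ?w"
      by (rule power2_le_imp_le) simp
    then show ?thesis by (simp add: u_def)
  qed
  then have b: "\<bar>x\<bar> / 12 \<le> n * norm ?w"
    using n by (simp add: field_simps)
  have "(1 + a) / 24 \<le> V" if "1 / 2 \<le> V" "a / 12 \<le> V" for a V :: real
  proof -
    have "(1 + a) / 24 \<le> (1 / 2 + a / 12) / 2" by (simp add: field_simps)
    also have "\<dots> \<le> (V + V) / 2"
      by (rule divide_right_mono[OF add_mono[OF that]]) simp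
    finally show ?thesis by simp
  qed
  from this[OF a b] have "(1 + \<bar>x\<bar>) / 24 \<le> n * norm ?w" .
  then show ?thesis by (simp add: r_def)
qed

text \<open>This is the derivative at \<open>0\<close> of \<open>z \<mapsto> exp (z (i x - 1))\<close>, taken along \<open>z = 1/n\<close>.\<close>

lemma circle_point_limit:
  "(\<lambda>n. real n *\<^sub>R (1 - of_real (exp (- 1 / n)) * cis (x / n))) \<longlonglongrightarrow> 1 - \<i> * of_real x"
proof -
  define c where "c = \<i> * of_real x - 1"
  have "((\<lambda>z. exp (z * c)) has_field_derivative c) (at 0)"
    by (auto intro!: derivative_eq_intros)
  then have "((\<lambda>z. (exp (z * c) - 1) / z) \<longlongrightarrow> c) (at 0)"
    by (simp add: has_field_derivative_iff)
  moreover have "filterlim (\<lambda>n. of_real (1 / real n) :: complex) (at 0) sequentially"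
    unfolding filterlim_at
    using tendsto_of_real[OF lim_1_over_n, where ?'a = complex]
    by (auto intro!: eventually_mono[OF eventually_gt_at_top[of 0]])
  ultimately have "(\<lambda>n. (exp (of_real (1 / real n) * c) - 1) / of_real (1 / real n)) \<longlonglongrightarrow> c"
    by (rule filterlim_compose)
  from tendsto_minus[OF this]
  have lim: "(\<lambda>n. - ((exp (of_real (1 / real n) * c) - 1) / of_real (1 / real n))) \<longlonglongrightarrow> 1 - \<i> * of_real x"
    by (simp add: c_def)
  have "exp (of_real (1 / real n) * c) = of_real (exp (- 1 / n)) * cis (x / n)" for n
  proof -
    have "of_real (1 / real n) * c = of_real (- 1 / n) + \<i> * of_real (x / n)"
      by (simp add: c_def algebra_simps)
    then show ?thesis
      by (simp only: exp_add exp_of_real cis_conv_exp)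
  qed
  then have "- ((exp (of_real (1 / real n) * c) - 1) / of_real (1 / real n)) = real n *\<^sub>R (1 - of_real (exp (- 1 / n)) * cis (x / n))" for n
    by (simp add: scaleR_conv_of_real algebra_simps)
  with lim show ?thesis by simp
qed

lemma integrable_shifted_power:
  fixes s :: real
  assumes "s < -1"
  shows "(\<lambda>x::real. if x \<le> 1 then 1 else x powr s) integrable_on {0..}"
proof (rule integrable_Un'[where A = "{0..1}" and B = "{1..}"])
  have "(\<lambda>x::real. 1::real) integrable_on {0..1}"
    by (rule integrable_const_ivl)
  then show "(\<lambda>x::real. if x \<le> 1 then 1 else x powr s) integrable_on {0..1}"
    by (rule integrable_eq) auto
  have "(\<lambda>x::real. x powr s) integrable_on {1..}"
    using has_integral_powr_to_inf[OF assms, of 1] by (auto simp: has_integral_iff)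
  then show "(\<lambda>x::real. if x \<le> 1 then 1 else x powr s) integrable_on {1..}"
    by (rule integrable_eq) auto
  have "{0..1} \<inter> {1..} = {1::real}" by auto
  then show "negligible ({0..1::real} \<inter> {1..})" by simp
qed auto

text \<open>Dominated convergence on growing intervals. The integral is split at \<open>0\<close>, so that a power tail on a half-line can
serve as the dominating function.\<close>

lemma rescaled_circle_integral_tendsto_0:
  fixes w :: "nat \<Rightarrow> real \<Rightarrow> real"
  assumes cont: "\<And>n. continuous_on UNIV (w n)" and s: "s < -1"
    and dom: "\<And>n x. n > 1 \<Longrightarrow> \<bar>x\<bar> \<le> pi * n \<Longrightarrow> \<bar>w n x\<bar> \<le> K * (1 + \<bar>x\<bar>) powr s"
    and lim: "\<And>x. (\<lambda>n. w n x) \<longlonglongrightarrow> 0"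
  shows "(\<lambda>n. integral {- pi * n..pi * n} (w n)) \<longlonglongrightarrow> 0"
proof -
  define h where "h x = (if x \<le> 1 then 1 else x powr s)" for x :: real
  have half: "(\<lambda>n. integral {0..pi * n} (v n)) \<longlonglongrightarrow> 0"
    if cont: "\<And>n. continuous_on UNIV (v n)" and dom: "\<And>n x. n > 1 \<Longrightarrow> 0 \<le> x \<Longrightarrow> x \<le> pi * n \<Longrightarrow> \<bar>v n x\<bar> \<le> K * (1 + x) powr s"
      and lim: "\<And>x. (\<lambda>n. v n x) \<longlonglongrightarrow> 0" for v :: "nat \<Rightarrow> real \<Rightarrow> real"
  proof -
    define V where "V n x = (if x \<in> {0..pi * n} then v n x else 0)" for n x
    have K: "K \<ge> 0"
      using dom[of 2 0] by simp
    have sub: "{0..pi * n} \<subseteq> {0..}" for n :: nat by auto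
    have int: "integral {0..} (V n) = integral {0..pi * n} (v n)" for n
      unfolding V_def Henstock_Kurzweil_Integration.integral_restrict_Int by (simp add: Int_absorb2[OF sub])
    \<comment> \<open>shifted by two, because the bound is assumed for \<open>n > 1\<close> only\<close>
    have "(\<lambda>n. integral {0..} (V (Suc (Suc n)))) \<longlonglongrightarrow> integral {0..} (\<lambda>x::real. 0)"
    proof (rule dominated_convergence(2)[where f = "\<lambda>n. V (Suc (Suc n))" and h = "\<lambda>x. K * h x"])
      fix n
      have "v n integrable_on {0..pi * n}" for n
        by (rule integrable_continuous_interval[OF continuous_on_subset[OF cont]]) simp
      then show "V (Suc (Suc n)) integrable_on {0..}"
        unfolding V_def integrable_restrict_Int Int_absorb2[OF sub] .
      show "(\<lambda>x. K * h x) integrable_on {0..}"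
        using integrable_cmul[OF integrable_shifted_power[OF s], of K] by (simp add: h_def)
      fix x :: real assume x: "x \<in> {0..}"
      have "(1 + x) powr s \<le> h x"
      proof (cases "x \<le> 1")
        case True
        then show ?thesis
          using x s powr_mono2'[of s 1 "1 + x"] by (simp add: h_def)
      next
        case False
        then show ?thesis
          using s powr_mono2'[of s x "1 + x"] by (simp add: h_def)
      qed
      then have "K * (1 + x) powr s \<le> K * h x"
        using K by (rule mult_left_mono)
      moreover have "0 \<le> K * h x"
        using K by (simp add: h_def)
      ultimately show "norm (V (Suc (Suc n)) x) \<le> K * h x"
        using dom[of "Suc (Suc n)" x] by (auto simp: V_def)
      have "norm (V k x) \<le> norm (v k x)" for k
        by (simp add: V_def)
      then have "(\<lambda>k. V k x) \<longlonglongrightarrow> 0"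
        by (intro Lim_null_comparison[OF _ tendsto_norm_zero[OF lim]] always_eventually) auto
      then show "(\<lambda>n. V (Suc (Suc n)) x) \<longlonglongrightarrow> 0"
        by (rule LIMSEQ_Suc[OF LIMSEQ_Suc])
    qed
    then have "(\<lambda>n. integral {0..} (V (Suc (Suc n)))) \<longlonglongrightarrow> 0"
      by simp
    then have "(\<lambda>n. integral {0..} (V n)) \<longlonglongrightarrow> 0"
      by (rule LIMSEQ_imp_Suc[OF LIMSEQ_imp_Suc])
    then show ?thesis by (simp add: int)
  qed
  have "(\<lambda>n. integral {0..pi * n} (w n) + integral {0..pi * n} (\<lambda>x. w n (- x))) \<longlonglongrightarrow> 0 + 0"
  proof (intro tendsto_add half)
    show "continuous_on UNIV (\<lambda>x. w n (- x))" for n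
      by (rule continuous_on_compose2[OF cont]) (auto intro: continuous_intros)
    show "\<bar>w n (- x)\<bar> \<le> K * (1 + x) powr s" if "n > 1" "0 \<le> x" "x \<le> pi * n" for n x
      using dom[of n "- x"] that by simp
    show "\<bar>w n x\<bar> \<le> K * (1 + x) powr s" if "n > 1" "0 \<le> x" "x \<le> pi * n" for n x
      using dom[of n x] that by simp
  qed (rule cont lim)+
  moreover have "integral {- pi * n..pi * n} (w n) = integral {0..pi * n} (w n) + integral {0..pi * n} (\<lambda>x. w n (- x))" for n
  proof -
    have "integral {- pi * n..0} (w n) + integral {0..pi * n} (w n) = integral {- pi * n..pi * n} (w n)"
      by (rule Henstock_Kurzweil_Integration.integral_combine)
        (auto intro!: integrable_continuous_interval continuous_on_subset[OF cont])
    moreover have "integral {0..pi * n} (\<lambda>x. w n (- x)) = integral {- pi * n..0} (w n)"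
      using Henstock_Kurzweil_Integration.integral_reflect_real[of 0 "- pi * n" "w n"] by simp
    ultimately show ?thesis by simp
  qed
  ultimately show ?thesis by simp
qed

section \<open>Asymptotics of the renewal sequence\<close>

text \<open>The bound on increments of \<open>R\<close>, applied to the scalar renewal problem whose tails are the model sequence:
there \<open>(1 - z)\<^sup>1\<^sup>-\<^sup>\<alpha>\<close> plays the role of \<open>\<delta>(z)\<close>.\<close>

lemma one_minus_powr_diff_bound:
  fixes z w :: complex
  assumes \<alpha>: "0 \<le> \<alpha>" "\<alpha> \<le> 1" and zw: "norm z < 1" "norm w < 1" and n: "n > 0" and d: "norm (z - w) \<le> pi / real n"
  shows "norm ((1 - z) powr of_real (1 - \<alpha>) - (1 - w) powr of_real (1 - \<alpha>)) \<le> pi * (\<Sum>k<n. model \<alpha> k) / n"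
proof -
  interpret m: decreasing_seq "model \<alpha>" by (rule decreasing_model[OF \<alpha>])
  let ?a = "\<lambda>z k. of_real (model \<alpha> k - model \<alpha> (Suc k)) * z ^ Suc k :: complex"
  have eq: "(1 - z) powr of_real (1 - \<alpha>) = of_real (model \<alpha> 0) - (\<Sum>k. ?a z k)" if "norm z < 1" for z
  proof -
    have "1 - z \<noteq> 0" using that by auto
    then have "(1 - z) powr of_real (1 - \<alpha>) = (1 - z) * (1 - z) powr (- of_real \<alpha>)"
      using powr_add[of "1 - z" 1 "- of_real \<alpha>"] by simp
    also have "(1 - z) powr (- of_real \<alpha>) = m.gen z"
      unfolding m.gen_def by (rule sums_unique[OF model_sums[OF that]])
    finally show ?thesis
      using m.one_minus_times_gen[OF that] by simp
  qed
  have aux: "(m - x) - (m - y) = y - x" for m x y :: complex by simp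
  have two: "pi \<ge> 2" using pi_ge_two by simp
  note drops = m.drops_power_diff[OF less_imp_le[OF zw(2)] less_imp_le[OF zw(1)] two n, unfolded norm_minus_commute[of w z], OF d]
  have s: "summable (?a z)" if "norm z < 1" for z
    using that by (intro summable_norm_cancel[OF m.summable_drops_power]) simp
  have "(1 - z) powr of_real (1 - \<alpha>) - (1 - w) powr of_real (1 - \<alpha>) = (\<Sum>k. ?a w k - ?a z k)"
    unfolding eq[OF zw(1)] eq[OF zw(2)] aux by (rule suminf_diff[OF s[OF zw(2)] s[OF zw(1)]])
  also have "norm \<dots> \<le> (\<Sum>k. (model \<alpha> k - model \<alpha> (Suc k)) * norm (w ^ Suc k - z ^ Suc k))"
  proof (rule norm_suminf_le[OF _ drops(1)])
    fix k
    have "?a w k - ?a z k = of_real (model \<alpha> k - model \<alpha> (Suc k)) * (w ^ Suc k - z ^ Suc k)"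
      by (simp only: right_diff_distrib)
    then show "norm (?a w k - ?a z k) \<le> (model \<alpha> k - model \<alpha> (Suc k)) * norm (w ^ Suc k - z ^ Suc k)"
      by (simp only: norm_mult norm_of_real) (simp add: m.p_le)
  qed
  also have "\<dots> \<le> pi * m.M n / n"
    by (rule drops(2))
  finally show ?thesis by (simp add: m.M_def)
qed

context renewal_operators
begin

abbreviation "\<kappa> \<equiv> Gamma (1 + \<alpha>)"

lemma \<kappa>: "\<kappa> > 0"
  using \<alpha> by (intro Gamma_real_pos) simp

definition g :: "complex \<Rightarrow> complex" where "g z = (1 - z) powr (- of_real (1 - \<alpha>))"

text \<open>The rescaled resolvent minus its expected singular part.\<close>

definition G where "G n z = (M n *\<^sub>R T z) - (cscale (of_real (real n powr \<alpha> / \<kappa>) * g z) o\<^sub>L Pc)" for n z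

text \<open>The circle of radius \<open>exp(-1/n)\<close>, on which \<open>|z\<^sup>n|\<close> stays bounded below, in the angular variable magnified by \<open>n\<close>.\<close>

definition circ :: "nat \<Rightarrow> real \<Rightarrow> complex" where "circ n x = of_real (exp (- 1 / n)) * cis (x / n)"

lemma norm_circ: "n > 0 \<Longrightarrow> norm (circ n x) < 1"
  by (simp add: circ_def norm_mult)

lemma one_minus_not_nonpos: "norm (z::complex) < 1 \<Longrightarrow> 1 - z \<notin> \<real>\<^sub>\<le>\<^sub>0"
  using complex_Re_le_cmod[of z] by (auto simp: complex_nonpos_Reals_iff)

lemma one_minus_powr_derivative:
  assumes "norm (z::complex) < 1"
  shows "((\<lambda>z. (1 - z) powr s) has_field_derivative s * (1 - z) powr (s - 1) * (- 1)) (at z)"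
proof (rule DERIV_chain2[where f = "\<lambda>w. w powr s" and g = "\<lambda>z. 1 - z"])
  show "((\<lambda>w. w powr s) has_field_derivative s * (1 - z) powr (s - 1)) (at (1 - z))"
    by (rule has_field_derivative_powr[OF one_minus_not_nonpos[OF assms]])
  show "((\<lambda>z. 1 - z) has_field_derivative - 1) (at z)"
    by (auto intro!: derivative_eq_intros)
qed

lemma G_holomorphic: "blinfun_holomorphic_on (G n) (ball 0 1)"
proof -
  have 1: "blinfun_holomorphic_on (\<lambda>z. cscale (of_real (M n)) o\<^sub>L T z) (ball 0 1)"
    by (rule blinfun_holomorphic_on_cscale[OF _ _ T_holomorphic, where \<phi>' = "\<lambda>_. 0"]) auto
  have 2: "blinfun_holomorphic_on (\<lambda>z. cscale (of_real (real n powr \<alpha> / \<kappa>) * g z) o\<^sub>L Pc) (ball 0 1)"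
  proof (rule blinfun_holomorphic_on_cscale[OF _ _ blinfun_holomorphic_on_const])
    fix z :: complex assume z: "z \<in> ball 0 1"
    have "((\<lambda>z. (1 - z) powr (- of_real (1 - \<alpha>))) has_field_derivative (- of_real (1 - \<alpha>)) * (1 - z) powr (- of_real (1 - \<alpha>) - 1) * (- 1)) (at z)"
      using z by (intro one_minus_powr_derivative) simp
    then show "((\<lambda>z. of_real (real n powr \<alpha> / \<kappa>) * g z) has_field_derivative
        of_real (real n powr \<alpha> / \<kappa>) * ((- of_real (1 - \<alpha>)) * (1 - z) powr (- of_real (1 - \<alpha>) - 1) * (- 1))) (at z)"
      unfolding g_def by (rule DERIV_cmult)
  next
    show "continuous_on (ball 0 1) (\<lambda>z. of_real (real n powr \<alpha> / \<kappa>) * ((- of_real (1 - \<alpha>)) * (1 - z) powr (- of_real (1 - \<alpha>) - 1) * (- 1)) :: complex)"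
      by (intro continuous_intros DERIV_continuous_on[OF has_field_derivative_at_within[OF one_minus_powr_derivative]]) simp
  qed
  have "G n = (\<lambda>z. (cscale (of_real (M n)) o\<^sub>L T z) - (cscale (of_real (real n powr \<alpha> / \<kappa>) * g z) o\<^sub>L Pc))"
    by (simp add: G_def fun_eq_iff cscale_of_real blinfun_compose_simps del: of_real_divide)
  with blinfun_holomorphic_on_diff[OF 1 2] show ?thesis by simp
qed

text \<open>The Taylor coefficients of \<open>G n\<close>.\<close>

definition A where "A n k = (M n *\<^sub>R renewal_sequence Rn k) - ((real n powr \<alpha> / \<kappa> * model (1 - \<alpha>) k) *\<^sub>R P)" for n k

lemma g_expansion:
  assumes z: "norm z \<le> 1 / 2"
  shows "norm (g z - (\<Sum>k\<le>n. of_real (model (1 - \<alpha>) k) * z ^ k)) \<le> 2 * norm z ^ Suc n"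
proof -
  interpret m: decreasing_seq "model (1 - \<alpha>)" using \<alpha> by (intro decreasing_model) auto
  let ?a = "\<lambda>k. of_real (model (1 - \<alpha>) k) * z ^ k"
  have z1: "norm z < 1" using z by simp
  have "?a sums g z"
    unfolding g_def by (rule model_sums[OF z1])
  then have "g z = (\<Sum>k. ?a k)" "summable ?a"
    by (simp_all add: sums_iff)
  then have "g z - (\<Sum>k<Suc n. ?a k) = (\<Sum>k. ?a (k + Suc n))"
    using suminf_minus_initial_segment[of ?a "Suc n"] by simp
  also have "norm \<dots> \<le> (\<Sum>k. norm z ^ Suc n * (1 / 2) ^ k)"
  proof (rule norm_suminf_le)
    show "summable (\<lambda>k. norm z ^ Suc n * (1 / 2) ^ k)"
      by (intro summable_mult summable_geometric) simp
    fix k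
    have "model (1 - \<alpha>) (k + Suc n) \<le> 1"
      using m.p_le[of 0 "k + Suc n"] by (simp add: model_def)
    then have "norm (?a (k + Suc n)) \<le> 1 * norm z ^ (k + Suc n)"
      unfolding norm_mult norm_power norm_of_real by (intro mult_right_mono) (auto simp: m.nonneg)
    also have "\<dots> = norm z ^ Suc n * norm z ^ k"
      by (simp add: power_add mult_ac)
    also have "\<dots> \<le> norm z ^ Suc n * (1 / 2) ^ k"
      using z by (intro mult_left_mono power_mono) auto
    finally show "norm (?a (k + Suc n)) \<le> norm z ^ Suc n * (1 / 2) ^ k" .
  qed
  also have "\<dots> = norm z ^ Suc n * (\<Sum>k. (1 / 2) ^ k)"
    by (rule suminf_mult) (simp add: summable_geometric)
  also have "(\<Sum>k. (1 / 2 :: real) ^ k) = 2"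
    using suminf_geometric[of "1/2 :: real"] by simp
  finally show ?thesis
    by (simp add: lessThan_Suc_atMost mult.commute)
qed

lemma G_expansion:
  "\<exists>K. \<forall>z. norm z < 1 / 2 \<longrightarrow> norm (G n z - (\<Sum>k\<le>n. cscale (z ^ k) o\<^sub>L complexify (A n k))) \<le> K * norm z ^ Suc n"
proof -
  have "compact (T ` cball 0 (1/2))"
    by (intro compact_continuous_image continuous_on_subset[OF T_continuous]) (auto simp: subset_iff)
  then have "bounded (T ` cball 0 (1/2))" by (rule compact_imp_bounded)
  then obtain B where B': "\<forall>z\<in>cball 0 (1/2). norm (T z) \<le> B"
    by (auto simp: bounded_iff)
  have B: "norm (T z) \<le> B" if "norm z \<le> 1/2" for z
    using B' that by simp
  have "\<exists>K. \<forall>z. norm z \<le> 1/2 \<longrightarrow>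
      norm (T z - (\<Sum>k\<le>n. cscale (z ^ k) o\<^sub>L complexify (renewal_sequence Rn k))) \<le> K * norm z ^ Suc n"
  proof (rule renewal_expansion[OF summable_Rn])
    fix z :: complex assume "norm z \<le> 1/2"
    then have "norm z \<le> 1" "z \<noteq> 1" by auto
    then show "inverse_blinfun (id_blinfun - R_z Rn z) (T z)" by (rule T_inverse)
  qed (rule B)
  then obtain K where K: "\<And>z. norm z \<le> 1/2 \<Longrightarrow>
      norm (T z - (\<Sum>k\<le>n. cscale (z ^ k) o\<^sub>L complexify (renewal_sequence Rn k))) \<le> K * norm z ^ Suc n"
    by blast
  define c where "c = real n powr \<alpha> / \<kappa>"
  have c: "c \<ge> 0" using \<kappa> by (simp add: c_def)
  show ?thesis
  proof (intro exI allI impI)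
    fix z :: complex assume "norm z < 1 / 2"
    then have z: "norm z \<le> 1 / 2" by simp
    have tm: "cscale (z ^ k) o\<^sub>L complexify (A n k) = M n *\<^sub>R (cscale (z ^ k) o\<^sub>L complexify (renewal_sequence Rn k))
        - (cscale (of_real c * (of_real (model (1 - \<alpha>) k) * z ^ k)) o\<^sub>L Pc)" for k
    proof -
      have "(cscale (of_real c * (of_real (model (1 - \<alpha>) k) * z ^ k)) :: ('b \<times> 'b) \<Rightarrow>\<^sub>L ('b \<times> 'b)) = (c * model (1 - \<alpha>) k) *\<^sub>R cscale (z ^ k)"
        by (simp add: cscale_scaleR[symmetric] scaleR_conv_of_real mult.assoc)
      then have "cscale (of_real c * (of_real (model (1 - \<alpha>) k) * z ^ k)) o\<^sub>L Pc = (c * model (1 - \<alpha>) k) *\<^sub>R (cscale (z ^ k) o\<^sub>L Pc)"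
        by (simp only: blinfun_compose.scaleR_left)
      then show ?thesis
        unfolding A_def c_def[symmetric] by (simp only: complexify_diff complexify_scaleR blinfun_compose_simps)
    qed
    have "(\<Sum>k\<le>n. cscale (z ^ k) o\<^sub>L complexify (A n k)) = M n *\<^sub>R (\<Sum>k\<le>n. cscale (z ^ k) o\<^sub>L complexify (renewal_sequence Rn k))
        - (cscale (of_real c * (\<Sum>k\<le>n. of_real (model (1 - \<alpha>) k) * z ^ k)) o\<^sub>L Pc)"
      unfolding tm sum_subtractf scaleR_sum_right sum_distrib_left
      by (simp add: linear_sum[OF bounded_linear.linear[OF bounded_linear_cscale]] blinfun_compose.sum_left)
    then have "G n z - (\<Sum>k\<le>n. cscale (z ^ k) o\<^sub>L complexify (A n k)) =
        M n *\<^sub>R (T z - (\<Sum>k\<le>n. cscale (z ^ k) o\<^sub>L complexify (renewal_sequence Rn k)))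
        - (cscale (of_real c * (g z - (\<Sum>k\<le>n. of_real (model (1 - \<alpha>) k) * z ^ k))) o\<^sub>L Pc)"
      by (simp add: G_def c_def[symmetric] scaleR_diff_right right_diff_distrib cscale_diff blinfun_compose_simps)
    also have "norm \<dots> \<le> M n * (K * norm z ^ Suc n) + 2 * (c * (2 * norm z ^ Suc n)) * norm Pc"
    proof (rule norm_triangle_le_diff[OF add_mono])
      show "norm (M n *\<^sub>R (T z - (\<Sum>k\<le>n. cscale (z ^ k) o\<^sub>L complexify (renewal_sequence Rn k)))) \<le> M n * (K * norm z ^ Suc n)"
        unfolding norm_scaleR using K[OF z] M_nonneg[of n] by (simp add: mult_left_mono)
      have "norm (of_real c * (g z - (\<Sum>k\<le>n. of_real (model (1 - \<alpha>) k) * z ^ k))) \<le> c * (2 * norm z ^ Suc n)"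
        unfolding norm_mult norm_of_real using g_expansion[OF z] c by (intro mult_mono) auto
      then show "norm (cscale (of_real c * (g z - (\<Sum>k\<le>n. of_real (model (1 - \<alpha>) k) * z ^ k))) o\<^sub>L Pc) \<le> 2 * (c * (2 * norm z ^ Suc n)) * norm Pc"
        by (intro order_trans[OF norm_cscale_compose] mult_right_mono) auto
    qed
    also have "\<dots> = (M n * K + 4 * c * norm Pc) * norm z ^ Suc n"
      by (simp add: algebra_simps)
    finally show "norm (G n z - (\<Sum>k\<le>n. cscale (z ^ k) o\<^sub>L complexify (A n k))) \<le> (M n * K + 4 * c * norm Pc) * norm z ^ Suc n" .
  qed
qed

text \<open>The integrand of the coefficient bound in the magnified variable; the shift by \<open>\<pi>\<close> is the turn by \<open>\<pi>/n\<close>.\<close>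

definition w where "w n x = norm (G n (circ n x) - G n (circ n (x + pi))) / n" for n x

lemma coefficient_le_integral:
  assumes n: "n > 0"
  shows "2 * pi * exp (- 1) * norm (A n n) \<le> integral {- pi * n..pi * n} (w n)"
proof -
  obtain K where K: "\<And>z. norm z < 1 / 2 \<Longrightarrow> norm (G n z - (\<Sum>k\<le>n. cscale (z ^ k) o\<^sub>L complexify (A n k))) \<le> K * norm z ^ Suc n"
    using G_expansion by blast
  define r where "r = exp (- 1 / real n)"
  have r: "0 < r" "r < 1" using n by (auto simp: r_def)
  have rn: "r ^ n = exp (- 1)"
    using n by (simp add: r_def exp_of_nat_mult[symmetric])
  let ?f = "\<lambda>t. norm (G n (of_real r * cis t) - G n (of_real r * cis (t + pi / n)))"
  have contG: "continuous_on (ball 0 1) (G n)"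
    using G_holomorphic by (rule blinfun_holomorphic_on_imp_continuous_on)
  have cont: "continuous_on {-pi..pi} ?f"
    using r by (intro continuous_intros continuous_on_compose2[OF contG]) (auto simp: norm_mult)
  have "2 * pi * r ^ n * norm (complexify (A n n)) \<le> integral {-pi..pi} ?f"
    by (rule holomorphic_coefficient_bound[OF G_holomorphic _ K r n, where \<eta> = "1/2"]) auto
  moreover have "2 * pi * exp (- 1) * norm (A n n) \<le> 2 * pi * r ^ n * norm (complexify (A n n))"
    unfolding rn by (intro mult_left_mono norm_le_complexify) auto
  moreover have "integral {-pi..pi} ?f = integral {- pi * n..pi * n} (w n)"
  proof -
    have "(?f has_integral integral {-pi..pi} ?f) {-pi..pi}"
      by (rule integrable_integral[OF integrable_continuous_interval[OF cont]])
    from has_integral_stretch_real[OF this, of "1 / real n"]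
    have "((\<lambda>x. ?f (x / n)) has_integral n * integral {-pi..pi} ?f) ((\<lambda>x. x * n) ` {-pi..pi})"
      using n by simp
    moreover have "(\<lambda>x. x * real n) ` {-pi..pi} = {- pi * n..pi * n}"
      using n by (subst image_mult_atLeastAtMost_if') auto
    ultimately have "((\<lambda>x. ?f (x / n)) has_integral n * integral {-pi..pi} ?f) {- pi * n..pi * n}"
      by simp
    from has_integral_mult_right[OF this, of "1 / n"]
    have "((\<lambda>x. 1 / n * ?f (x / n)) has_integral integral {-pi..pi} ?f) {- pi * n..pi * n}"
      using n by simp
    moreover have "(\<lambda>x. 1 / n * ?f (x / n)) = w n"
      by (simp add: w_def circ_def r_def fun_eq_iff add_divide_distrib)
    ultimately show ?thesis by (simp add: integral_unique)
  qed
  ultimately show ?thesis by linarith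
qed

lemma w_continuous: "continuous_on UNIV (w n)"
proof (cases "n = 0")
  case True
  then show ?thesis by (simp add: w_def)
next
  case False
  have "continuous_on (ball 0 1) (G n)"
    using G_holomorphic by (rule blinfun_holomorphic_on_imp_continuous_on)
  moreover have "continuous_on UNIV (circ n)"
    unfolding circ_def using False by (intro continuous_intros) auto
  ultimately have G: "continuous_on UNIV (\<lambda>x. G n (circ n x))"
    by (rule continuous_on_compose2) (use False norm_circ in auto)
  have "continuous_on UNIV (\<lambda>x. G n (circ n (x + pi)))"
    by (rule continuous_on_compose2[OF G]) (auto intro!: continuous_intros)
  with G show ?thesis
    unfolding w_def using False by (intro continuous_intros) auto
qed


lemma circ_distance:
  assumes "n > 0" "\<bar>x\<bar> \<le> 3 / 2 * pi * n"
  shows "(1 + \<bar>x\<bar>) / 24 \<le> n * norm (1 - circ n x)"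
  using circle_point_distance[OF assms] by (simp add: circ_def)

lemma norm_circ_diff:
  assumes "n > 0"
  shows "norm (circ n x - circ n (x + pi)) \<le> pi / n"
proof -
  have "circ n x - circ n (x + pi) = circ n x * (1 - cis (pi / n))"
    by (simp add: circ_def cis_mult[symmetric] add_divide_distrib algebra_simps)
  then have "norm (circ n x - circ n (x + pi)) = norm (circ n x) * norm (1 - cis (pi / n))"
    by (simp add: norm_mult)
  also have "\<dots> \<le> 1 * \<bar>pi / n\<bar>"
  proof (intro mult_mono)
    show "norm (circ n x) \<le> 1" using norm_circ[OF assms, of x] by simp
    show "norm (1 - cis (pi / n)) \<le> \<bar>pi / n\<bar>"
    proof (rule power2_le_imp_le)
      have "cos (2 * (pi / n / 2)) = 1 - 2 * (sin (pi / n / 2))\<^sup>2"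
        by (rule cos_double_sin)
      then have c: "cos (pi / n) = 1 - 2 * (sin (pi / n / 2))\<^sup>2" by simp
      have "(norm (1 - cis (pi / n)))\<^sup>2 = (1 - cos (pi / n))\<^sup>2 + (sin (pi / n))\<^sup>2"
        by (simp add: cmod_power2)
      also have "\<dots> = 2 - 2 * cos (pi / n)"
        by (simp add: sin_squared_eq power2_eq_square algebra_simps)
      also have "\<dots> = 4 * (sin (pi / n / 2))\<^sup>2"
        unfolding c by simp
      also have "\<dots> \<le> 4 * \<bar>pi / n / 2\<bar>\<^sup>2"
        by (intro mult_left_mono) (simp_all only: power2_abs abs_le_square_iff[symmetric] abs_sin_x_le_abs_x zero_le_numeral)
      finally show "(norm (1 - cis (pi / n)))\<^sup>2 \<le> \<bar>pi / n\<bar>\<^sup>2"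
        by (simp add: power_divide)
    qed simp
  qed auto
  finally show ?thesis by simp
qed

text \<open>Both \<open>T\<close> and \<open>g\<close> are inverses, so their increments are products of two inverses with the increment of the inverted function. At scale \<open>1/n\<close> each
inverse contributes a factor \<open>(1 + |x|)\<^sup>\<gamma>\<^sup>-\<^sup>1\<close>, while the increments of \<open>1 - R(z)\<close> and of \<open>(1 - z)\<^sup>1\<^sup>-\<^sup>\<alpha>\<close> between the points of
a pair are of order \<open>M n / n\<close> and \<open>n\<^sup>\<alpha>\<^sup>-\<^sup>1\<close>, uniformly in \<open>x\<close>.\<close>

lemma w_dominated:
  "\<exists>K. \<forall>n>1. \<forall>x. \<bar>x\<bar> \<le> pi * n \<longrightarrow> \<bar>w n x\<bar> \<le> K * (1 + \<bar>x\<bar>) powr (2 * \<gamma> - 2)"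
proof -
  obtain K where K: "K > 0" "\<And>n z. n > 0 \<Longrightarrow> norm z < 1 \<Longrightarrow> 1 / 120 \<le> n * norm (1 - z) \<Longrightarrow>
    norm (T z) \<le> K * (n / M n) * (n * norm (1 - z)) powr (\<gamma> - 1)"
    using T_bound[of "1 / 120"] by auto
  have "(\<lambda>n. (\<Sum>k<n. model \<alpha> k) / real n powr \<alpha>) \<longlonglongrightarrow> 1 / \<kappa>"
    by (rule sum_model_asymptotics[OF \<alpha>(1)])
  then have "Bseq (\<lambda>n. (\<Sum>k<n. model \<alpha> k) / real n powr \<alpha>)"
    by (intro convergent_imp_Bseq convergentI)
  then obtain D where D: "D > 0" "\<And>n. \<bar>(\<Sum>k<n. model \<alpha> k) / real n powr \<alpha>\<bar> \<le> D"
    unfolding Bseq_def by auto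
  define K1 where "K1 = (K * 120 powr (1 - \<gamma>))\<^sup>2 * (2 * C * pi)"
  define K2 where "K2 = (120 powr (1 - \<alpha>))\<^sup>2 * (2 * norm Pc * pi * D / \<kappa>)"
  show ?thesis
  proof (intro exI[of _ "K1 + K2"] allI impI)
    fix n :: nat and x :: real assume n: "n > 1" and x: "\<bar>x\<bar> \<le> pi * n"
    define y where "y = 1 + \<bar>x\<bar>"
    have y: "y \<ge> 1" by (simp add: y_def)
    let ?z = "circ n x" and ?z' = "circ n (x + pi)"
    have n0: "n > 0" using n by simp
    have z: "norm ?z < 1" "norm ?z' < 1" using norm_circ[OF n0] by auto
    have Mn: "M n > 0" using M_ge_1[OF n0] by simp
    have "\<bar>x\<bar> \<le> 3 / 2 * pi * n"
      using x pi_gt_zero mult_nonneg_nonneg[of pi "real n"] by simp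
    then have X1: "y / 120 \<le> n * norm (1 - ?z)"
      using circ_distance[OF n0, of x] y by (simp add: y_def)
    \<comment> \<open>the turned point may leave the half circle; \<open>n > 1\<close> keeps its angle below \<open>3\<pi>/2\<close>, and \<open>1 + |x|\<close> changes at most by a factor \<open>5\<close>, hence the constant \<open>120 = 24 * 5\<close>\<close>
    have "\<bar>x + pi\<bar> \<le> pi * n + pi"
      using x abs_triangle_ineq[of x pi] by simp
    also have "\<dots> \<le> pi * n + pi * (n / 2)"
      using n by (intro add_left_mono) simp
    finally have "\<bar>x + pi\<bar> \<le> 3 / 2 * pi * n" by simp
    from circ_distance[OF n0 this] have "(1 + \<bar>x + pi\<bar>) / 24 \<le> n * norm (1 - ?z')" .
    moreover have "y \<le> 5 * (1 + \<bar>x + pi\<bar>)"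
    proof -
      have "\<bar>x\<bar> \<le> \<bar>x + pi\<bar> + pi"
        using abs_triangle_ineq4[of "x + pi" pi] by simp
      also have "\<dots> \<le> 5 * \<bar>x + pi\<bar> + 4"
        using pi_less_4 by (intro add_mono) auto
      finally show ?thesis by (simp add: y_def)
    qed
    ultimately have X2: "y / 120 \<le> n * norm (1 - ?z')" by linarith
    have pw: "X powr (s - 1) \<le> 120 powr (1 - s) * y powr (s - 1)" if "y / 120 \<le> X" "s < 1" for X s
    proof -
      have "X powr (s - 1) \<le> (y / 120) powr (s - 1)"
        using that y by (intro powr_mono2') auto
      also have "\<dots> = 120 powr (1 - s) * y powr (s - 1)"
        using y powr_minus_divide[of 120 "s - 1"] by (simp only: powr_divide minus_diff_eq) simp
      finally show ?thesis .
    qed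
    have y2: "y powr (\<gamma> - 1) * y powr (\<gamma> - 1) = y powr (2 * \<gamma> - 2)"
      by (simp add: powr_add[symmetric])
    have T: "norm (T ?z) \<le> (n / M n) * (K * 120 powr (1 - \<gamma>) * y powr (\<gamma> - 1))"
      "norm (T ?z') \<le> (n / M n) * (K * 120 powr (1 - \<gamma>) * y powr (\<gamma> - 1))"
    proof -
      have Tv: "norm (T v) \<le> (n / M n) * (K * 120 powr (1 - \<gamma>) * y powr (\<gamma> - 1))" if v: "norm v < 1" "y / 120 \<le> n * norm (1 - v)" for v
      proof -
        have "norm (T v) \<le> K * (n / M n) * (n * norm (1 - v)) powr (\<gamma> - 1)"
          using v y by (intro K(2) n0) auto
        also have "\<dots> \<le> K * (n / M n) * (120 powr (1 - \<gamma>) * y powr (\<gamma> - 1))"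
          using K(1) Mn v \<gamma> by (intro mult_left_mono pw) auto
        finally show ?thesis by (simp add: mult_ac)
      qed
      show "norm (T ?z) \<le> (n / M n) * (K * 120 powr (1 - \<gamma>) * y powr (\<gamma> - 1))"
        by (rule Tv[OF z(1) X1])
      show "norm (T ?z') \<le> (n / M n) * (K * 120 powr (1 - \<gamma>) * y powr (\<gamma> - 1))"
        by (rule Tv[OF z(2) X2])
    qed
    have Tdiff: "norm (M n *\<^sub>R (T ?z - T ?z')) / n \<le> K1 * y powr (2 * \<gamma> - 2)"
    proof -
      let ?t = "(n / M n) * (K * 120 powr (1 - \<gamma>) * y powr (\<gamma> - 1))"
      have t: "0 \<le> ?t" using K(1) Mn by simp
      have "T ?z - T ?z' = T ?z o\<^sub>L ((id_blinfun - R_z Rn ?z') - (id_blinfun - R_z Rn ?z)) o\<^sub>L T ?z'"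
        using z by (intro inverse_blinfun_diff T_inverse) auto
      also have "(id_blinfun - R_z Rn ?z') - (id_blinfun - R_z Rn ?z) = R_z Rn ?z - R_z Rn ?z'"
        by simp
      finally have "norm (T ?z - T ?z') \<le> norm (T ?z o\<^sub>L (R_z Rn ?z - R_z Rn ?z')) * norm (T ?z')"
        by (simp only: norm_blinfun_compose)
      also have "\<dots> \<le> (norm (T ?z) * norm (R_z Rn ?z - R_z Rn ?z')) * norm (T ?z')"
        by (intro mult_right_mono norm_blinfun_compose) simp
      also have "\<dots> \<le> (?t * (2 * C * (pi * M n / n))) * ?t"
        using z C(1) K(1) Mn t norm_circ_diff[OF n0, of x] pi_ge_two
        by (intro mult_mono T R_z_diff_bound n0) auto
      finally have "norm (T ?z - T ?z') \<le> (?t * (2 * C * (pi * M n / n))) * ?t" .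
      then have "M n * norm (T ?z - T ?z') / n \<le> M n * ((?t * (2 * C * (pi * M n / n))) * ?t) / n"
        using Mn by (intro divide_right_mono mult_left_mono) auto
      also have "\<dots> = (K * 120 powr (1 - \<gamma>))\<^sup>2 * (2 * C * pi) * (y powr (\<gamma> - 1) * y powr (\<gamma> - 1))"
        using Mn n0 by (simp add: power2_eq_square field_simps)
      finally show ?thesis
        unfolding y2 K1_def using Mn by simp
    qed
    have gdiff: "norm (cscale (of_real (real n powr \<alpha> / \<kappa>) * (g ?z - g ?z')) o\<^sub>L Pc) / n \<le> K2 * y powr (2 * \<gamma> - 2)"
    proof -
      define \<beta> where "\<beta> = 1 - \<alpha>"
      have inv: "(1 - v) powr of_real \<beta> * g v = 1" if "norm v < 1" for v
      proof -
        have "1 - v \<noteq> 0" using that by auto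
        then show ?thesis by (simp add: g_def \<beta>_def[symmetric] powr_minus)
      qed
      have ng: "norm (g v) = real n powr \<beta> * (n * norm (1 - v)) powr (\<alpha> - 1)" if "norm v < 1" for v
      proof -
        have "norm (g v) = norm (1 - v) powr (- \<beta>)"
          by (simp add: g_def \<beta>_def norm_powr_real_powr')
        also have "\<dots> = real n powr \<beta> * (n * norm (1 - v)) powr (- \<beta>)"
          using n0 by (simp add: powr_mult powr_minus)
        finally show ?thesis by (simp add: \<beta>_def)
      qed
      have ng': "norm (g v) \<le> real n powr \<beta> * (120 powr \<beta> * y powr (\<gamma> - 1))" if "norm v < 1" "y / 120 \<le> n * norm (1 - v)" for v
      proof -
        have "(n * norm (1 - v)) powr (\<alpha> - 1) \<le> 120 powr \<beta> * y powr (\<alpha> - 1)"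
          unfolding \<beta>_def using that \<alpha> by (intro pw) auto
        also have "\<dots> \<le> 120 powr \<beta> * y powr (\<gamma> - 1)"
          using y \<gamma> by (intro mult_left_mono powr_mono) auto
        finally show ?thesis
          unfolding ng[OF that(1)] by (intro mult_left_mono) auto
      qed
      let ?t = "real n powr \<beta> * (120 powr \<beta> * y powr (\<gamma> - 1))"
      let ?m = "\<Sum>k<n. model \<alpha> k"
      have "g ?z - g ?z' = g ?z * ((1 - ?z') powr of_real \<beta> - (1 - ?z) powr of_real \<beta>) * g ?z'"
        using inv[OF z(1)] inv[OF z(2)] by (simp add: algebra_simps)
      then have "norm (g ?z - g ?z') = norm (g ?z) * norm ((1 - ?z) powr of_real \<beta> - (1 - ?z') powr of_real \<beta>) * norm (g ?z')"
        by (simp add: norm_mult norm_minus_commute)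
      also have "\<dots> \<le> ?t * (pi * ?m / n) * ?t"
        unfolding \<beta>_def[symmetric]
        using one_minus_powr_diff_bound[OF \<alpha>(1) _ z n0 norm_circ_diff[OF n0]] \<alpha> z X1 X2
        by (intro mult_mono ng' mult_nonneg_nonneg divide_nonneg_nonneg sum_nonneg) (auto simp: \<beta>_def model_nonneg)
      also have "?m \<le> D * real n powr \<alpha>"
        using D(2)[of n] n0 by (simp add: field_simps abs_le_iff)
      then have "?t * (pi * ?m / n) * ?t \<le> ?t * (pi * (D * real n powr \<alpha>) / n) * ?t"
        by (intro mult_right_mono mult_left_mono divide_right_mono) auto
      finally have gg: "norm (g ?z - g ?z') \<le> ?t * (pi * (D * real n powr \<alpha>) / n) * ?t" .
      have "norm (cscale (of_real (real n powr \<alpha> / \<kappa>) * (g ?z - g ?z')) o\<^sub>L Pc) / n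
          \<le> (2 * norm (of_real (real n powr \<alpha> / \<kappa>) * (g ?z - g ?z')) * norm Pc) / n"
        by (intro divide_right_mono norm_cscale_compose) simp
      also have "\<dots> = (2 * norm Pc * (real n powr \<alpha> / \<kappa>) / n) * norm (g ?z - g ?z')"
        using \<kappa> by (simp add: norm_mult norm_divide)
      also have "\<dots> \<le> (2 * norm Pc * (real n powr \<alpha> / \<kappa>) / n) * (?t * (pi * (D * real n powr \<alpha>) / n) * ?t)"
        using \<kappa> by (intro mult_left_mono gg) auto
      also have "\<dots> = (120 powr \<beta>)\<^sup>2 * (2 * norm Pc * pi * D / \<kappa>) * (y powr (\<gamma> - 1) * y powr (\<gamma> - 1)) * ((real n powr \<alpha> * real n powr \<beta> / n) * (real n powr \<alpha> * real n powr \<beta> / n))"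
        by (simp only: power2_eq_square divide_inverse mult_ac)
      also have "real n powr \<alpha> * real n powr \<beta> / n = 1"
        using n0 by (simp add: powr_add[symmetric] \<beta>_def)
      finally show ?thesis
        unfolding y2 K2_def \<beta>_def by simp
    qed
    have "G n ?z - G n ?z' = M n *\<^sub>R (T ?z - T ?z') - (cscale (of_real (real n powr \<alpha> / \<kappa>) * (g ?z - g ?z')) o\<^sub>L Pc)"
      by (simp add: G_def scaleR_diff_right right_diff_distrib cscale_diff blinfun_compose_simps)
    then have "norm (G n ?z - G n ?z') \<le> norm (M n *\<^sub>R (T ?z - T ?z')) + norm (cscale (of_real (real n powr \<alpha> / \<kappa>) * (g ?z - g ?z')) o\<^sub>L Pc)"
      by (simp only: norm_triangle_ineq4)
    then have "w n x \<le> norm (M n *\<^sub>R (T ?z - T ?z')) / n + norm (cscale (of_real (real n powr \<alpha> / \<kappa>) * (g ?z - g ?z')) o\<^sub>L Pc) / n"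
      unfolding w_def add_divide_distrib[symmetric] by (rule divide_right_mono) simp
    also have "\<dots> \<le> K1 * y powr (2 * \<gamma> - 2) + K2 * y powr (2 * \<gamma> - 2)"
      by (rule add_mono[OF Tdiff gdiff])
    finally show "\<bar>w n x\<bar> \<le> (K1 + K2) * (1 + \<bar>x\<bar>) powr (2 * \<gamma> - 2)"
      by (simp add: y_def w_def distrib_right)
  qed
qed

lemma circ_limit: "(\<lambda>n. of_nat n * (1 - circ n x)) \<longlonglongrightarrow> 1 - \<i> * of_real x"
  using circle_point_limit[of x] by (simp add: circ_def scaleR_conv_of_real)

lemma circ_tendsto_1: "filterlim (\<lambda>n. circ n x) (at 1 within ball 0 1) sequentially"
  unfolding filterlim_at
proof
  have "(\<lambda>n. inverse (of_nat n) * (of_nat n * (1 - circ n x))) \<longlonglongrightarrow> 0 * (1 - \<i> * of_real x)"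
    by (intro tendsto_mult circ_limit lim_inverse_n)
  moreover have "\<forall>\<^sub>F n in sequentially. inverse (of_nat n) * (of_nat n * (1 - circ n x)) = 1 - circ n x"
    using eventually_gt_at_top[of 0] by eventually_elim simp
  ultimately have "(\<lambda>n. 1 - circ n x) \<longlonglongrightarrow> 0"
    by (simp add: filterlim_cong)
  from tendsto_diff[OF tendsto_const this, of 1] show "(\<lambda>n. circ n x) \<longlonglongrightarrow> 1" by simp
  show "\<forall>\<^sub>F n in sequentially. circ n x \<in> ball 0 1 \<and> circ n x \<noteq> 1"
    using eventually_gt_at_top[of 0]
  proof eventually_elim
    case (elim n)
    have "norm (circ n x) < 1" by (rule norm_circ[OF elim])
    then show ?case by auto
  qed
qed

lemma one_minus_i_times: "1 - \<i> * of_real x \<notin> \<real>\<^sub>\<le>\<^sub>0" "1 - \<i> * of_real x \<noteq> (0::complex)" "1 \<le> norm (1 - \<i> * of_real x :: complex)"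
proof -
  show "1 - \<i> * of_real x \<notin> \<real>\<^sub>\<le>\<^sub>0" by (simp add: complex_nonpos_Reals_iff)
  then show "1 - \<i> * of_real x \<noteq> 0" by auto
  show "1 \<le> norm (1 - \<i> * of_real x :: complex)"
    using complex_Re_le_cmod[of "1 - \<i> * of_real x"] by simp
qed

lemma scaled_circ_powr:
  "(\<lambda>n. of_real (real n powr s) * (1 - circ n x) powr of_real s) \<longlonglongrightarrow> (1 - \<i> * of_real x) powr of_real s"
proof -
  have "(\<lambda>n. (of_nat n * (1 - circ n x)) powr of_real s) \<longlonglongrightarrow> (1 - \<i> * of_real x) powr of_real s"
    by (rule tendsto_powr_complex[OF one_minus_i_times(1) circ_limit tendsto_const])
  moreover have "(of_nat n * (1 - circ n x)) powr of_real s = of_real (real n powr s) * (1 - circ n x) powr of_real s" for n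
    using powr_of_real[of "real n" s] by (subst powr_times_real_left) simp_all
  ultimately show ?thesis by simp
qed

text \<open>For fixed \<open>x\<close> the points \<open>circ n x\<close> satisfy \<open>|1 - z| ~ |1 - i x| / n\<close>, so the Abelian theorem applies with a constant \<open>K\<close> depending on \<open>x\<close>.\<close>

lemma gen_circ_limit:
  "(\<lambda>n. gen (circ n x) / of_real (M n)) \<longlonglongrightarrow> of_real \<kappa> * (1 - \<i> * of_real x) powr of_real (- \<alpha>)"
proof -
  let ?\<sigma> = "1 - \<i> * of_real x :: complex"
  let ?m = "\<lambda>n. of_real \<kappa> * (of_real (real n powr - \<alpha>) * (1 - circ n x) powr of_real (- \<alpha>))"
  define K where "K = norm ?\<sigma> + 2"
  have K: "K > 0" by (simp add: K_def add_nonneg_pos)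
  have "(\<lambda>n. norm (of_nat n * (1 - circ n x))) \<longlonglongrightarrow> norm ?\<sigma>"
    by (intro tendsto_norm circ_limit)
  then have "\<forall>\<^sub>F n in sequentially. norm (of_nat n * (1 - circ n x)) < norm ?\<sigma> + 1 \<and> 1 / 2 < norm (of_nat n * (1 - circ n x))"
    using one_minus_i_times(3)[of x] by (intro eventually_conj order_tendstoD) auto
  then have range: "\<forall>\<^sub>F n in sequentially. norm (circ n x) < 1 \<and> 1 / (K * n) \<le> norm (1 - circ n x) \<and> norm (1 - circ n x) \<le> K / n"
    using eventually_gt_at_top[of 0]
  proof eventually_elim
    case (elim n)
    have "1 / K \<le> 1 / 2"
      by (intro divide_left_mono) (auto simp: K_def add_nonneg_pos)
    moreover have "n * norm (1 - circ n x) \<le> K" "1 / 2 < n * norm (1 - circ n x)"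
      using elim by (auto simp: norm_mult K_def)
    ultimately have "1 / K \<le> n * norm (1 - circ n x)" "n * norm (1 - circ n x) \<le> K"
      by linarith+
    then show ?case
      using elim(2) K norm_circ[OF elim(2), of x] by (simp add: field_simps)
  qed
  have "(\<lambda>n. gen (circ n x) / of_real (M n) - ?m n) \<longlonglongrightarrow> 0"
  proof (rule tendstoI)
    fix \<epsilon> :: real assume "\<epsilon> > 0"
    then have "\<epsilon> / 2 > 0" by simp
    have "\<forall>\<^sub>F n in sequentially. \<forall>z. norm z < 1 \<longrightarrow> 1 / (K * n) \<le> norm (1 - z) \<longrightarrow> norm (1 - z) \<le> K / n \<longrightarrow>
     norm (gen z - of_real (\<kappa> * real n powr (- \<alpha>) * M n) * (1 - z) powr (- of_real \<alpha>)) \<le> \<epsilon> / 2 * M n"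
      using \<alpha> p0 by (intro abelian RV K \<open>\<epsilon> / 2 > 0\<close>) auto
    with range show "\<forall>\<^sub>F n in sequentially. dist (gen (circ n x) / of_real (M n) - ?m n) 0 < \<epsilon>"
      using eventually_gt_at_top[of 0]
    proof eventually_elim
      case (elim n)
      have Mn: "M n > 0" using M_ge_1[OF elim(3)] by simp
      have "norm (gen (circ n x) - of_real (\<kappa> * real n powr (- \<alpha>) * M n) * (1 - circ n x) powr (- of_real \<alpha>)) \<le> \<epsilon> / 2 * M n"
        using elim by blast
      moreover have "gen (circ n x) - of_real (\<kappa> * real n powr (- \<alpha>) * M n) * (1 - circ n x) powr (- of_real \<alpha>)
          = of_real (M n) * (gen (circ n x) / of_real (M n) - ?m n)"
        using Mn by (simp add: algebra_simps)
      ultimately have "M n * norm (gen (circ n x) / of_real (M n) - ?m n) \<le> M n * (\<epsilon> / 2)"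
        using Mn by (simp add: norm_mult mult.commute)
      then have "norm (gen (circ n x) / of_real (M n) - ?m n) \<le> \<epsilon> / 2"
        using Mn by simp
      then show ?case
        using \<open>\<epsilon> > 0\<close> by (simp add: dist_norm)
    qed
  qed
  moreover have "?m \<longlonglongrightarrow> of_real \<kappa> * ?\<sigma> powr of_real (- \<alpha>)"
    by (intro tendsto_mult_left scaled_circ_powr)
  ultimately show ?thesis
    using tendsto_add[of "\<lambda>n. gen (circ n x) / of_real (M n) - ?m n" 0 sequentially ?m] by simp
qed

text \<open>Write \<open>M n T(z) / n = (T(z) \<delta>(z)) (M n / (n \<delta>(z)))\<close>. The first factor tends to \<open>P\<close>, the second to \<open>1 / (\<Gamma>(1 + \<alpha>) (1 - i x)\<^sup>1\<^sup>-\<^sup>\<alpha>)\<close>,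
which is exactly the limit of the singular part that \<open>G\<close> subtracts.\<close>

lemma G_circ_limit: "(\<lambda>n. G n (circ n x) /\<^sub>R n) \<longlonglongrightarrow> 0"
proof -
  let ?\<sigma> = "1 - \<i> * of_real x :: complex"
  define Z where "Z n = T (circ n x) o\<^sub>L cscale (\<delta> (circ n x))" for n
  have Z: "Z \<longlonglongrightarrow> Pc"
    unfolding Z_def by (rule filterlim_compose[OF T_asymptotics circ_tendsto_1])
  have lin: "Pc o\<^sub>L cscale c = cscale c o\<^sub>L Pc" for c
    using complex_linear_complexify[of P] by (simp add: complex_linear_def)
  have \<delta>: "(\<lambda>n. of_nat n * \<delta> (circ n x) / of_real (M n)) \<longlonglongrightarrow> of_real \<kappa> * ?\<sigma> powr of_real (1 - \<alpha>)"
  proof -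
    have "(\<lambda>n. (of_nat n * (1 - circ n x)) * (gen (circ n x) / of_real (M n))) \<longlonglongrightarrow> ?\<sigma> * (of_real \<kappa> * ?\<sigma> powr of_real (- \<alpha>))"
      by (intro tendsto_mult circ_limit gen_circ_limit)
    moreover have "?\<sigma> * ?\<sigma> powr of_real (- \<alpha>) = ?\<sigma> powr of_real (1 - \<alpha>)"
      using powr_add[of ?\<sigma> 1 "of_real (- \<alpha>)"] one_minus_i_times(2)[of x] by simp
    ultimately show ?thesis
      by (simp add: \<delta>_def mult_ac)
  qed
  have \<sigma>0: "of_real \<kappa> * ?\<sigma> powr of_real (1 - \<alpha>) \<noteq> 0"
    using \<kappa> one_minus_i_times(2)[of x] by simp
  define c where "c n = 1 / (of_nat n * \<delta> (circ n x) / of_real (M n))" for n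
  have c: "c \<longlonglongrightarrow> 1 / (of_real \<kappa> * ?\<sigma> powr of_real (1 - \<alpha>))"
    unfolding c_def by (intro tendsto_divide tendsto_const \<delta> \<sigma>0)
  have gl: "(\<lambda>n. of_real (1 / \<kappa>) * (of_real (real n powr - (1 - \<alpha>)) * (1 - circ n x) powr of_real (- (1 - \<alpha>)))) \<longlonglongrightarrow> of_real (1 / \<kappa>) * ?\<sigma> powr of_real (- (1 - \<alpha>))"
    by (intro tendsto_mult_left scaled_circ_powr)
  have "(\<lambda>n. (Z n o\<^sub>L cscale (c n)) - (cscale (of_real (1 / \<kappa>) * (of_real (real n powr - (1 - \<alpha>)) * (1 - circ n x) powr of_real (- (1 - \<alpha>)))) o\<^sub>L Pc)) \<longlonglongrightarrow>
      (Pc o\<^sub>L cscale (1 / (of_real \<kappa> * ?\<sigma> powr of_real (1 - \<alpha>)))) - (cscale (of_real (1 / \<kappa>) * ?\<sigma> powr of_real (- (1 - \<alpha>))) o\<^sub>L Pc)"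
    by (intro tendsto_diff bounded_bilinear.tendsto[OF bounded_bilinear_blinfun_compose] Z
        bounded_linear.tendsto[OF bounded_linear_cscale] c gl tendsto_const)
  moreover have "1 / (of_real \<kappa> * ?\<sigma> powr of_real (1 - \<alpha>)) = of_real (1 / \<kappa>) * ?\<sigma> powr of_real (- (1 - \<alpha>))"
    using powr_minus[of ?\<sigma> "of_real (1 - \<alpha>)"] by (simp add: divide_inverse)
  ultimately have lim: "(\<lambda>n. (Z n o\<^sub>L cscale (c n)) - (cscale (of_real (1 / \<kappa>) * (of_real (real n powr - (1 - \<alpha>)) * (1 - circ n x) powr of_real (- (1 - \<alpha>)))) o\<^sub>L Pc)) \<longlonglongrightarrow> 0"
    by (simp only: lin diff_self)
  have "\<forall>\<^sub>F n in sequentially. of_nat n * \<delta> (circ n x) / of_real (M n) \<noteq> 0"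
    by (rule tendsto_imp_eventually_ne[OF \<delta> \<sigma>0])
  then have "\<forall>\<^sub>F n in sequentially. (Z n o\<^sub>L cscale (c n)) - (cscale (of_real (1 / \<kappa>) * (of_real (real n powr - (1 - \<alpha>)) * (1 - circ n x) powr of_real (- (1 - \<alpha>)))) o\<^sub>L Pc) = G n (circ n x) /\<^sub>R n"
    using eventually_gt_at_top[of 0]
  proof eventually_elim
    case (elim n)
    then have d: "\<delta> (circ n x) * c n = of_real (M n / n)"
      by (simp add: c_def)
    have "Z n o\<^sub>L cscale (c n) = T (circ n x) o\<^sub>L cscale (of_real (M n / n))"
      unfolding Z_def blinfun_compose_assoc cscale_mult[symmetric] d ..
    also have "\<dots> = (M n / n) *\<^sub>R T (circ n x)"
      unfolding cscale_of_real by (simp add: blinfun_compose_simps)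
    finally have 1: "Z n o\<^sub>L cscale (c n) = (M n / n) *\<^sub>R T (circ n x)" .
    have "of_real (1 / \<kappa>) * (of_real (real n powr - (1 - \<alpha>)) * (1 - circ n x) powr of_real (- (1 - \<alpha>)))
        = (1 / n) *\<^sub>R (of_real (real n powr \<alpha> / \<kappa>) * g (circ n x))"
      using elim(2) by (simp add: g_def scaleR_conv_of_real powr_diff)
    then show ?case
      by (simp add: 1 G_def cscale_scaleR blinfun_compose_simps scaleR_diff_right divide_inverse mult.commute)
  qed
  with lim show ?thesis
    by (simp add: filterlim_cong)
qed

lemma w_limit: "(\<lambda>n. w n x) \<longlonglongrightarrow> 0"
proof -
  have "(\<lambda>n. G n (circ n x) /\<^sub>R n - G n (circ n (x + pi)) /\<^sub>R n) \<longlonglongrightarrow> 0 - 0"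
    by (intro tendsto_diff G_circ_limit)
  then have "(\<lambda>n. norm (G n (circ n x) /\<^sub>R n - G n (circ n (x + pi)) /\<^sub>R n)) \<longlonglongrightarrow> 0"
    by (simp add: tendsto_norm_zero)
  moreover have "norm (G n (circ n x) /\<^sub>R n - G n (circ n (x + pi)) /\<^sub>R n) = w n x" for n
    by (simp add: w_def scaleR_diff_right[symmetric] divide_inverse mult.commute)
  ultimately show ?thesis by simp
qed

lemma A_tendsto_0: "(\<lambda>n. A n n) \<longlonglongrightarrow> 0"
proof -
  obtain K where K: "\<And>n x. n > 1 \<Longrightarrow> \<bar>x\<bar> \<le> pi * n \<Longrightarrow> \<bar>w n x\<bar> \<le> K * (1 + \<bar>x\<bar>) powr (2 * \<gamma> - 2)"
    using w_dominated by blast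
  have "(\<lambda>n. integral {- pi * n..pi * n} (w n)) \<longlonglongrightarrow> 0"
    by (rule rescaled_circle_integral_tendsto_0[OF w_continuous _ K w_limit]) (use \<gamma> in auto)
  then have lim: "(\<lambda>n. integral {- pi * n..pi * n} (w n) / (2 * pi * exp (- 1))) \<longlonglongrightarrow> 0"
    by (rule tendsto_divide_zero)
  show ?thesis
  proof (rule Lim_null_comparison[OF _ lim])
    show "\<forall>\<^sub>F n in sequentially. norm (A n n) \<le> integral {- pi * n..pi * n} (w n) / (2 * pi * exp (- 1))"
      using eventually_gt_at_top[of 0]
      by eventually_elim (use coefficient_le_integral in \<open>simp add: field_simps\<close>)
  qed
qed

theorem renewal_asymptotics:
  "(\<lambda>n. M n *\<^sub>R renewal_sequence Rn n) \<longlonglongrightarrow> (1 / (Gamma (1 - \<alpha>) * Gamma (1 + \<alpha>))) *\<^sub>R P"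
proof -
  have "(\<lambda>n. model (1 - \<alpha>) n * real n powr (1 - (1 - \<alpha>))) \<longlonglongrightarrow> 1 / Gamma (1 - \<alpha>)"
    using \<alpha> by (intro model_asymptotics) simp
  then have "(\<lambda>n. (1 / \<kappa> * (model (1 - \<alpha>) n * real n powr (1 - (1 - \<alpha>)))) *\<^sub>R P) \<longlonglongrightarrow> (1 / \<kappa> * (1 / Gamma (1 - \<alpha>))) *\<^sub>R P"
    by (intro tendsto_intros)
  from tendsto_add[OF A_tendsto_0 this]
  show ?thesis
    by (simp add: A_def mult_ac)
qed

end

section \<open>First returns\<close>

locale first_return =
  fixes M :: "'a measure" and f :: "'a \<Rightarrow> 'a" and Y :: "'a set"
  assumes preserving: "measure_preserving_map M f"
    and conservative: "conservative M f"
    and Y: "Y \<in> sets M" "emeasure M Y = 1"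
begin

abbreviation "N \<equiv> restrict_space M Y"
abbreviation "\<phi> \<equiv> return_time f Y"
abbreviation "F \<equiv> return_map f Y"

lemma f_measurable [measurable]: "f \<in> measurable M M" and distr_f: "distr M M f = M"
  using preserving by (auto simp: measure_preserving_map_def)

lemma funpow_measurable [measurable]: "f ^^ n \<in> measurable M M"
  by (induction n) (auto intro: measurable_comp)

lemma Y_subset: "Y \<subseteq> space M"
  using Y(1) by (rule sets.sets_into_space)

lemma space_N [simp]: "space N = Y"
  using Y_subset by (auto simp: space_restrict_space)

lemma sets_N: "A \<in> sets N \<longleftrightarrow> A \<in> sets M \<and> A \<subseteq> Y"
  using Y by (auto simp: sets_restrict_space_iff Int_absorb2[OF Y_subset])

sublocale N: prob_space N
  by standard (use Y Y_subset in \<open>simp add: emeasure_restrict_space Int_absorb2\<close>)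

lemma finite_measure_Y: "A \<subseteq> Y \<Longrightarrow> emeasure M A \<noteq> \<infinity>"
  using emeasure_mono[of A Y M] Y by (metis ennreal_one_less_top infinity_ennreal_def leD order_le_less_trans)

lemma measure_N: "A \<in> sets N \<Longrightarrow> measure N A = measure M A"
  using Y Y_subset by (intro measure_restrict_space) (auto simp: sets_N)

lemma return_time_eq_0_iff: "\<phi> y = 0 \<longleftrightarrow> (\<forall>n\<ge>1. (f ^^ n) y \<notin> Y)"
proof (cases "\<exists>n\<ge>1. (f ^^ n) y \<in> Y")
  case True
  have "Inf {n. n \<ge> 1 \<and> (f ^^ n) y \<in> Y} \<in> {n. n \<ge> 1 \<and> (f ^^ n) y \<in> Y}"
    using True by (intro Inf_nat_def1) auto
  moreover have "\<phi> y = Inf {n. n \<ge> 1 \<and> (f ^^ n) y \<in> Y}"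
    using True by (simp add: return_time_def)
  ultimately have "\<phi> y \<ge> 1" by simp
  with True show ?thesis by auto
next
  case False
  then show ?thesis by (auto simp: return_time_def)
qed

lemma return_time_eq_Suc_iff:
  "\<phi> y = Suc n \<longleftrightarrow> (f ^^ Suc n) y \<in> Y \<and> (\<forall>k<n. (f ^^ Suc k) y \<notin> Y)"
proof -
  let ?S = "{n. n \<ge> 1 \<and> (f ^^ n) y \<in> Y}"
  show ?thesis
  proof (cases "?S = {}")
    case True
    then have "\<forall>n\<ge>1. (f ^^ n) y \<notin> Y" by blast
    then have "\<phi> y = 0" "(f ^^ Suc n) y \<notin> Y"
      unfolding return_time_eq_0_iff by (blast, metis le_add1 plus_1_eq_Suc)
    then show ?thesis by (simp del: funpow.simps)
  next
    case False
    then have eq: "\<phi> y = Inf ?S"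
      by (auto simp: return_time_def)
    show ?thesis
    proof
      assume a: "\<phi> y = Suc n"
      have "Suc n \<in> ?S"
        using Inf_nat_def1[OF False] a eq by simp
      moreover have "Suc k \<notin> ?S" if "k < n" for k
        using cInf_lower[of "Suc k" ?S] that a eq by auto
      ultimately show "(f ^^ Suc n) y \<in> Y \<and> (\<forall>k<n. (f ^^ Suc k) y \<notin> Y)" by simp
    next
      assume a: "(f ^^ Suc n) y \<in> Y \<and> (\<forall>k<n. (f ^^ Suc k) y \<notin> Y)"
      have "Suc n \<le> k" if "k \<in> ?S" for k
      proof (rule ccontr)
        assume "\<not> Suc n \<le> k"
        with that obtain k' where "k = Suc k'" "k' < n"
          by (cases k) auto
        with a that show False by auto
      qed
      with a show "\<phi> y = Suc n"
        unfolding eq by (intro cInf_eq_minimum) auto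
    qed
  qed
qed

lemma vimage_funpow_sets [measurable]: "A \<in> sets M \<Longrightarrow> (f ^^ n) -` A \<inter> space M \<in> sets M"
  by (rule measurable_sets[OF funpow_measurable])

lemma level_set: "{y \<in> Y. \<phi> y = n} \<in> sets M"
proof (cases n)
  case 0
  have "{y \<in> Y. \<phi> y = 0} = Y - (\<Union>n\<in>{1..}. (f ^^ n) -` Y \<inter> space M)"
    using Y_subset by (auto simp: return_time_eq_0_iff)
  also have "\<dots> \<in> sets M"
    using Y by (intro sets.Diff sets.countable_UN') (auto intro: vimage_funpow_sets)
  finally show ?thesis using 0 by simp
next
  case (Suc m)
  have "{y \<in> Y. \<phi> y = Suc m} = (Y \<inter> ((f ^^ Suc m) -` Y \<inter> space M)) - (\<Union>k\<in>{..<m}. (f ^^ Suc k) -` Y \<inter> space M)"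
    using Y_subset by (auto simp: return_time_eq_Suc_iff)
  also have "\<dots> \<in> sets M"
    using vimage_funpow_sets[OF Y(1)] by (intro sets.Diff sets.Int[OF Y(1)] sets.countable_UN'') (simp_all del: funpow.simps)
  finally show ?thesis using Suc by simp
qed

lemma return_time_measurable [measurable]: "\<phi> \<in> measurable N (count_space UNIV)"
proof (rule measurable_count_space_eq_countable[THEN iffD2])
  show "\<phi> \<in> space N \<rightarrow> UNIV \<and> (\<forall>a\<in>UNIV. \<phi> -` {a} \<inter> space N \<in> sets N)"
    using level_set by (auto simp: sets_N vimage_def Int_def conj_commute)
qed simp

lemma return_map_in_Y: "y \<in> Y \<Longrightarrow> F y \<in> Y"
  using return_time_eq_Suc_iff[of y "\<phi> y - 1"] by (cases "\<phi> y") (auto simp: return_map_def)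

lemma funpow_measurable_N [measurable]: "f ^^ n \<in> measurable N M"
  by (rule measurable_restrict_space1) simp

lemma return_map_measurable [measurable]: "F \<in> measurable N N"
proof (rule measurable_restrict_space2)
  show "F \<in> measurable N M"
    unfolding return_map_def by (rule measurable_compose_countable) measurable
qed (auto simp: return_map_in_Y)

text \<open>The set of points that never return is wandering.\<close>

lemma never_return_null: "{y \<in> Y. \<phi> y = 0} \<in> null_sets M"
proof -
  have "wandering M f {y \<in> Y. \<phi> y = 0}"
    unfolding wandering_def
  proof
    show "disjoint_family (\<lambda>n. (f ^^ n) -` {y \<in> Y. \<phi> y = 0} \<inter> space M)"
      unfolding disjoint_family_on_def
    proof (intro ballI impI)
      have "False" if "m < n" "(f ^^ m) x \<in> {y \<in> Y. \<phi> y = 0}" "(f ^^ n) x \<in> Y" for m n x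
      proof -
        have "(f ^^ (n - m)) ((f ^^ m) x) = (f ^^ n) x"
          using that(1) by (simp flip: funpow_add[THEN fun_cong, unfolded o_apply])
        moreover have "n - m \<ge> 1" using that(1) by simp
        ultimately show False
          using that return_time_eq_0_iff[of "(f ^^ m) x"] by auto
      qed
      then show "((f ^^ m) -` {y \<in> Y. \<phi> y = 0} \<inter> space M) \<inter> ((f ^^ n) -` {y \<in> Y. \<phi> y = 0} \<inter> space M) = {}"
        if "m \<noteq> n" for m n :: nat
        using that by (cases "m < n") (auto, metis linorder_neqE_nat)
    qed
  qed (rule level_set)
  then show ?thesis
    using conservative by (simp add: conservative_def)
qed

lemma AE_returns: "AE y in N. \<phi> y \<noteq> 0"
proof (rule AE_I')
  show "{y \<in> Y. \<phi> y = 0} \<in> null_sets N"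
    using never_return_null Y Y_subset by (simp add: null_sets_restrict_space)
qed auto

lemma measure_vimage_f:
  assumes "A \<in> sets M"
  shows "measure M (f -` A \<inter> space M) = measure M A"
  using measure_distr[OF f_measurable assms] by (simp add: distr_f)

lemma emeasure_vimage_funpow:
  assumes "A \<in> sets M"
  shows "emeasure M ((f ^^ n) -` A \<inter> space M) = emeasure M A"
proof (induction n)
  case 0
  then show ?case using sets.sets_into_space[OF assms] by (simp add: Int_absorb2)
next
  case (Suc n)
  have eq: "(f ^^ Suc n) -` A \<inter> space M = f -` ((f ^^ n) -` A \<inter> space M) \<inter> space M"
    using measurable_space[OF f_measurable] by (auto simp: funpow_Suc_right simp del: funpow.simps)
  show ?case
    unfolding eq using emeasure_distr[OF f_measurable vimage_funpow_sets[OF assms, of n]] Suc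
    by (simp add: distr_f del: vimage_Int)
qed

text \<open>Pull \<open>A\<close> back under \<open>f\<close> step by step. At each step, the points that lie in \<open>Y\<close> are those that reach \<open>A\<close> by their first return;
the last term consists of the points outside \<open>Y\<close> that are still on their way to \<open>A\<close>.\<close>

lemma measure_return_decomposition:
  assumes A: "A \<in> sets M" "A \<subseteq> Y"
  shows "measure M A = (\<Sum>j<n. measure M {y \<in> Y. \<phi> y = Suc j \<and> F y \<in> A})
      + measure M {x \<in> space M. (\<forall>k<n. (f ^^ k) x \<notin> Y) \<and> (f ^^ n) x \<in> A}"
proof (induction n)
  case 0
  have "{x \<in> space M. x \<in> A} = A"
    using sets.sets_into_space[OF A(1)] by auto
  then show ?case by simp
next
  case (Suc n)
  let ?B = "\<lambda>n. {x \<in> space M. (\<forall>k<n. (f ^^ k) x \<notin> Y) \<and> (f ^^ n) x \<in> A}"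
  let ?D = "{y \<in> Y. \<phi> y = Suc n \<and> F y \<in> A}"
  have B: "?B n \<in> sets M" for n
  proof -
    have "?B n = ((f ^^ n) -` A \<inter> space M) - (\<Union>k\<in>{..<n}. (f ^^ k) -` Y \<inter> space M)"
      by auto
    also have "\<dots> \<in> sets M"
      using A Y by (intro sets.Diff sets.countable_UN') (auto intro: vimage_funpow_sets)
    finally show ?thesis .
  qed
  have fin: "emeasure M (?B n) \<noteq> \<infinity>" for n
  proof -
    have "emeasure M (?B n) \<le> emeasure M ((f ^^ n) -` A \<inter> space M)"
      using A by (intro emeasure_mono) (auto intro: vimage_funpow_sets)
    also have "\<dots> = emeasure M A"
      by (rule emeasure_vimage_funpow[OF A(1)])
    finally show ?thesis
      using finite_measure_Y[OF A(2)] by (auto simp: top_unique)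
  qed
  have D: "?D \<in> sets M"
  proof -
    have "?D = {y \<in> Y. \<phi> y = Suc n} \<inter> (F -` A \<inter> space N)" by auto
    moreover have "F -` A \<inter> space N \<in> sets N"
      using A by (intro measurable_sets[OF return_map_measurable]) (simp add: sets_N)
    ultimately show ?thesis
      using level_set by (auto simp: sets_N)
  qed
  have split: "f -` ?B n \<inter> space M = ?D \<union> ?B (Suc n)"
  proof (intro set_eqI iffI)
    fix x assume x: "x \<in> f -` ?B n \<inter> space M"
    then have x': "x \<in> space M" "\<forall>k<n. (f ^^ Suc k) x \<notin> Y" "(f ^^ Suc n) x \<in> A"
      by (auto simp: funpow_Suc_right simp del: funpow.simps)
    show "x \<in> ?D \<union> ?B (Suc n)"
    proof (cases "x \<in> Y")
      case True
      then have "\<phi> x = Suc n"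
        using x' A by (auto simp: return_time_eq_Suc_iff simp del: funpow.simps)
      with True x' show ?thesis by (simp add: return_map_def del: funpow.simps)
    next
      case False
      have "(f ^^ k) x \<notin> Y" if "k < Suc n" for k
        using x'(2) False that by (cases k) (auto simp del: funpow.simps(2))
      with x' show ?thesis by (simp del: funpow.simps)
    qed
  next
    fix x assume x: "x \<in> ?D \<union> ?B (Suc n)"
    have "(\<forall>k<n. (f ^^ Suc k) x \<notin> Y) \<and> (f ^^ Suc n) x \<in> A \<and> x \<in> space M"
    proof (cases "x \<in> ?D")
      case True
      then have "\<phi> x = Suc n" "F x = (f ^^ Suc n) x"
        by (auto simp: return_map_def simp del: funpow.simps)
      with True Y_subset show ?thesis
        using return_time_eq_Suc_iff[of x n] by (auto simp del: funpow.simps)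
    next
      case False
      with x show ?thesis by (auto simp del: funpow.simps)
    qed
    then have "\<forall>k<n. (f ^^ Suc k) x \<notin> Y" "(f ^^ Suc n) x \<in> A" "x \<in> space M"
      by blast+
    then show "x \<in> f -` ?B n \<inter> space M"
      using measurable_space[OF f_measurable] by (auto simp: funpow_Suc_right simp del: funpow.simps)
  qed
  have "measure M (?B n) = measure M (f -` ?B n \<inter> space M)"
    by (rule measure_vimage_f[OF B, symmetric])
  also have "\<dots> = measure M ?D + measure M (?B (Suc n))"
    unfolding split
  proof (rule measure_Union)
    show "?D \<inter> ?B (Suc n) = {}"
    proof -
      have "x \<notin> Y" if "x \<in> ?B (Suc n)" for x
        using that by (auto dest: spec[of _ 0])
      then show ?thesis by blast
    qed
    show "emeasure M ?D \<noteq> \<infinity>" by (rule finite_measure_Y) auto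
  qed (rule D B fin)+
  finally show ?case using Suc by simp
qed

lemma sums_measure_return:
  assumes A: "A \<in> sets N"
  shows "(\<lambda>j. measure M {y \<in> Y. \<phi> y = Suc j \<and> F y \<in> A}) sums measure N (F -` A \<inter> Y)"
proof -
  let ?D = "\<lambda>j. {y \<in> Y. \<phi> y = Suc j \<and> F y \<in> A}"
  have FA: "F -` A \<inter> Y \<in> sets N"
    using measurable_sets[OF return_map_measurable A] by simp
  have D: "?D j \<in> sets N" for j
  proof -
    have "?D j = {y \<in> Y. \<phi> y = Suc j} \<inter> (F -` A \<inter> Y)" by auto
    also have "\<dots> \<in> sets N"
      by (rule sets.Int[OF _ FA]) (auto simp: sets_N level_set)
    finally show ?thesis .
  qed
  have "(\<lambda>j. measure N (?D j)) sums measure N (\<Union>j. ?D j)"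
    using D by (intro N.finite_measure_UNION) (auto simp: disjoint_family_on_def)
  moreover have "measure N (\<Union>j. ?D j) = measure N (F -` A \<inter> Y)"
  proof (rule N.finite_measure_eq_AE)
    show "AE y in N. (y \<in> (\<Union>j. ?D j)) = (y \<in> F -` A \<inter> Y)"
      using AE_returns AE_space
      by eventually_elim (auto simp: gr0_conv_Suc)
    show "(\<Union>j. ?D j) \<in> sets N" using D by auto
  qed (rule FA)
  ultimately show ?thesis
    using measure_N[OF D] by simp
qed

text \<open>The level sets of the return time exhaust \<open>Y\<close> up to a null set.\<close>

lemma sums_measure_level: "(\<lambda>j. measure M {y \<in> Y. \<phi> y = Suc j}) sums 1"
proof -
  have "F -` Y \<inter> Y = Y" using return_map_in_Y by auto
  moreover have "{y \<in> Y. \<phi> y = Suc j \<and> F y \<in> Y} = {y \<in> Y. \<phi> y = Suc j}" for j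
    using return_map_in_Y by auto
  ultimately show ?thesis
    using sums_measure_return[of Y] N.prob_space Y by (simp add: sets_N)
qed

lemma measure_tendsto_0_of_le:
  assumes "g \<longlonglongrightarrow> 0" "\<And>n. measure M (B n) \<le> g n"
  shows "(\<lambda>n. measure M (B n)) \<longlonglongrightarrow> 0"
  by (rule Lim_null_comparison[OF _ assms(1)]) (simp add: assms(2))

text \<open>In the decomposition above the remainder vanishes in the limit: it is dominated by the remainder for \<open>A = Y\<close>, which is one
minus the partial sums of a series with sum \<open>1\<close>.\<close>

lemma measure_return_map_vimage:
  assumes A: "A \<in> sets N"
  shows "measure N (F -` A \<inter> Y) = measure N A"
proof -
  let ?D = "\<lambda>j. {y \<in> Y. \<phi> y = Suc j \<and> F y \<in> A}"
  let ?B = "\<lambda>n A. {x \<in> space M. (\<forall>k<n. (f ^^ k) x \<notin> Y) \<and> (f ^^ n) x \<in> A}"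
  have A': "A \<in> sets M" "A \<subseteq> Y" using A by (auto simp: sets_N)
  have "{y \<in> Y. \<phi> y = Suc j \<and> F y \<in> Y} = {y \<in> Y. \<phi> y = Suc j}" for j
    using return_map_in_Y by auto
  then have Y_eq: "measure M (?B n Y) = 1 - (\<Sum>j<n. measure M {y \<in> Y. \<phi> y = Suc j})" for n
    using measure_return_decomposition[of Y n] Y by (simp add: measure_def)
  have "(\<lambda>n. 1 - (\<Sum>j<n. measure M {y \<in> Y. \<phi> y = Suc j})) \<longlonglongrightarrow> 1 - 1"
    by (rule tendsto_diff[OF tendsto_const sums_measure_level[unfolded sums_def]])
  then have "(\<lambda>n. measure M (?B n Y)) \<longlonglongrightarrow> 0"
    by (simp add: Y_eq)
  moreover have "measure M (?B n A) \<le> measure M (?B n Y)" for n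
  proof (rule measure_mono_fmeasurable)
    show "?B n A \<subseteq> ?B n Y" using A' by auto
    have Bs: "?B n A \<in> sets M" if "A \<in> sets M" for A
    proof -
      have "?B n A = ((f ^^ n) -` A \<inter> space M) - (\<Union>k\<in>{..<n}. (f ^^ k) -` Y \<inter> space M)"
        by auto
      also have "\<dots> \<in> sets M"
        using that Y by (intro sets.Diff sets.countable_UN') (auto intro: vimage_funpow_sets)
      finally show ?thesis .
    qed
    show "?B n A \<in> sets M" by (rule Bs[OF A'(1)])
    have "emeasure M (?B n Y) \<le> emeasure M ((f ^^ n) -` Y \<inter> space M)"
      using Y by (intro emeasure_mono) (auto intro: vimage_funpow_sets)
    also have "\<dots> = 1"
      using emeasure_vimage_funpow[OF Y(1)] Y by simp
    finally have "emeasure M (?B n Y) < \<infinity>"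
      by (simp add: order_le_less_trans)
    then show "?B n Y \<in> fmeasurable M"
      using Bs[OF Y(1)] by (rule fmeasurableI[rotated])
  qed
  ultimately have "(\<lambda>n. measure M (?B n A)) \<longlonglongrightarrow> 0"
    by (rule measure_tendsto_0_of_le)
  then have "(\<lambda>n. measure M A - measure M (?B n A)) \<longlonglongrightarrow> measure M A - 0"
    by (intro tendsto_intros)
  moreover have "measure M A - measure M (?B n A) = (\<Sum>j<n. measure M (?D j))" for n
    using measure_return_decomposition[OF A', of n] by simp
  ultimately have "(\<lambda>j. measure M (?D j)) sums measure M A"
    by (simp add: sums_def)
  from sums_unique2[OF sums_measure_return[OF A] this] show ?thesis
    by (simp only: measure_N[OF A])
qed

lemma distr_return_map: "distr N N F = N"
proof (rule measure_eqI)
  fix A assume "A \<in> sets (distr N N F)"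
  then have A: "A \<in> sets N" by simp
  then show "emeasure (distr N N F) A = emeasure N A"
    using measure_return_map_vimage[OF A]
    by (simp add: emeasure_distr N.emeasure_eq_measure)
qed simp

end

section \<open>The renewal equation for the transfer operators\<close>

locale operator_renewal = first_return M f Y
  for M :: "'a measure" and f Y +
  fixes L R :: "('a \<Rightarrow> real) \<Rightarrow> ('a \<Rightarrow> real)" and \<iota> :: "'b::banach \<Rightarrow> 'a \<Rightarrow> real"
    and Rn :: "nat \<Rightarrow> 'b \<Rightarrow>\<^sub>L 'b"
  assumes L: "transfer_operator M f L"
    and R: "transfer_operator N F R"
    and B: "banach_function_space N \<iota>"
    and Rn: "\<And>n. n \<ge> 1 \<Longrightarrow> induces N \<iota> (\<lambda>v. R (\<lambda>y. indicator {y. \<phi> y = n} y * v y)) (Rn n)"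
    and H1: "\<exists>C>0. \<forall>n\<ge>1. norm (Rn n) \<le> C * measure M {y \<in> Y. \<phi> y = n}"
begin

lemma \<iota>_measurable [measurable]: "\<iota> v \<in> borel_measurable N"
  using B by (simp add: banach_function_space_def)

lemma prob_Y: "measure N Y = 1"
  using N.prob_space by simp

lemma \<iota>_add: "AE y in N. \<iota> (u + v) y = \<iota> u y + \<iota> v y"
  using B by (simp add: banach_function_space_def)

lemma \<iota>_scale: "AE y in N. \<iota> (c *\<^sub>R v) y = c * \<iota> v y"
  using B by (simp add: banach_function_space_def)

lemma \<iota>_bound: "AE y in N. \<bar>\<iota> v y\<bar> \<le> norm v"
proof -
  have "AE y in N. ereal \<bar>\<iota> v y\<bar> \<le> esssup N (\<lambda>y. ereal \<bar>\<iota> v y\<bar>)"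
    by (rule esssup_AE)
  then have "AE y in N. ereal \<bar>\<iota> v y\<bar> \<le> ereal (norm v)"
  proof (rule eventually_mono)
    fix y assume "ereal \<bar>\<iota> v y\<bar> \<le> esssup N (\<lambda>y. ereal \<bar>\<iota> v y\<bar>)"
    also have "\<dots> \<le> ereal (norm v)"
      using B by (simp add: banach_function_space_def)
    finally show "ereal \<bar>\<iota> v y\<bar> \<le> ereal (norm v)" .
  qed
  then show ?thesis by simp
qed

lemma \<iota>_integrable: "integrable N (\<iota> v)"
  using \<iota>_bound by (intro N.integrable_const_bound[where B = "norm v"]) auto

lemma integrable_mult_bounded:
  assumes "integrable N u" "w \<in> borel_measurable N" "\<And>y. y \<in> Y \<Longrightarrow> \<bar>w y\<bar> \<le> K"
  shows "integrable N (\<lambda>y. u y * w y :: real)"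
proof (rule Bochner_Integration.integrable_bound)
  show "integrable N (\<lambda>y. K * u y)" using assms(1) by simp
  have "norm (u y * w y) \<le> norm (K * u y)" if "y \<in> Y" for y
  proof -
    have "\<bar>u y\<bar> * \<bar>w y\<bar> \<le> \<bar>u y\<bar> * \<bar>K\<bar>"
      using assms(3)[OF that] by (intro mult_left_mono) auto
    then show ?thesis by (simp add: abs_mult mult.commute)
  qed
  then show "AE y in N. norm (u y * w y) \<le> norm (K * u y)"
    by (intro AE_I2) simp
qed (use assms in measurable)

lemma bounded_linear_integral:
  assumes w: "w \<in> borel_measurable N" "\<And>y. y \<in> Y \<Longrightarrow> \<bar>w y\<bar> \<le> 1"
  shows "bounded_linear (\<lambda>v. \<integral>y. \<iota> v y * w y \<partial>N)"
proof (rule bounded_linear_intro[where K = 1])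
  have int: "integrable N (\<lambda>y. \<iota> v y * w y)" for v
    by (rule integrable_mult_bounded[OF \<iota>_integrable w])
  have m: "(\<lambda>y. \<iota> v y * w y) \<in> borel_measurable N" for v
    using w by measurable
  show "(\<integral>y. \<iota> (u + v) y * w y \<partial>N) = (\<integral>y. \<iota> u y * w y \<partial>N) + (\<integral>y. \<iota> v y * w y \<partial>N)" for u v
  proof -
    have "(\<integral>y. \<iota> (u + v) y * w y \<partial>N) = (\<integral>y. \<iota> u y * w y + \<iota> v y * w y \<partial>N)"
    proof (rule integral_cong_AE)
      show "AE y in N. \<iota> (u + v) y * w y = \<iota> u y * w y + \<iota> v y * w y"
        using \<iota>_add[of u v] by eventually_elim (simp add: algebra_simps)
    qed (use w in measurable)
    then show ?thesis using int by simp
  qed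
  show "(\<integral>y. \<iota> (c *\<^sub>R v) y * w y \<partial>N) = c *\<^sub>R (\<integral>y. \<iota> v y * w y \<partial>N)" for c v
  proof -
    have "(\<integral>y. \<iota> (c *\<^sub>R v) y * w y \<partial>N) = (\<integral>y. c * (\<iota> v y * w y) \<partial>N)"
    proof (rule integral_cong_AE)
      show "AE y in N. \<iota> (c *\<^sub>R v) y * w y = c * (\<iota> v y * w y)"
        using \<iota>_scale[of c v] by eventually_elim simp
    qed (use w in measurable)
    then show ?thesis by simp
  qed
  show "norm (\<integral>y. \<iota> v y * w y \<partial>N) \<le> norm v * 1" for v
  proof -
    have "norm (\<integral>y. \<iota> v y * w y \<partial>N) \<le> (\<integral>y. norm (\<iota> v y * w y) \<partial>N)"
      by (rule integral_norm_bound)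
    also have "\<dots> \<le> (\<integral>y. norm v \<partial>N)"
    proof (rule integral_mono_AE)
      show "AE y in N. norm (\<iota> v y * w y) \<le> norm v"
        using \<iota>_bound[of v] AE_space
      proof eventually_elim
        case (elim y)
        then have "\<bar>\<iota> v y\<bar> * \<bar>w y\<bar> \<le> norm v * 1"
          using w(2)[of y] by (intro mult_mono) auto
        then show ?case by (simp add: abs_mult)
      qed
    qed (use int in auto)
    finally show ?thesis by (simp add: prob_Y)
  qed
qed

text \<open>Testing against indicators of measurable sets determines an integrable function almost everywhere; this is how identities
between transfer operators are proved below.\<close>

lemma AE_eqI:
  assumes "integrable N u" "integrable N v"
    and "\<And>A. A \<in> sets N \<Longrightarrow> (\<integral>y. u y * indicator A y \<partial>N) = (\<integral>y. v y * indicator A y \<partial>N)"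
  shows "AE y in N. u y = (v y :: real)"
  using assms by (intro density_unique_real) (auto simp: set_lebesgue_integral_def mult.commute)

lemma \<iota>_inject:
  assumes "AE y in N. \<iota> u y = \<iota> v y"
  shows "u = v"
proof -
  have "AE y in N. \<iota> (u + (- 1) *\<^sub>R v) y = 0"
    using assms \<iota>_add[of u "(- 1) *\<^sub>R v"] \<iota>_scale[of "- 1" v]
    by eventually_elim simp
  then have "u + (- 1) *\<^sub>R v = 0"
    using B unfolding banach_function_space_def by blast
  then show ?thesis by simp
qed

lemma R_dual:
  assumes "integrable N v" "w \<in> borel_measurable N" "\<And>y. y \<in> Y \<Longrightarrow> \<bar>w y\<bar> \<le> K"
  shows "(\<integral>y. R v y * w y \<partial>N) = (\<integral>y. v y * w (F y) \<partial>N)"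
proof -
  have "\<exists>K. \<forall>x\<in>space N. \<bar>w x\<bar> \<le> K"
    using assms(3) by auto
  with assms(1,2) R show ?thesis
    unfolding transfer_operator_def by blast
qed

lemma Rn_dual:
  assumes "n \<ge> 1" "w \<in> borel_measurable N" "\<And>y. y \<in> Y \<Longrightarrow> \<bar>w y\<bar> \<le> 1"
  shows "(\<integral>y. \<iota> (Rn n v) y * w y \<partial>N) = (\<integral>y. \<iota> v y * (indicator {y. \<phi> y = n} y * w (F y)) \<partial>N)"
proof -
  let ?u = "\<lambda>y. indicator {y. \<phi> y = n} y * \<iota> v y :: real"
  have ind: "indicator {y. \<phi> y = n} \<in> borel_measurable N"
    by measurable
  have u: "integrable N ?u"
    using integrable_mult_bounded[OF \<iota>_integrable ind, of 1 v] by (simp add: mult.commute indicator_def)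
  have Ru: "integrable N (R ?u)"
    using R u unfolding transfer_operator_def by blast
  have AE: "AE y in N. \<iota> (Rn n v) y = R ?u y"
    using Rn[OF assms(1)] unfolding induces_def by blast
  have "(\<integral>y. \<iota> (Rn n v) y * w y \<partial>N) = (\<integral>y. R ?u y * w y \<partial>N)"
  proof (rule integral_cong_AE)
    show "AE y in N. \<iota> (Rn n v) y * w y = R ?u y * w y"
      using AE by eventually_elim simp
    show "(\<lambda>y. R ?u y * w y) \<in> borel_measurable N"
      using Ru assms(2) by (intro borel_measurable_times) auto
  qed (use assms in measurable)
  also have "\<dots> = (\<integral>y. ?u y * w (F y) \<partial>N)"
    by (rule R_dual[OF u assms(2,3)])
  finally show ?thesis by (simp add: mult_ac)
qed

lemma integral_return_map:
  assumes "w \<in> borel_measurable N"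
  shows "(\<integral>y. w (F y) \<partial>N) = (\<integral>y. w y \<partial>N :: real)"
  using integral_distr[OF return_map_measurable assms] by (simp add: distr_return_map)

text \<open>The dual form of the renewal equation. For \<open>y \<in> Y\<close> and \<open>A \<subseteq> Y\<close>, the point \<open>f\<^sup>n y\<close> can lie in \<open>A\<close> only if the first return time
\<open>j\<close> is at most \<open>n\<close>; then \<open>f\<^sup>n y = f\<^sup>n\<^sup>-\<^sup>j (F y)\<close>, and the induction hypothesis applies after the first return.\<close>

lemma renewal_dual:
  assumes A: "A \<in> sets N"
  shows "(\<integral>y. \<iota> (renewal_sequence Rn n v) y * indicator A y \<partial>N) = (\<integral>y. \<iota> v y * indicator A ((f ^^ n) y) \<partial>N)"
proof (induction n arbitrary: v rule: less_induct)
  case (less n)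
  have A': "A \<in> sets M" "A \<subseteq> Y" using A by (auto simp: sets_N)
  have ind: "(\<lambda>y. indicator A ((f ^^ k) y) :: real) \<in> borel_measurable N" for k
    using A' by measurable
  show ?case
  proof (cases "n = 0")
    case True
    then show ?thesis by (simp add: renewal_sequence.simps)
  next
    case False
    have point: "indicator A ((f ^^ n) y) =
        (\<Sum>j\<in>{1..n}. indicator {y. \<phi> y = j} y * indicator A ((f ^^ (n - j)) (F y)) :: real)" for y
    proof -
      have "(\<Sum>j\<in>{1..n}. indicator {y. \<phi> y = j} y * indicator A ((f ^^ (n - j)) (F y)) :: real) =
          (\<Sum>j\<in>{1..n}. if j = \<phi> y then indicator A ((f ^^ (n - j)) (F y)) else 0)"
        by (rule sum.cong) (auto simp: indicator_def)
      also have "\<dots> = (if \<phi> y \<in> {1..n} then indicator A ((f ^^ (n - \<phi> y)) (F y)) else 0)"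
        by (simp add: sum.delta)
      also have "\<dots> = indicator A ((f ^^ n) y)"
      proof (cases "\<phi> y \<in> {1..n}")
        case True
        then have "(f ^^ (n - \<phi> y)) (F y) = (f ^^ n) y"
          by (simp add: return_map_def flip: funpow_add[THEN fun_cong, unfolded o_apply])
        with True show ?thesis by simp
      next
        case False2: False
        have "(f ^^ n) y \<notin> Y"
        proof (cases "\<phi> y = 0")
          case True
          with \<open>n \<noteq> 0\<close> show ?thesis using return_time_eq_0_iff[of y] by auto
        next
          case nz: False
          then obtain m where m: "\<phi> y = Suc m" by (cases "\<phi> y") auto
          obtain k where k: "n = Suc k" using \<open>n \<noteq> 0\<close> by (cases n) auto
          have "k < m" using False2 m k by auto
          then show ?thesis using m unfolding return_time_eq_Suc_iff k by blast
        qed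
        with A' False2 show ?thesis by (auto simp: indicator_def)
      qed
      finally show ?thesis by simp
    qed
    have w: "(\<lambda>y. indicator A ((f ^^ k) (F y)) :: real) \<in> borel_measurable N" for k
      using measurable_compose[OF return_map_measurable ind] .
    have int: "integrable N (\<lambda>y. \<iota> v y * (indicator {y. \<phi> y = j} y * indicator A ((f ^^ k) (F y))))" for j k
    proof (rule integrable_mult_bounded[OF \<iota>_integrable])
      show "(\<lambda>y. indicator {y. \<phi> y = j} y * indicator A ((f ^^ k) (F y)) :: real) \<in> borel_measurable N"
        using w[of k] by measurable
      show "\<bar>indicator {y. \<phi> y = j} y * indicator A ((f ^^ k) (F y))\<bar> \<le> (1 :: real)" for y
        by (simp add: indicator_def)
    qed
    have "(\<integral>y. \<iota> v y * indicator A ((f ^^ n) y) \<partial>N) =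
        (\<integral>y. (\<Sum>j\<in>{1..n}. \<iota> v y * (indicator {y. \<phi> y = j} y * indicator A ((f ^^ (n - j)) (F y)))) \<partial>N)"
      by (simp only: point sum_distrib_left)
    also have "\<dots> = (\<Sum>j\<in>{1..n}. \<integral>y. \<iota> v y * (indicator {y. \<phi> y = j} y * indicator A ((f ^^ (n - j)) (F y))) \<partial>N)"
      by (rule Bochner_Integration.integral_sum) (rule int)
    also have "\<dots> = (\<Sum>j\<in>{1..n}. \<integral>y. \<iota> (Rn j v) y * indicator A ((f ^^ (n - j)) y) \<partial>N)"
      by (intro sum.cong refl Rn_dual[symmetric] ind) (auto simp: indicator_def)
    also have "\<dots> = (\<Sum>j\<in>{1..n}. \<integral>y. \<iota> (renewal_sequence Rn (n - j) (Rn j v)) y * indicator A y \<partial>N)"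
      by (intro sum.cong refl less.IH[symmetric]) auto
    also have "\<dots> = (\<integral>y. \<iota> (\<Sum>j\<in>{1..n}. renewal_sequence Rn (n - j) (Rn j v)) y * indicator A y \<partial>N)"
      using A by (intro linear_sum[OF bounded_linear.linear[OF bounded_linear_integral], symmetric]) (auto simp: indicator_def)
    also have "(\<Sum>j\<in>{1..n}. renewal_sequence Rn (n - j) (Rn j v)) = renewal_sequence Rn n v"
      using False by (subst (2) renewal_sequence.simps) (simp add: blinfun.sum_left)
    finally show ?thesis by simp
  qed
qed

lemma integrable_extend:
  assumes "integrable N v"
  shows "integrable M (\<lambda>x. indicator Y x * v x :: real)"
  using assms Y by (subst (asm) integrable_restrict_space) auto

lemma funpow_L:
  assumes "integrable M v"
  shows "integrable M ((L ^^ n) v) \<and> (\<forall>A\<in>sets M. (\<integral>x. (L ^^ n) v x * indicator A x \<partial>M) = (\<integral>x. v x * indicator A ((f ^^ n) x) \<partial>M))"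
proof (induction n)
  case 0
  then show ?case using assms by simp
next
  case (Suc n)
  have i: "integrable M (L ((L ^^ n) v))"
    using Suc L unfolding transfer_operator_def by blast
  have "(\<integral>x. L ((L ^^ n) v) x * indicator A x \<partial>M) = (\<integral>x. v x * indicator A ((f ^^ Suc n) x) \<partial>M)" if A: "A \<in> sets M" for A
  proof -
    have "(\<integral>x. L ((L ^^ n) v) x * indicator A x \<partial>M) = (\<integral>x. (L ^^ n) v x * indicator A (f x) \<partial>M)"
    proof -
      have "\<exists>K. \<forall>x\<in>space M. \<bar>indicator A x\<bar> \<le> (K::real)"
        by (rule exI[of _ 1]) (simp add: indicator_def)
      moreover have "indicator A \<in> borel_measurable M" using A by simp
      ultimately show ?thesis
        using L Suc unfolding transfer_operator_def by blast
    qed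
    also have "\<dots> = (\<integral>x. (L ^^ n) v x * indicator (f -` A \<inter> space M) x \<partial>M)"
      by (rule Bochner_Integration.integral_cong) (auto simp: indicator_def)
    also have "\<dots> = (\<integral>x. v x * indicator (f -` A \<inter> space M) ((f ^^ n) x) \<partial>M)"
      using Suc measurable_sets[OF f_measurable A] by blast
    also have "\<dots> = (\<integral>x. v x * indicator A ((f ^^ Suc n) x) \<partial>M)"
      using measurable_space[OF funpow_measurable, of _ n]
      by (intro Bochner_Integration.integral_cong) (auto simp: indicator_def)
    finally show ?thesis .
  qed
  with i show ?case by simp
qed

lemma renewal_sequence_induces:
  "induces N \<iota> (\<lambda>v x. indicator Y x * (L ^^ n) (\<lambda>x. indicator Y x * v x) x) (renewal_sequence Rn n)"
  unfolding induces_def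
proof
  fix v
  let ?v = "\<lambda>x. indicator Y x * \<iota> v x"
  have v: "integrable M ?v"
    by (rule integrable_extend[OF \<iota>_integrable])
  show "AE y in N. \<iota> (renewal_sequence Rn n v) y = indicator Y y * (L ^^ n) ?v y"
  proof (rule AE_eqI)
    have "integrable M (\<lambda>x. indicator Y x *\<^sub>R (L ^^ n) ?v x)"
      using funpow_L[OF v] Y by (intro integrable_mult_indicator) auto
    then have "integrable N ((L ^^ n) ?v)"
      using Y by (subst integrable_restrict_space) auto
    then show "integrable N (\<lambda>y. indicator Y y * (L ^^ n) ?v y)"
      by (rule Bochner_Integration.integrable_cong[THEN iffD1, rotated 2]) (simp_all add: indicator_def)
  next
    fix A assume A: "A \<in> sets N"
    then have A': "A \<in> sets M" "A \<subseteq> Y" by (auto simp: sets_N)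
    have "(\<integral>y. indicator Y y * (L ^^ n) ?v y * indicator A y \<partial>N) = (\<integral>x. (L ^^ n) ?v x * indicator A x \<partial>M)"
      using Y A'(2) by (subst integral_restrict_space) (auto intro!: Bochner_Integration.integral_cong simp: indicator_def)
    also have "\<dots> = (\<integral>x. ?v x * indicator A ((f ^^ n) x) \<partial>M)"
      using funpow_L[OF v] A' by blast
    also have "\<dots> = (\<integral>y. \<iota> v y * indicator A ((f ^^ n) y) \<partial>N)"
      using Y by (subst integral_restrict_space) (auto intro!: Bochner_Integration.integral_cong)
    finally show "(\<integral>y. \<iota> (renewal_sequence Rn n v) y * indicator A y \<partial>N) = (\<integral>y. indicator Y y * (L ^^ n) ?v y * indicator A y \<partial>N)"
      using renewal_dual[OF A] by simp
  qed (rule \<iota>_integrable)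
qed

section \<open>The invariant functional and the constant function\<close>

definition e :: 'b where "e = (SOME e. AE y in N. \<iota> e y = 1)"

lemma \<iota>_e: "AE y in N. \<iota> e y = 1"
proof -
  have "\<exists>e. AE y in N. \<iota> e y = 1"
    using B unfolding banach_function_space_def by blast
  then show ?thesis
    unfolding e_def by (rule someI_ex)
qed

lift_definition P :: "'b \<Rightarrow>\<^sub>L 'b" is "\<lambda>v. (\<integral>y. \<iota> v y \<partial>N) *\<^sub>R e"
proof -
  have "bounded_linear (\<lambda>v. \<integral>y. \<iota> v y * 1 \<partial>N)"
    by (rule bounded_linear_integral) auto
  then show "bounded_linear (\<lambda>v. (\<integral>y. \<iota> v y \<partial>N) *\<^sub>R e)"
    using bounded_linear_scaleR_left[THEN bounded_linear_compose] by simp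
qed

lemma bounded_linear_mean: "bounded_linear (\<lambda>v. \<integral>y. \<iota> v y \<partial>N)"
  using bounded_linear_integral[of "\<lambda>_. 1"] by simp

lemma P_apply: "P v = (\<integral>y. \<iota> v y \<partial>N) *\<^sub>R e"
  by transfer simp

lemma P_induces: "induces N \<iota> (\<lambda>v _. \<integral>y. v y \<partial>N) P"
  unfolding induces_def
proof
  fix v
  show "AE y in N. \<iota> (P v) y = (\<integral>y. \<iota> v y \<partial>N)"
    using \<iota>_scale[of "\<integral>y. \<iota> v y \<partial>N" e] \<iota>_e unfolding P_apply by eventually_elim simp
qed

lemma integral_e_mult:
  assumes "w \<in> borel_measurable N"
  shows "(\<integral>y. \<iota> e y * w y \<partial>N) = (\<integral>y. w y \<partial>N)"
proof (rule integral_cong_AE)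
  show "AE y in N. \<iota> e y * w y = w y"
    using \<iota>_e by eventually_elim simp
qed (use assms in measurable)

lemma integral_e: "(\<integral>y. \<iota> e y \<partial>N) = 1"
  using integral_e_mult[of "\<lambda>_. 1"] by (simp add: prob_Y)

lemma e_nonzero: "e \<noteq> 0"
  using integral_e linear_0[OF bounded_linear.linear[OF bounded_linear_mean]] by auto

lemma P_e: "P e = e"
  by (simp add: P_apply integral_e)

lemma summable_Rn: "summable (\<lambda>n. norm (Rn (Suc n)))"
proof -
  obtain C where C: "C > 0" "\<And>n. n \<ge> 1 \<Longrightarrow> norm (Rn n) \<le> C * measure M {y \<in> Y. \<phi> y = n}"
    using H1 by blast
  show ?thesis
  proof (rule summable_comparison_test'[where N = 0])
    show "summable (\<lambda>n. C * measure M {y \<in> Y. \<phi> y = Suc n})"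
      by (rule summable_mult[OF sums_summable[OF sums_measure_level]])
    show "norm (norm (Rn (Suc n))) \<le> C * measure M {y \<in> Y. \<phi> y = Suc n}" for n
      using C(2)[of "Suc n"] by simp
  qed
qed

definition R1 :: "'b \<Rightarrow>\<^sub>L 'b" where "R1 = (\<Sum>n. Rn (Suc n))"

lemma R1_sums: "(\<lambda>n. Rn (Suc n)) sums R1"
  unfolding R1_def by (rule summable_sums[OF summable_norm_cancel[OF summable_Rn]])

text \<open>Sum the dual relations of the \<open>R\<^sub>n\<close> over the level sets of the return time: \<open>R1\<close> is the transfer operator of the return map.\<close>

lemma R1_dual:
  assumes "w \<in> borel_measurable N" "\<And>y. y \<in> Y \<Longrightarrow> \<bar>w y\<bar> \<le> 1"
  shows "(\<integral>y. \<iota> (R1 v) y * w y \<partial>N) = (\<integral>y. \<iota> v y * w (F y) \<partial>N)"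
proof -
  have wF: "(\<lambda>y. w (F y)) \<in> borel_measurable N"
    by (rule measurable_compose[OF return_map_measurable assms(1)])
  have "(\<lambda>n. Rn (Suc n) v) sums R1 v"
    by (rule bounded_linear.sums[OF blinfun.bounded_linear_left R1_sums])
  from bounded_linear.sums[OF bounded_linear_integral[OF assms] this]
  have 1: "(\<lambda>n. \<integral>y. \<iota> v y * (indicator {y. \<phi> y = Suc n} y * w (F y)) \<partial>N) sums (\<integral>y. \<iota> (R1 v) y * w y \<partial>N)"
    using Rn_dual[OF _ assms] by simp
  have int: "integrable N (\<lambda>y. \<iota> v y * (indicator {y. \<phi> y = Suc n} y * w (F y)))" for n
    using assms(2)[OF return_map_in_Y] wF
    by (intro integrable_mult_bounded[OF \<iota>_integrable, where K = 1]) (auto simp: indicator_def)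
  have "(\<lambda>n. \<integral>y. (\<Sum>k<n. \<iota> v y * (indicator {y. \<phi> y = Suc k} y * w (F y))) \<partial>N) \<longlonglongrightarrow> (\<integral>y. \<iota> v y * w (F y) \<partial>N)"
  proof (rule integral_dominated_convergence[where w = "\<lambda>_. norm v"])
    have eq: "(\<Sum>k<n. \<iota> v y * (indicator {y. \<phi> y = Suc k} y * w (F y))) =
        (if \<phi> y \<in> {1..n} then \<iota> v y * w (F y) else 0)" for n y
    proof (cases "\<phi> y")
      case 0
      then show ?thesis by (simp add: indicator_def)
    next
      case (Suc m)
      have "(\<Sum>k<n. \<iota> v y * (indicator {y. \<phi> y = Suc k} y * w (F y))) = (\<Sum>k<n. if k = m then \<iota> v y * w (F y) else 0)"
        using Suc by (intro sum.cong) (auto simp: indicator_def)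
      then show ?thesis using Suc by (simp add: Suc_le_eq)
    qed
    show "AE y in N. (\<lambda>n. \<Sum>k<n. \<iota> v y * (indicator {y. \<phi> y = Suc k} y * w (F y))) \<longlonglongrightarrow> \<iota> v y * w (F y)"
      using AE_returns
    proof eventually_elim
      case (elim y)
      show ?case unfolding eq
        using elim by (intro tendsto_eventually eventually_mono[OF eventually_ge_at_top[of "\<phi> y"]]) auto
    qed
    show "AE y in N. norm (\<Sum>k<n. \<iota> v y * (indicator {y. \<phi> y = Suc k} y * w (F y))) \<le> norm v" for n
      using \<iota>_bound[of v] AE_space
    proof eventually_elim
      case (elim y)
      have "\<bar>\<iota> v y\<bar> * \<bar>w (F y)\<bar> \<le> norm v * 1"
        using elim assms(2)[OF return_map_in_Y] by (intro mult_mono) auto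
      then show ?case unfolding eq by (simp add: abs_mult)
    qed
  qed (use wF in measurable)
  then have "(\<lambda>n. \<integral>y. \<iota> v y * (indicator {y. \<phi> y = Suc n} y * w (F y)) \<partial>N) sums (\<integral>y. \<iota> v y * w (F y) \<partial>N)"
    using int by (simp add: sums_def Bochner_Integration.integral_sum)
  with 1 show ?thesis by (rule sums_unique2)
qed

lemma R1_e: "R1 e = e"
proof (rule \<iota>_inject, rule AE_eqI[OF \<iota>_integrable \<iota>_integrable])
  fix A assume A: "A \<in> sets N"
  have ind: "indicator A \<in> borel_measurable N" using A by simp
  have "(\<integral>y. \<iota> (R1 e) y * indicator A y \<partial>N) = (\<integral>y. \<iota> e y * indicator A (F y) \<partial>N)"
    by (rule R1_dual[OF ind]) (simp add: indicator_def)
  also have "\<dots> = (\<integral>y. indicator A (F y) \<partial>N)"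
    by (rule integral_e_mult[OF measurable_compose[OF return_map_measurable ind]])
  also have "\<dots> = (\<integral>y. indicator A y \<partial>N)"
    by (rule integral_return_map[OF ind])
  also have "\<dots> = (\<integral>y. \<iota> e y * indicator A y \<partial>N)"
    by (rule integral_e_mult[OF ind, symmetric])
  finally show "(\<integral>y. \<iota> (R1 e) y * indicator A y \<partial>N) = (\<integral>y. \<iota> e y * indicator A y \<partial>N)" .
qed

lemma P_R1: "P o\<^sub>L R1 = P"
proof (rule blinfun_eqI)
  fix v
  show "(P o\<^sub>L R1) v = P v"
    using R1_dual[of "\<lambda>_. 1" v] by (simp add: P_apply)
qed

lemma R1_P: "R1 o\<^sub>L P = P"
  by (rule blinfun_eqI) (simp add: P_apply blinfun.scaleR_right R1_e)

lemma P_P: "P o\<^sub>L P = P"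
  by (rule blinfun_eqI) (simp add: P_apply blinfun.scaleR_right P_e[unfolded P_apply] integral_e)

lemma P_Rn_P:
  assumes "n \<ge> 1"
  shows "P o\<^sub>L (Rn n o\<^sub>L P) = measure M {y \<in> Y. \<phi> y = n} *\<^sub>R P"
proof (rule blinfun_eqI)
  fix v
  have "(\<integral>y. \<iota> (Rn n e) y \<partial>N) = (\<integral>y. \<iota> e y * indicator {y. \<phi> y = n} y \<partial>N)"
    using Rn_dual[OF assms, of "\<lambda>_. 1" e] by simp
  also have "\<dots> = (\<integral>y. indicator {y. \<phi> y = n} y \<partial>N)"
    by (rule integral_e_mult) measurable
  also have "\<dots> = measure N {y \<in> Y. \<phi> y = n}"
  proof -
    have "(\<integral>y. indicator {y. \<phi> y = n} y \<partial>N) = measure N ({y. \<phi> y = n} \<inter> space N)"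
      by (rule Bochner_Integration.integral_indicator)
    also have "{y. \<phi> y = n} \<inter> space N = {y \<in> Y. \<phi> y = n}" by auto
    finally show ?thesis .
  qed
  also have "\<dots> = measure M {y \<in> Y. \<phi> y = n}"
    by (rule measure_N) (simp add: sets_N level_set)
  finally show "(P o\<^sub>L (Rn n o\<^sub>L P)) v = (measure M {y \<in> Y. \<phi> y = n} *\<^sub>R P) v"
    by (simp add: P_apply blinfun.scaleR_right blinfun.scaleR_left)
qed

end

section \<open>From return time tails to the renewal asymptotics\<close>

context operator_renewal
begin

definition tail :: "nat \<Rightarrow> real" where "tail n = measure M {y \<in> Y. \<phi> y > n}"

lemma tail_set: "{y \<in> Y. \<phi> y > n} \<in> sets N"
proof -
  have "\<phi> -` {n<..} \<inter> space N \<in> sets N"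
    by (rule measurable_sets[OF return_time_measurable]) simp
  also have "\<phi> -` {n<..} \<inter> space N = {y \<in> Y. \<phi> y > n}" by auto
  finally show ?thesis .
qed

lemma tail_Suc: "tail n - tail (Suc n) = measure M {y \<in> Y. \<phi> y = Suc n}"
proof -
  have lev: "{y \<in> Y. \<phi> y = Suc n} \<in> sets N"
    by (simp add: sets_N level_set)
  have "measure N {y \<in> Y. \<phi> y > n} = measure N ({y \<in> Y. \<phi> y = Suc n} \<union> {y \<in> Y. \<phi> y > Suc n})"
    by (rule arg_cong[where f = "measure N"]) auto
  also have "\<dots> = measure N {y \<in> Y. \<phi> y = Suc n} + measure N {y \<in> Y. \<phi> y > Suc n}"
    by (rule N.finite_measure_Union[OF lev tail_set]) auto
  finally show ?thesis
    using lev tail_set by (simp add: tail_def measure_N)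
qed

sublocale tail: decreasing_seq tail
proof
  show "decseq tail"
    unfolding decseq_Suc_iff using tail_Suc by (metis diff_ge_0_iff_ge measure_nonneg)
qed (simp add: tail_def)

lemma tail_0: "tail 0 = 1"
proof -
  have "AE y in N. y \<in> {y \<in> Y. \<phi> y > 0}"
    using AE_returns AE_space by eventually_elim auto
  then have "measure N {y \<in> Y. \<phi> y > 0} = 1"
    using N.prob_eq_1[OF tail_set] by simp
  then show ?thesis
    by (simp only: tail_def measure_N[OF tail_set])
qed

lemma tail_sum_at_top:
  assumes "(\<integral>\<^sup>+ y. of_nat (\<phi> y) \<partial>N) = \<infinity>"
  shows "filterlim tail.M at_top sequentially"
proof -
  have nn: "(\<integral>\<^sup>+ y. of_nat (\<phi> y) \<partial>N) = (\<Sum>n. ennreal (tail n))"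
  proof -
    have "(\<integral>\<^sup>+ y. of_nat (\<phi> y) \<partial>N) = (\<Sum>n. emeasure N {y \<in> space N. n < \<phi> y})"
      by (rule nn_integral_nat_function) measurable
    also have "\<dots> = (\<Sum>n. ennreal (tail n))"
      using tail_set by (simp add: N.emeasure_eq_measure measure_N tail_def)
    finally show ?thesis .
  qed
  have ns: "\<not> summable tail"
  proof
    assume "summable tail"
    then have "(\<Sum>n. ennreal (tail n)) = ennreal (\<Sum>n. tail n)"
      by (intro suminf_ennreal2 tail.nonneg)
    with nn assms show False by simp
  qed
  show ?thesis
    unfolding filterlim_at_top
  proof
    fix Z
    have "\<exists>n. tail.M n \<ge> Z"
    proof (rule ccontr)
      assume "\<not> ?thesis"
      then have "(\<Sum>k<n. tail k) \<le> Z" for n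
        by (simp add: tail.M_def not_le less_imp_le)
      then have "summable tail"
        by (intro summableI_nonneg_bounded tail.nonneg)
      with ns show False ..
    qed
    then obtain n where "tail.M n \<ge> Z" ..
    then show "\<forall>\<^sub>F n in sequentially. Z \<le> tail.M n"
      using tail.M_mono by (intro eventually_sequentiallyI[of n]) (meson order_trans)
  qed
qed

lemma R_z_1: "R_z Rn 1 = complexify R1"
proof -
  have "(\<lambda>n. complexify (Rn (Suc n))) sums complexify R1"
    by (rule bounded_linear.sums[OF bounded_linear_complexify R1_sums])
  then show ?thesis
    unfolding R_z_def by (simp add: sums_iff)
qed

lemma P_rank_one: "\<exists>a. complexify P v = cscale a (e, 0)"
  by (rule exI[of _ "Complex (\<integral>y. \<iota> (fst v) y \<partial>N) (\<integral>y. \<iota> (snd v) y \<partial>N)"])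
    (simp add: complexify_apply cscale_apply P_apply)

text \<open>The spectral hypotheses supply the reduced resolvent, the invariance of the measure the relations between \<open>P\<close> and \<open>R1\<close>; the rest
is the abstract renewal theorem for operators.\<close>

theorem normalised_transfer_convergence:
  assumes H2i: "simple_isolated_eigenvalue (R_z Rn 1) 1"
    and H2ii: "\<And>z. norm z \<le> 1 \<Longrightarrow> z \<noteq> 1 \<Longrightarrow> 1 \<notin> cspectrum (R_z Rn z)"
    and \<alpha>: "0 \<le> \<alpha>" "\<alpha> < 1 / 2"
    and RV: "\<And>t. t > 0 \<Longrightarrow> (\<lambda>n. tail.M (nat \<lfloor>real n * t\<rfloor>) / tail.M n) \<longlonglongrightarrow> t powr \<alpha>"
  shows "(\<lambda>n. tail.M n *\<^sub>R renewal_sequence Rn n) \<longlonglongrightarrow> (1 / (Gamma (1 - \<alpha>) * Gamma (1 + \<alpha>))) *\<^sub>R P"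
proof -
  have PR: "complexify P o\<^sub>L R_z Rn 1 = complexify P" "R_z Rn 1 o\<^sub>L complexify P = complexify P"
    by (simp_all add: R_z_1 complexify_compose[symmetric] P_R1 R1_P)
  obtain S where S: "S o\<^sub>L (id_blinfun - R_z Rn 1) = id_blinfun - complexify P"
      "(id_blinfun - R_z Rn 1) o\<^sub>L S = id_blinfun - complexify P"
  proof (rule reduced_resolvent[OF H2i _ _ PR])
    show "complex_linear (R_z Rn 1)"
      unfolding R_z_1 by (rule complex_linear_complexify)
    show "complex_linear (complexify P)"
      by (rule complex_linear_complexify)
    show "complexify P (e, 0) = (e, 0)"
      by (simp add: complexify_apply P_e)
    show "(e, 0 :: 'b) \<noteq> 0"
      using e_nonzero by (simp add: zero_prod_def)
  qed (rule P_rank_one)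
  obtain C where C: "C > 0" "\<And>n. n \<ge> 1 \<Longrightarrow> norm (Rn n) \<le> C * measure M {y \<in> Y. \<phi> y = n}"
    using H1 by blast
  interpret ops: renewal_operators tail Rn P C \<alpha> S
  proof
    show "norm (Rn (Suc n)) \<le> C * (tail n - tail (Suc n))" for n
      using C(2)[of "Suc n"] by (simp add: tail_Suc)
    show "P o\<^sub>L (Rn (Suc n) o\<^sub>L P) = (tail n - tail (Suc n)) *\<^sub>R P" for n
      using P_Rn_P[of "Suc n"] by (simp add: tail_Suc)
  qed (fact tail_0 RV \<alpha> C(1) P_P PR S H2ii)+
  show ?thesis
    by (rule ops.renewal_asymptotics)
qed

end

text \<open>Regular variation of the tails passes to their partial sums \<open>M\<close>, provided these diverge. For \<open>\<beta> < 1\<close> they do so automatically.\<close>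

lemma (in decreasing_seq) regularly_varying_partial_sums:
  assumes tails: "\<And>n. n \<ge> 1 \<Longrightarrow> p n = l (real n) * real n powr (- \<beta>)" and p0: "p 0 > 0"
    and sv: "slowly_varying l" and div: "\<beta> \<noteq> 1 \<Longrightarrow> \<beta> < 1" "\<beta> = 1 \<Longrightarrow> filterlim M at_top sequentially"
    and t: "t > 0"
  shows "(\<lambda>n. M (nat \<lfloor>real n * t\<rfloor>) / M n) \<longlonglongrightarrow> t powr (1 - \<beta>)"
proof -
  have lpos: "l x > 0" if "x > 0" for x
    using sv that by (simp add: slowly_varying_def)
  have pos: "p n > 0" for n
    using p0 tails[of n] lpos[of "real n"] by (cases "n = 0") auto
  have lim: "(\<lambda>n. p (m * n) / p n) \<longlonglongrightarrow> real m powr (- \<beta>)" if m: "m > 0" for m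
  proof -
    have "((\<lambda>x. l (real m * x) / l x) \<longlongrightarrow> 1) at_top"
      using sv m by (simp add: slowly_varying_def)
    then have "(\<lambda>n. l (real m * real n) / l (real n)) \<longlonglongrightarrow> 1"
      by (rule filterlim_compose[OF _ filterlim_real_sequentially])
    then have "(\<lambda>n. l (real m * real n) / l (real n) * real m powr (- \<beta>)) \<longlonglongrightarrow> 1 * real m powr (- \<beta>)"
      by (intro tendsto_intros)
    moreover have "\<forall>\<^sub>F n in sequentially. l (real m * real n) / l (real n) * real m powr (- \<beta>) = p (m * n) / p n"
      using eventually_ge_at_top[of 1]
    proof eventually_elim
      case (elim n)
      then have "p (m * n) = l (real m * real n) * (real m powr (- \<beta>) * real n powr (- \<beta>))"
        using m tails[of "m * n"] by (simp add: powr_mult)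
      with elim show ?case by (simp add: tails)
    qed
    ultimately show ?thesis by (simp add: Lim_transform_eventually)
  qed
  have top: "filterlim M at_top sequentially"
    using div M_at_top_of_regular_variation[OF pos] lim[of 2] by (cases "\<beta> = 1") auto
  show ?thesis
    using M_ratio_real[OF M_ratio_integer[OF pos lim _ top] p0 top t] by simp
qed

text \<open>The normalising sequence \<open>m_seq l \<beta> n * n powr (1 - \<beta>)\<close> is \<open>n p n\<close> for \<open>\<beta> < 1\<close> and \<open>M (n + 1) - 1\<close> for \<open>\<beta> = 1\<close>.\<close>

lemma (in decreasing_seq) normalising_sequence_ratio:
  assumes tails: "\<And>n. n \<ge> 1 \<Longrightarrow> p n = l (real n) * real n powr (- \<beta>)" and p0: "p 0 = 1"
    and \<beta>: "0 < \<beta>" "\<beta> \<le> 1"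
    and RV: "\<And>t. t > 0 \<Longrightarrow> (\<lambda>n. M (nat \<lfloor>real n * t\<rfloor>) / M n) \<longlonglongrightarrow> t powr (1 - \<beta>)"
    and div: "\<beta> = 1 \<Longrightarrow> filterlim M at_top sequentially"
  shows "(\<lambda>n. m_seq l \<beta> n * real n powr (1 - \<beta>) / M n) \<longlonglongrightarrow> (if \<beta> = 1 then 1 else 1 - \<beta>)"
proof -
  have dens: "(\<lambda>n. real n * p n / M n) \<longlonglongrightarrow> 1 - \<beta>"
    using p0 by (intro monotone_density RV) auto
  have Mpos: "M n > 0" if "n \<ge> 1" for n
    using M_mono[OF that] p0 by (simp add: M_def)
  show ?thesis
  proof (cases "\<beta> = 1")
    case False
    have "\<forall>\<^sub>F n in sequentially. real n * p n / M n = m_seq l \<beta> n * real n powr (1 - \<beta>) / M n"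
      using eventually_ge_at_top[of 1]
    proof eventually_elim
      case (elim n)
      have "real n * real n powr (- \<beta>) = real n powr (1 - \<beta>)"
        using elim powr_add[of "real n" 1 "- \<beta>"] by simp
      with elim False show ?case by (simp add: tails m_seq_def mult_ac)
    qed
    from Lim_transform_eventually[OF dens this] False show ?thesis by simp
  next
    case True
    have sum: "m_seq l 1 n = M n + p n - 1" for n
    proof -
      have "m_seq l 1 n = (\<Sum>j=1..n. p j)"
        unfolding m_seq_def by (auto intro!: sum.cong simp: tails True powr_minus_divide)
      also have "\<dots> = (\<Sum>j<Suc n. p j) - p 0"
        by (simp only: lessThan_Suc_atMost atMost_atLeast0 sum.atLeast_Suc_atMost[of 0 n p] zero_le One_nat_def)
      finally show ?thesis by (simp add: M_def p0)
    qed
    have "(\<lambda>n. p n / M n) \<longlonglongrightarrow> 0"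
    proof (rule Lim_null_comparison)
      have "(\<lambda>n. 1 / real n) \<longlonglongrightarrow> 0" by (rule lim_1_over_n)
      then show "(\<lambda>n. 1 / real n) \<longlonglongrightarrow> 0" .
      show "\<forall>\<^sub>F n in sequentially. norm (p n / M n) \<le> 1 / real n"
        using eventually_ge_at_top[of 1]
        by eventually_elim (use p_le_average Mpos nonneg in \<open>simp add: field_simps abs_of_nonneg abs_of_pos\<close>)
    qed
    moreover have "(\<lambda>n. 1 / M n) \<longlonglongrightarrow> 0"
      using div[OF True] by (intro tendsto_divide_0[OF tendsto_const] filterlim_at_top_imp_at_infinity)
    ultimately have "(\<lambda>n. 1 + p n / M n - 1 / M n) \<longlonglongrightarrow> 1 + 0 - 0"
      by (intro tendsto_intros)
    moreover have "\<forall>\<^sub>F n in sequentially. 1 + p n / M n - 1 / M n = m_seq l \<beta> n * real n powr (1 - \<beta>) / M n"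
      using eventually_ge_at_top[of 1]
    proof eventually_elim
      case (elim n)
      with Mpos[OF elim] show ?case by (simp add: True sum diff_divide_distrib add_divide_distrib)
    qed
    ultimately show ?thesis
      using True by (simp add: Lim_transform_eventually)
  qed
qed

lemma d_const_Gamma:
  assumes "0 < \<beta>" "\<beta> \<le> 1"
  shows "(if \<beta> = 1 then 1 else 1 - \<beta>) * (1 / (Gamma (1 - (1 - \<beta>)) * Gamma (1 + (1 - \<beta>)))) = d_const \<beta>"
proof (cases "\<beta> = 1")
  case False
  with assms have b: "1 - \<beta> > 0" by simp
  have "Gamma (1 + (1 - \<beta>)) = (1 - \<beta>) * Gamma (1 - \<beta>)"
    using Gamma_plus1[of "1 - \<beta>"] b by (simp add: add.commute nonpos_Ints_def)
  then have "(1 - \<beta>) * (1 / (Gamma (1 - (1 - \<beta>)) * Gamma (1 + (1 - \<beta>)))) = 1 / (Gamma \<beta> * Gamma (1 - \<beta>))"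
    using b by simp
  also have "Gamma \<beta> * Gamma (1 - \<beta>) = pi / sin (pi * \<beta>)"
  proof -
    have "complex_of_real (Gamma \<beta> * Gamma (1 - \<beta>)) = Gamma (of_real \<beta>) * Gamma (1 - of_real \<beta>)"
      by (simp flip: Gamma_complex_of_real)
    also have "\<dots> = of_real pi / sin (of_real pi * of_real \<beta>)"
      by (rule Gamma_reflection_complex)
    also have "\<dots> = complex_of_real (pi / sin (pi * \<beta>))"
      by (simp flip: sin_of_real)
    finally show ?thesis by (simp only: of_real_eq_iff)
  qed
  finally show ?thesis
    using False by (simp add: d_const_def mult.commute)
qed (simp add: d_const_def)

theorem theorem2p1:
  fixes M :: "'a measure" and f :: "'a \<Rightarrow> 'a" and Y :: "'a set"
    and l :: "real \<Rightarrow> real" and \<beta> :: real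
    and L R :: "('a \<Rightarrow> real) \<Rightarrow> ('a \<Rightarrow> real)"
    and \<iota> :: "'b::banach \<Rightarrow> 'a \<Rightarrow> real"
    and Rn :: "nat \<Rightarrow> 'b \<Rightarrow>\<^sub>L 'b"
  assumes infinite_measure: "emeasure M (space M) = \<infinity>"
    and preserving: "measure_preserving_map M f"
    and conservative: "conservative M f"
    and Y: "Y \<in> sets M" "emeasure M Y = 1"
    and nonintegrable: "\<beta> = 1 \<Longrightarrow> (\<integral>\<^sup>+ y. of_nat (return_time f Y y) \<partial>restrict_space M Y) = \<infinity>"
    and beta: "1 / 2 < \<beta>" "\<beta> \<le> 1"
    and slowly_varying: "slowly_varying l"
    and tails: "\<And>n::nat. n \<ge> 1 \<Longrightarrow>
      measure M {y \<in> Y. return_time f Y y > n} = l (real n) * real n powr (- \<beta>)"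
    and L: "transfer_operator M f L"
    and R: "transfer_operator (restrict_space M Y) (return_map f Y) R"
    and B: "banach_function_space (restrict_space M Y) \<iota>"
    and Rn: "\<And>n. n \<ge> 1 \<Longrightarrow> induces (restrict_space M Y) \<iota>
      (\<lambda>v. R (\<lambda>y. indicator {y. return_time f Y y = n} y * v y)) (Rn n)"
    and H1: "\<exists>C>0. \<forall>n\<ge>1. norm (Rn n) \<le> C * measure M {y \<in> Y. return_time f Y y = n}"
    and H2i: "simple_isolated_eigenvalue (R_z Rn 1) 1"
    and H2ii: "\<And>z. norm z \<le> 1 \<Longrightarrow> z \<noteq> 1 \<Longrightarrow> 1 \<notin> cspectrum (R_z Rn z)"
  shows "\<exists>(T :: nat \<Rightarrow> 'b \<Rightarrow>\<^sub>L 'b) (P :: 'b \<Rightarrow>\<^sub>L 'b).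
    (\<forall>n. induces (restrict_space M Y) \<iota>
      (\<lambda>v x. indicator Y x * (L ^^ n) (\<lambda>x. indicator Y x * v x) x) (T n)) \<and>
    induces (restrict_space M Y) \<iota> (\<lambda>v _. \<integral>y. v y \<partial>restrict_space M Y) P \<and>
    (\<lambda>n. (m_seq l \<beta> n * real n powr (1 - \<beta>)) *\<^sub>R T n) \<longlonglongrightarrow> d_const \<beta> *\<^sub>R P"
proof -
  interpret operator_renewal M f Y L R \<iota> Rn
    by unfold_locales (rule preserving conservative Y L R B H1 Rn | assumption)+
  have p: "tail n = l (real n) * real n powr (- \<beta>)" if "n \<ge> 1" for n
    using tails[OF that] by (simp add: tail_def)
  have top: "filterlim tail.M at_top sequentially" if "\<beta> = 1"
    by (rule tail_sum_at_top[OF nonintegrable[OF that]])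
  have RV: "(\<lambda>n. tail.M (nat \<lfloor>real n * t\<rfloor>) / tail.M n) \<longlonglongrightarrow> t powr (1 - \<beta>)" if "t > 0" for t
    using tail.regularly_varying_partial_sums[OF p _ slowly_varying _ top that] beta tail_0 by auto
  have ratio: "(\<lambda>n. m_seq l \<beta> n * real n powr (1 - \<beta>) / tail.M n) \<longlonglongrightarrow> (if \<beta> = 1 then 1 else 1 - \<beta>)"
    using beta by (intro tail.normalising_sequence_ratio[OF p tail_0 _ _ RV top]) auto
  have T: "(\<lambda>n. tail.M n *\<^sub>R renewal_sequence Rn n) \<longlonglongrightarrow> (1 / (Gamma (1 - (1 - \<beta>)) * Gamma (1 + (1 - \<beta>)))) *\<^sub>R P"
    using beta by (intro normalised_transfer_convergence[OF H2i H2ii _ _ RV]) auto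
  have "(\<lambda>n. (m_seq l \<beta> n * real n powr (1 - \<beta>) / tail.M n) *\<^sub>R (tail.M n *\<^sub>R renewal_sequence Rn n)) \<longlonglongrightarrow>
      (if \<beta> = 1 then 1 else 1 - \<beta>) *\<^sub>R ((1 / (Gamma (1 - (1 - \<beta>)) * Gamma (1 + (1 - \<beta>)))) *\<^sub>R P)"
    by (rule tendsto_scaleR[OF ratio T])
  also have "(if \<beta> = 1 then 1 else 1 - \<beta>) *\<^sub>R ((1 / (Gamma (1 - (1 - \<beta>)) * Gamma (1 + (1 - \<beta>)))) *\<^sub>R P) = d_const \<beta> *\<^sub>R P"
    unfolding scaleR_scaleR using d_const_Gamma[of \<beta>] beta by simp
  finally have lim: "(\<lambda>n. (m_seq l \<beta> n * real n powr (1 - \<beta>) / tail.M n) *\<^sub>R (tail.M n *\<^sub>R renewal_sequence Rn n)) \<longlonglongrightarrow> d_const \<beta> *\<^sub>R P" .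
  have "\<forall>\<^sub>F n in sequentially. (m_seq l \<beta> n * real n powr (1 - \<beta>) / tail.M n) *\<^sub>R (tail.M n *\<^sub>R renewal_sequence Rn n) =
      (m_seq l \<beta> n * real n powr (1 - \<beta>)) *\<^sub>R renewal_sequence Rn n"
    using eventually_ge_at_top[of 1]
  proof eventually_elim
    case (elim n)
    have "tail.M n \<ge> tail.M 1" by (rule tail.M_mono[OF elim])
    then have "tail.M n \<noteq> 0" by (simp add: tail.M_def tail_0)
    then show ?case by simp
  qed
  with lim have "(\<lambda>n. (m_seq l \<beta> n * real n powr (1 - \<beta>)) *\<^sub>R renewal_sequence Rn n) \<longlonglongrightarrow> d_const \<beta> *\<^sub>R P"
    by (rule Lim_transform_eventually)
  with renewal_sequence_induces P_induces show ?thesis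
    by blast
qed

end
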